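(* Let $d\ge1$, let $\Omega\subset\mathbb{R}^d$ be a bounded convex polyhedral domain, and let $\mathcal{T}_1,\dots,\mathcal{T}_J=\mathcal{T}_h$ ($J\ge 1$) be triangulations of $\Omega$ such that $\mathcal{T}_l$ is a refinement of $\mathcal{T}_{l-1}$ for $2\le l\le J$ and the mesh sizes $h_l$ of $\mathcal{T}_l$ satisfy $c_1\gamma^{2l}\le h_l\le c_2\gamma^{2l}$, $1\le l\le J$, for some $\gamma\in(0,1)$ and constants $0<c_1\le c_2$. Suppose that $\mathcal{T}_h$ satisfies condition $\mathrm{(T)}$ of the context for some parameters $\rho,\sigma,C_0>0$. Define, for $v\in V_{h,0}$, $$Bv=\sum_{l=1}^Jh_l^2Q_lv,\qquad B_{\mathrm{Jac}}v=\sum_{l=1}^Jh_l^2\sum_{i=1}^{N_l}Q_i^lv,$$ where $Q_l$ is the $L^2(\Omega)$-orthogonal projection onto $V_l$, $N_l$ is the number of interior vertices of $\mathcal{T}_l$, $\{\phi_i^l\}_{i=1}^{N_l}$ is the nodal basis of $V_l$, and $Q_i^l$ is the $L^2(\Omega)$-orthogonal projection onto $\operatorname{span}\{\phi_i^l\}$. Then $$\tfrac12(Bv,v)_{L^2(\Omega)}\le(B_{\mathrm{Jac}}v,v)_{L^2(\Omega)}\le\tfrac{d+2}{2}(Bv,v)_{L^2(\Omega)},\qquad v\in V_{h,0}.$$ Consequently, $$\kappa(B_{\mathrm{Jac}}A)\le(d+2)\,\kappa(BA),$$ where $A\colon V_{h,0}\to V_{h,0}$ is defined by $(Av,w)_{L^2(\Omega)}=\int_\Omega\nabla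 v\cdot\nabla w\,dx$.
   Context: Simplices are open sets. For a $d$-simplex $\tau$: $h_\tau$ is its diameter, $r_\tau$ its inradius, $\mathcal{V}(\tau)$ its vertices, $\mathcal{F}(\tau)$ its $(d-1)$-faces. A triangulation $\mathcal{T}$ of $\Omega$ is a finite conforming collection of pairwise disjoint $d$-simplices whose closures have union $\overline\Omega$; its mesh size is $\max_{\tau}h_\tau$. $\mathcal{T}'$ is a refinement of $\mathcal{T}$ if every element of $\mathcal{T}'$ is contained in an element of $\mathcal{T}$. The vertex patch $\omega_a$ of a vertex $a$ is the open set (interior of the closure) with $\overline{\omega}_a=\bigcup\{\overline\tau:\tau\in\mathcal{T},\ a\in\mathcal{V}(\tau)\}$. Condition (T) for a triangulation $\mathcal{T}$ of mesh size $h$, with parameters $\rho,\sigma,C_0$: (a) $h_\tau\le\rho r_\tau$ and $\sigma h\le h_\tau\le h$ for all $\tau\in\mathcal{T}$, and every vertex patch is convex; (b) for each vertex $a\in\partial\Omega$, with $\mathcal{K}_a$ the set of $(d-1)$-faces $K\subset\partial\Omega$ of $\mathcal{T}$ having $a$ as a vertex, $\tau_K$ the unique element with $K\in\mathcal{F}(\tau_K)$, and $\mu_{a,K}=|K|/\#(\mathcal{K}_a\cap\mathcal{F}(\tau_K))$, one has $|\omega_a|\le C_0h\sum_{K\in\mathcal{K}_a}\mu_{a,K}$. $V_l=\{v\in H_0^1(\Omega):v|_\tau\in\mathbb{P}_1(\tau)\ \forall\tau\in\mathcal{T}_l\}$ ($\mathbb{P}_1$ = affine functions), $V_{h,0}=V_J$.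 The nodal basis function $\phi_i^l\in V_l$ equals $1$ at the $i$-th interior vertex of $\mathcal{T}_l$ and $0$ at all other vertices. For a symmetric positive definite operator $M$ on $V_{h,0}$ (with respect to the $L^2(\Omega)$ inner product), $\kappa(MA)$ is the ratio of the supremum to the infimum of $(Av,v)_{L^2(\Omega)}/(M^{-1}v,v)_{L^2(\Omega)}$ over $v\in V_{h,0}\setminus\{0\}$ (for $V_{h,0}\neq\{0\}$). *)

theory Defs
  imports "HOL-Analysis.Analysis"
begin

section \<open>Sobolev spaces on an open set\<close>

text \<open>
  Elements of Lebesgue and Sobolev spaces are represented by functions on the whole space; only
  their values on \<open>\<Omega>\<close> matter, and two functions that agree almost everywhere on \<open>\<Omega>\<close> represent the
  same element. Everything below that is defined through integrals over \<open>\<Omega>\<close> depends only on the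
  represented element. An operator is a map on representatives; where it is defined by a
  characterizing equation, \<open>SOME\<close> picks one representative of its (unique) value.
\<close>

definition ae_eq :: "'a::euclidean_space set \<Rightarrow> ('a \<Rightarrow> real) \<Rightarrow> ('a \<Rightarrow> real) \<Rightarrow> bool" where
  "ae_eq \<Omega> u v \<longleftrightarrow> (AE x in lebesgue. x \<in> \<Omega> \<longrightarrow> u x = v x)"

definition L2 :: "'a::euclidean_space set \<Rightarrow> ('a \<Rightarrow> 'b::euclidean_space) set" where
  "L2 \<Omega> = {f. set_borel_measurable lebesgue \<Omega> f \<and> set_integrable lebesgue \<Omega> (\<lambda>x. (norm (f x))\<^sup>2)}"

definition l2_inner :: "'a::euclidean_space set \<Rightarrow> ('a \<Rightarrow> real) \<Rightarrow> ('a \<Rightarrow> real) \<Rightarrow> real" where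
  "l2_inner \<Omega> u v = (LINT x:\<Omega>|lebesgue. u x * v x)"

primrec Ck :: "nat \<Rightarrow> ('a::euclidean_space \<Rightarrow> real) \<Rightarrow> bool" where
  "Ck 0 f \<longleftrightarrow> continuous_on UNIV f"
| "Ck (Suc k) f \<longleftrightarrow> (\<forall>x. f differentiable (at x)) \<and>
     (\<forall>b\<in>Basis. Ck k (\<lambda>x. frechet_derivative f (at x) b))"

definition test_functions :: "'a::euclidean_space set \<Rightarrow> ('a \<Rightarrow> real) set" where
  "test_functions \<Omega> = {\<psi>. (\<forall>k. Ck k \<psi>) \<and> compact (closure {x. \<psi> x \<noteq> 0}) \<and> closure {x. \<psi> x \<noteq> 0} \<subseteq> \<Omega>}"

definition has_weak_gradient :: "'a::euclidean_space set \<Rightarrow> ('a \<Rightarrow> real) \<Rightarrow> ('a \<Rightarrow> 'a) \<Rightarrow> bool" where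
  "has_weak_gradient \<Omega> v g \<longleftrightarrow> (\<forall>\<psi>\<in>test_functions \<Omega>. \<forall>b\<in>Basis.
     (LINT x:\<Omega>|lebesgue. v x * frechet_derivative \<psi> (at x) b) = - (LINT x:\<Omega>|lebesgue. (g x \<bullet> b) * \<psi> x))"

definition H1 :: "'a::euclidean_space set \<Rightarrow> ('a \<Rightarrow> real) set" where
  "H1 \<Omega> = {v \<in> L2 \<Omega>. \<exists>g\<in>L2 \<Omega>. has_weak_gradient \<Omega> v g}"

definition weak_grad :: "'a::euclidean_space set \<Rightarrow> ('a \<Rightarrow> real) \<Rightarrow> 'a \<Rightarrow> 'a" where
  "weak_grad \<Omega> v = (SOME g. g \<in> L2 \<Omega> \<and> has_weak_gradient \<Omega> v g)"

definition dirichlet_form :: "'a::euclidean_space set \<Rightarrow> ('a \<Rightarrow> real) \<Rightarrow> ('a \<Rightarrow> real) \<Rightarrow> real" where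
  "dirichlet_form \<Omega> v w = (LINT x:\<Omega>|lebesgue. weak_grad \<Omega> v x \<bullet> weak_grad \<Omega> w x)"

definition H1_norm :: "'a::euclidean_space set \<Rightarrow> ('a \<Rightarrow> real) \<Rightarrow> real" where
  "H1_norm \<Omega> v = sqrt (l2_inner \<Omega> v v + dirichlet_form \<Omega> v v)"

definition H10 :: "'a::euclidean_space set \<Rightarrow> ('a \<Rightarrow> real) set" where
  "H10 \<Omega> = {v \<in> H1 \<Omega>. \<forall>\<epsilon>>0. \<exists>\<psi>\<in>test_functions \<Omega>. H1_norm \<Omega> (\<lambda>x. v x - \<psi> x) < \<epsilon>}"


section \<open>Triangulations\<close>

definition convex_polyhedral_domain :: "'a::euclidean_space set \<Rightarrow> bool" where
  "convex_polyhedral_domain \<Omega> \<longleftrightarrow>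
     open \<Omega> \<and> \<Omega> \<noteq> {} \<and> bounded \<Omega> \<and> convex \<Omega> \<and> polyhedron (closure \<Omega>)"

definition open_simplex :: "'a::euclidean_space set \<Rightarrow> bool" where
  "open_simplex \<tau> \<longleftrightarrow> (\<exists>S. int DIM('a) simplex S \<and> \<tau> = interior S)"

definition simplex_vertices :: "'a::euclidean_space set \<Rightarrow> 'a set" where
  "simplex_vertices \<tau> = {a. a extreme_point_of closure \<tau>}"

text \<open>The faces of codimension one are taken closed.\<close>

definition simplex_faces :: "'a::euclidean_space set \<Rightarrow> 'a set set" where
  "simplex_faces \<tau> = {K. K facet_of closure \<tau>}"

definition inradius :: "'a::euclidean_space set \<Rightarrow> real" where
  "inradius \<tau> = Sup {r. \<exists>c. ball c r \<subseteq> \<tau>}"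

text \<open>
  The library predicate \<^const>\<open>triangulation\<close>, applied to the closed simplices, expresses
  conformity: the closures of any two elements meet in a (possibly empty) common face.
\<close>

definition triangulation_of :: "'a::euclidean_space set \<Rightarrow> 'a set set \<Rightarrow> bool" where
  "triangulation_of \<Omega> T \<longleftrightarrow> finite T \<and> (\<forall>\<tau>\<in>T. open_simplex \<tau>) \<and> pairwise disjnt T \<and>
     triangulation (closure ` T) \<and> \<Union>(closure ` T) = closure \<Omega>"

definition mesh_size :: "'a::euclidean_space set set \<Rightarrow> real" where
  "mesh_size T = Max (diameter ` T)"

definition is_refinement :: "'a set set \<Rightarrow> 'a set set \<Rightarrow> bool" where
  "is_refinement T' T \<longleftrightarrow> (\<forall>\<tau>'\<in>T'. \<exists>\<tau>\<in>T. \<tau>' \<subseteq> \<tau>)"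

definition mesh_vertices :: "'a::euclidean_space set set \<Rightarrow> 'a set" where
  "mesh_vertices T = (\<Union>\<tau>\<in>T. simplex_vertices \<tau>)"

definition interior_vertices :: "'a::euclidean_space set \<Rightarrow> 'a set set \<Rightarrow> 'a set" where
  "interior_vertices \<Omega> T = mesh_vertices T \<inter> \<Omega>"

definition vertex_patch :: "'a::euclidean_space set set \<Rightarrow> 'a \<Rightarrow> 'a set" where
  "vertex_patch T a = interior (\<Union>{closure \<tau> |\<tau>. \<tau> \<in> T \<and> a \<in> simplex_vertices \<tau>})"

text \<open>
  The (d-1)-dimensional measure of a subset \<open>K\<close> of a hyperplane with unit normal \<open>n\<close>, as the
  d-dimensional measure of the right prism of height 1 over \<open>K\<close>. (For d = 1, a point has measure 1.)
\<close>

definition face_measure :: "'a::euclidean_space set \<Rightarrow> real" where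
  "face_measure K =
     (let n = (SOME n. norm n = 1 \<and> (\<forall>x\<in>K. \<forall>y\<in>K. n \<bullet> (x - y) = 0))
      in measure lebesgue {x + t *\<^sub>R n |x t. x \<in> K \<and> t \<in> {0..1}})"

definition boundary_faces :: "'a::euclidean_space set \<Rightarrow> 'a set set \<Rightarrow> 'a \<Rightarrow> 'a set set" where
  "boundary_faces \<Omega> T a =
     {K. (\<exists>\<tau>\<in>T. K \<in> simplex_faces \<tau>) \<and> K \<subseteq> frontier \<Omega> \<and> a extreme_point_of K}"

definition face_element :: "'a::euclidean_space set set \<Rightarrow> 'a set \<Rightarrow> 'a set" where
  "face_element T K = (THE \<tau>. \<tau> \<in> T \<and> K \<in> simplex_faces \<tau>)"

definition face_weight :: "'a::euclidean_space set \<Rightarrow> 'a set set \<Rightarrow> 'a \<Rightarrow> 'a set \<Rightarrow> real" where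
  "face_weight \<Omega> T a K =
     face_measure K / real (card (boundary_faces \<Omega> T a \<inter> simplex_faces (face_element T K)))"

definition condition_T ::
  "'a::euclidean_space set \<Rightarrow> 'a set set \<Rightarrow> real \<Rightarrow> real \<Rightarrow> real \<Rightarrow> bool" where
  "condition_T \<Omega> T \<rho> \<sigma> C0 \<longleftrightarrow>
     (\<forall>\<tau>\<in>T. diameter \<tau> \<le> \<rho> * inradius \<tau> \<and>
            \<sigma> * mesh_size T \<le> diameter \<tau> \<and> diameter \<tau> \<le> mesh_size T) \<and>
     (\<forall>a\<in>mesh_vertices T. convex (vertex_patch T a)) \<and>
     (\<forall>a\<in>mesh_vertices T \<inter> frontier \<Omega>.
        measure lebesgue (vertex_patch T a)
          \<le> C0 * mesh_size T * (\<Sum>K\<in>boundary_faces \<Omega> T a. face_weight \<Omega> T a K))"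


section \<open>Finite element spaces and operators\<close>

text \<open>
  Representatives are required to be affine on each open simplex; their values on the skeleton,
  a null set, are unconstrained. With this choice the spaces of nested triangulations are nested
  as sets of functions.
\<close>

definition fe_space :: "'a::euclidean_space set \<Rightarrow> 'a set set \<Rightarrow> ('a \<Rightarrow> real) set" where
  "fe_space \<Omega> T = {v \<in> H10 \<Omega>. \<forall>\<tau>\<in>T. \<exists>p c. \<forall>x\<in>\<tau>. v x = p \<bullet> x + c}"

text \<open>Vertex values are those of the representative that is continuous on the closure of \<open>\<Omega>\<close>.\<close>

definition nodal_basis_fun :: "'a::euclidean_space set \<Rightarrow> 'a set set \<Rightarrow> 'a \<Rightarrow> 'a \<Rightarrow> real" where
  "nodal_basis_fun \<Omega> T a = (SOME \<phi>. \<phi> \<in> fe_space \<Omega> T \<and> continuous_on (closure \<Omega>) \<phi> \<and>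
     \<phi> a = 1 \<and> (\<forall>b\<in>mesh_vertices T - {a}. \<phi> b = 0))"

definition l2_proj :: "'a::euclidean_space set \<Rightarrow> ('a \<Rightarrow> real) set \<Rightarrow> ('a \<Rightarrow> real) \<Rightarrow> 'a \<Rightarrow> real" where
  "l2_proj \<Omega> W v = (SOME w. w \<in> W \<and> (\<forall>z\<in>W. l2_inner \<Omega> (\<lambda>x. v x - w x) z = 0))"

definition fun_span :: "('a \<Rightarrow> real) \<Rightarrow> ('a \<Rightarrow> real) set" where
  "fun_span \<phi> = {\<lambda>x. c * \<phi> x |c. True}"

definition B_op ::
  "'a::euclidean_space set \<Rightarrow> (nat \<Rightarrow> 'a set set) \<Rightarrow> nat \<Rightarrow> ('a \<Rightarrow> real) \<Rightarrow> 'a \<Rightarrow> real" where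
  "B_op \<Omega> T J v = (\<lambda>x. \<Sum>l=1..J. (mesh_size (T l))\<^sup>2 * l2_proj \<Omega> (fe_space \<Omega> (T l)) v x)"

definition B_Jac ::
  "'a::euclidean_space set \<Rightarrow> (nat \<Rightarrow> 'a set set) \<Rightarrow> nat \<Rightarrow> ('a \<Rightarrow> real) \<Rightarrow> 'a \<Rightarrow> real" where
  "B_Jac \<Omega> T J v = (\<lambda>x. \<Sum>l=1..J. (mesh_size (T l))\<^sup>2 *
     (\<Sum>a\<in>interior_vertices \<Omega> (T l). l2_proj \<Omega> (fun_span (nodal_basis_fun \<Omega> (T l) a)) v x))"

definition A_op ::
  "'a::euclidean_space set \<Rightarrow> ('a \<Rightarrow> real) set \<Rightarrow> ('a \<Rightarrow> real) \<Rightarrow> 'a \<Rightarrow> real" where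
  "A_op \<Omega> V v = (SOME u. u \<in> V \<and> (\<forall>w\<in>V. l2_inner \<Omega> u w = dirichlet_form \<Omega> v w))"

definition op_inverse ::
  "'a::euclidean_space set \<Rightarrow> ('a \<Rightarrow> real) set \<Rightarrow> (('a \<Rightarrow> real) \<Rightarrow> 'a \<Rightarrow> real) \<Rightarrow> ('a \<Rightarrow> real) \<Rightarrow> 'a \<Rightarrow> real"
  where
  "op_inverse \<Omega> V M v = (SOME w. w \<in> V \<and> ae_eq \<Omega> (M w) v)"

definition nonzero_elements :: "'a::euclidean_space set \<Rightarrow> ('a \<Rightarrow> real) set \<Rightarrow> ('a \<Rightarrow> real) set" where
  "nonzero_elements \<Omega> V = {v \<in> V. \<not> ae_eq \<Omega> v (\<lambda>x. 0)}"

definition kappa ::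
  "'a::euclidean_space set \<Rightarrow> ('a \<Rightarrow> real) set \<Rightarrow> (('a \<Rightarrow> real) \<Rightarrow> 'a \<Rightarrow> real) \<Rightarrow> (('a \<Rightarrow> real) \<Rightarrow> 'a \<Rightarrow> real) \<Rightarrow> real"
  where
  "kappa \<Omega> V M A =
     (SUP v\<in>nonzero_elements \<Omega> V. l2_inner \<Omega> (A v) v / l2_inner \<Omega> (op_inverse \<Omega> V M v) v) /
     (INF v\<in>nonzero_elements \<Omega> V. l2_inner \<Omega> (A v) v / l2_inner \<Omega> (op_inverse \<Omega> V M v) v)"

end

theory Submission
  imports Defs
begin

text \<open>
  On each level both quadratic forms are expressed through the mass matrix \<open>M\<close> of the nodal basis and
  its diagonal \<open>D\<close>: if \<open>c\<close> is the coefficient vector of \<open>Q\<^sub>l v\<close>, then \<open>(Q\<^sub>l v, v) = c\<^sup>T M c\<close> and the Jacobi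
  sum is \<open>c\<^sup>T M D\<inverse> M c\<close>. So the claim is \<open>D/2 \<le> M \<le> (d+2)/2 D\<close>, which holds element by element because
  on a simplex \<open>\<integral>\<lambda>\<^sub>i\<lambda>\<^sub>j\<close> is half of \<open>\<integral>\<lambda>\<^sub>i\<^sup>2\<close> for \<open>i \<noteq> j\<close>. The latter follows from two affine changes of variables:
  the exchange of two vertices, and the map onto the half simplex \<open>\<lambda>\<^sub>i \<ge> \<lambda>\<^sub>j\<close>.

  That the nodal functions span the finite element space needs two facts about \<open>H10\<close>. The zero
  extension of a piecewise affine element has a bounded weak gradient on the whole space, hence is
  Lipschitz; conversely, a Lipschitz piecewise affine function that vanishes outside the convex
  domain is approximated by test functions after dilation and mollification.
\<close>

section \<open>Smooth functions and test functions\<close>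

text \<open>Both constants come from one matrix: on a d-simplex the mass matrix is (\<alpha>/2)(I +
  ee^T) with diagonal \<alpha>, where e is the all-ones vector of length d+1, so its eigenvalues are
  \<alpha>/2 and (d+2)\<alpha>/2. Setting coefficients at boundary vertices to zero lets the element
  bounds add up to bounds for the interior nodes. The passage to the Jacobi form is two weighted
  Cauchy-Schwarz estimates instead of a matrix inverse. Inversion reverses the order of quadratic
  forms, so in the condition numbers the factors 2 and (d+2)/2 multiply to d+2.

  The obstacle is that a finite element function has arbitrary values on the skeleton and that
  projections, gradients and inverses are chosen representatives: pointwise linear algebra fails.
  The algebra is therefore carried by positive semidefinite forms, which do not see null sets, and
  existence comes from a Riesz lemma that tolerates null vectors. Since \<open>kappa\<close> is a
  quotient of a real supremum and infimum, the Rayleigh quotients must also be shown to be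
  bounded.\<close>

definition smooth :: "('a::euclidean_space \<Rightarrow> real) \<Rightarrow> bool" where
  "smooth f \<longleftrightarrow> (\<forall>k. Ck k f)"

section \<open>Calculus of k times continuously differentiable functions\<close>

lemma Ck_SucI:
  assumes "\<And>x. (f has_derivative f' x) (at x)" and "\<And>b. b \<in> Basis \<Longrightarrow> Ck k (\<lambda>x. f' x b)"
  shows "Ck (Suc k) f"
proof -
  have "frechet_derivative f (at x) = f' x" for x
    using assms(1) frechet_derivative_at by metis
  then show ?thesis
    using assms by (auto simp: differentiable_def)
qed

lemma Ck_Suc_D: "Ck (Suc k) f \<Longrightarrow> Ck k f"
proof (induction k arbitrary: f)
  case 0
  then show ?case
    by (auto intro!: differentiable_imp_continuous_on simp: differentiable_on_def)
qed auto

lemma Ck_has_derivative: "Ck (Suc k) f \<Longrightarrow> (f has_derivative frechet_derivative f (at x)) (at x)"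
  by (simp add: frechet_derivative_works)

lemma Ck_const: "Ck k (\<lambda>x. c)"
proof (induction k arbitrary: c)
  case (Suc k)
  show ?case by (rule Ck_SucI[where f'="\<lambda>x h. 0"]) (auto intro: Suc)
qed auto

lemma Ck_add: "Ck k f \<Longrightarrow> Ck k g \<Longrightarrow> Ck k (\<lambda>x. f x + g x)"
proof (induction k arbitrary: f g)
  case 0
  then show ?case by (auto intro: continuous_intros)
next
  case (Suc k)
  show ?case
    by (rule Ck_SucI[OF has_derivative_add[OF Ck_has_derivative[OF Suc.prems(1)] Ck_has_derivative[OF Suc.prems(2)]]])
       (use Suc in auto)
qed

text \<open>The product rule leaves one factor undifferentiated, so the induction also has to lower
  the order of the hypotheses by \<open>Ck_Suc_D\<close>.\<close>

lemma Ck_mult: "Ck k f \<Longrightarrow> Ck k g \<Longrightarrow> Ck k (\<lambda>x. f x * g x)"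
proof (induction k arbitrary: f g)
  case 0
  then show ?case by (auto intro: continuous_intros)
next
  case (Suc k)
  show ?case
    by (rule Ck_SucI[OF has_derivative_mult[OF Ck_has_derivative[OF Suc.prems(1)] Ck_has_derivative[OF Suc.prems(2)]]])
       (use Suc Ck_Suc_D[OF Suc.prems(1)] Ck_Suc_D[OF Suc.prems(2)] in \<open>auto intro!: Ck_add\<close>)
qed

lemma smooth_const: "smooth (\<lambda>x. c)"
  by (simp add: smooth_def Ck_const)

lemma smooth_add: "smooth f \<Longrightarrow> smooth g \<Longrightarrow> smooth (\<lambda>x. f x + g x)"
  by (simp add: smooth_def Ck_add)

lemma smooth_mult: "smooth f \<Longrightarrow> smooth g \<Longrightarrow> smooth (\<lambda>x. f x * g x)"
  by (simp add: smooth_def Ck_mult)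

lemma smooth_diff: "smooth f \<Longrightarrow> smooth g \<Longrightarrow> smooth (\<lambda>x. f x - g x)"
  using smooth_add[of f "\<lambda>x. (-1) * g x"] smooth_mult[OF smooth_const[of "-1"], of g] by simp

lemma smooth_prod: "(\<And>i. i \<in> I \<Longrightarrow> smooth (f i)) \<Longrightarrow> smooth (\<lambda>x. \<Prod>i\<in>I. f i x)"
  by (induction I rule: infinite_finite_induct) (auto intro: smooth_const smooth_mult)

lemma smooth_sum: "(\<And>i. i \<in> I \<Longrightarrow> smooth (f i)) \<Longrightarrow> smooth (\<lambda>x. \<Sum>i\<in>I. f i x)"
  by (induction I rule: infinite_finite_induct) (auto intro: smooth_const smooth_add)

lemma smooth_inner: "smooth (\<lambda>x. x \<bullet> b)"
  unfolding smooth_def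
proof
  fix k show "Ck k (\<lambda>x. x \<bullet> b)"
  proof (cases k)
    case (Suc n)
    show ?thesis unfolding Suc
      by (rule Ck_SucI[where f'="\<lambda>x h. h \<bullet> b"]) (auto intro!: derivative_eq_intros Ck_const)
  qed (auto intro: continuous_intros)
qed

lemma smooth_has_derivative: "smooth f \<Longrightarrow> (f has_derivative frechet_derivative f (at x)) (at x)"
  using Ck_has_derivative unfolding smooth_def by blast

lemma smooth_partial: "smooth f \<Longrightarrow> b \<in> Basis \<Longrightarrow> smooth (\<lambda>x. frechet_derivative f (at x) b)"
  unfolding smooth_def by (metis Ck.simps(2))

lemma smooth_continuous: "smooth f \<Longrightarrow> continuous_on S f"
  unfolding smooth_def using continuous_on_subset Ck.simps(1) by (metis subset_UNIV)

text \<open>\<open>Ck\<close> speaks about basis directions only. This expansion carries its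
  information over to derivatives in arbitrary directions, which are needed along segments.\<close>

lemma smooth_frechet_expand:
  assumes "smooth f"
  shows "frechet_derivative f (at x) h = (\<Sum>b\<in>Basis. (h \<bullet> b) * frechet_derivative f (at x) b)"
proof -
  have l: "linear (frechet_derivative f (at x))"
    using smooth_has_derivative[OF assms] has_derivative_linear by blast
  have "frechet_derivative f (at x) h = frechet_derivative f (at x) (\<Sum>b\<in>Basis. (h \<bullet> b) *\<^sub>R b)"
    by (simp add: euclidean_representation)
  also have "\<dots> = (\<Sum>b\<in>Basis. (h \<bullet> b) * frechet_derivative f (at x) b)"
    using l by (simp add: linear_sum linear_scale)
  finally show ?thesis .
qed

lemma smooth_directional: "smooth f \<Longrightarrow> smooth (\<lambda>x. frechet_derivative f (at x) h)"
  by (subst smooth_frechet_expand) (auto intro!: smooth_sum smooth_mult smooth_const smooth_partial)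

lemma has_derivative_translate:
  assumes "(f has_derivative f') (at (x + a))"
  shows "((\<lambda>x. f (x + a)) has_derivative f') (at x)"
proof -
  have "((\<lambda>x. x + a) has_derivative (\<lambda>h. h)) (at x)"
    by (auto intro!: derivative_eq_intros)
  from has_derivative_compose[OF this assms] show ?thesis .
qed

lemma smooth_translate:
  assumes "smooth f"
  shows "smooth (\<lambda>x. f (x + a))"
    and "frechet_derivative (\<lambda>x. f (x + a)) (at x) = frechet_derivative f (at (x + a))"
proof -
  have d: "((\<lambda>x. f (x + a)) has_derivative frechet_derivative f (at (x + a))) (at x)" if "smooth f" for f x
    by (intro has_derivative_translate smooth_has_derivative that)
  have "Ck k (\<lambda>x. f (x + a))" if "smooth f" for f k
    using that
  proof (induction k arbitrary: f)
    case 0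
    have "continuous_on UNIV (\<lambda>x. x + a)" by (intro continuous_intros)
    from continuous_on_compose2[OF smooth_continuous[OF 0, of UNIV] this] show ?case by simp
  next
    case (Suc k)
    show ?case
      by (rule Ck_SucI[OF d[OF Suc.prems]]) (rule Suc.IH[OF smooth_partial[OF Suc.prems]])
  qed
  then show "smooth (\<lambda>x. f (x + a))" using assms by (auto simp: smooth_def)
  show "frechet_derivative (\<lambda>x. f (x + a)) (at x) = frechet_derivative f (at (x + a))"
    using d[OF assms] frechet_derivative_at by metis
qed

section \<open>A smooth function that is flat at the origin\<close>

definition flat_exp :: "real poly \<Rightarrow> real \<Rightarrow> real" where
  "flat_exp p x = (if x > 0 then poly p (1 / x) * exp (- (1 / x)) else 0)"

lemma flat_exp_tendsto: "((\<lambda>x::real. poly p (1 / x) * exp (- (1 / x))) \<longlongrightarrow> 0) (at_right 0)"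
proof -
  have *: "((\<lambda>s. s ^ k * exp (- s)) \<longlongrightarrow> (0::real)) at_top" for k
    using tendsto_power_div_exp_0[of k] by (simp only: exp_minus divide_inverse)
  have "((\<lambda>s. \<Sum>i\<le>degree p. coeff p i * (s ^ i * exp (- s))) \<longlongrightarrow> (\<Sum>i\<le>degree p. coeff p i * 0)) at_top"
    by (rule tendsto_sum, rule tendsto_mult_left, rule *)
  moreover have "(\<Sum>i\<le>degree p. coeff p i * (s ^ i * exp (- s))) = poly p s * exp (- s)" for s
    unfolding poly_altdef sum_distrib_right by (simp only: mult.assoc)
  ultimately have "((\<lambda>s. poly p s * exp (- s)) \<longlongrightarrow> 0) at_top"
    by (simp only: mult_zero_right sum.neutral_const)
  from filterlim_compose[OF this filterlim_inverse_at_top_right] show ?thesis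
    by (simp add: inverse_eq_divide)
qed

text \<open>The polynomial factor in 1/x makes the family \<open>flat_exp p\<close> closed under
  differentiation, which exp(-1/x) alone is not.\<close>

lemma flat_exp_deriv: "\<exists>q. \<forall>x. (flat_exp p has_real_derivative flat_exp q x) (at x)"
proof -
  \<comment> \<open>With s = 1/x, the derivative of p(s) exp(-s) in x is s^2 (p(s) - p'(s)) exp(-s),
    because ds/dx = -s^2.\<close>
  define q where "q = [:0,0,1:] * (p - pderiv p)"
  have "(flat_exp p has_real_derivative flat_exp q x) (at x)" for x
  proof -
    consider "x > 0" | "x < 0" | "x = 0" by linarith
    then show ?thesis
    proof cases
      case 1
      have "((\<lambda>x. poly p (1 / x) * exp (- (1 / x))) has_real_derivative
              poly (pderiv p) (1 / x) * (- 1 / x\<^sup>2) * exp (- (1 / x)) + poly p (1/x) * (exp (- (1 / x)) * (1 / x\<^sup>2))) (at x)"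
        using 1 by (auto intro!: derivative_eq_intros DERIV_chain2[OF poly_DERIV] simp: power2_eq_square)
      then have "((\<lambda>x. poly p (1 / x) * exp (- (1 / x))) has_real_derivative flat_exp q x) (at x)"
        using 1 by (simp add: flat_exp_def q_def field_simps power2_eq_square)
      then show ?thesis
        by (rule has_field_derivative_transform_within_open[where S="{0<..}"]) (use 1 in \<open>auto simp: flat_exp_def\<close>)
    next
      case 2
      have "((\<lambda>x. 0) has_real_derivative 0) (at x)" by simp
      then have "(flat_exp p has_real_derivative 0) (at x)"
        by (rule has_field_derivative_transform_within_open[where S="{..<0}"]) (use 2 in \<open>auto simp: flat_exp_def\<close>)
      then show ?thesis using 2 by (simp add: flat_exp_def)
    next
      case 3
      \<comment> \<open>At the origin the right difference quotient carries an extra factor 1/h,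
        which \<open>pCons 0 p\<close> absorbs as one more power of s. The left difference quotient
        is identically zero.\<close>
      have "((\<lambda>h. poly (pCons 0 p) (1 / h) * exp (- (1 / h))) \<longlongrightarrow> 0) (at_right 0)"
        by (rule flat_exp_tendsto)
      then have r: "((\<lambda>h. (flat_exp p (0 + h) - flat_exp p 0) / h) \<longlongrightarrow> 0) (at_right 0)"
        by (rule Lim_transform_eventually) (auto simp: eventually_at_filter flat_exp_def)
      have "((\<lambda>h. 0) \<longlongrightarrow> 0) (at_left (0::real))" by simp
      then have l: "((\<lambda>h. (flat_exp p (0 + h) - flat_exp p 0) / h) \<longlongrightarrow> 0) (at_left 0)"
        by (rule Lim_transform_eventually) (auto simp: eventually_at_filter flat_exp_def)
      from l r have "((\<lambda>h. (flat_exp p (0 + h) - flat_exp p 0) / h) \<longlongrightarrow> 0) (at 0)"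
        by (simp add: filterlim_split_at)
      then show ?thesis using 3 by (simp add: DERIV_def flat_exp_def)
    qed
  qed
  then show ?thesis by blast
qed

text \<open>The induction runs over all polynomials at once: the chain rule replaces
  \<open>p\<close> by another polynomial and adds a partial derivative of \<open>g\<close> as a
  factor.\<close>

lemma smooth_flat_exp:
  assumes "smooth g"
  shows "smooth (\<lambda>x. flat_exp p (g x))"
  unfolding smooth_def
proof
  fix k show "Ck k (\<lambda>x. flat_exp p (g x))"
  proof (induction k arbitrary: p)
    case 0
    obtain q where q: "\<And>x. (flat_exp p has_real_derivative flat_exp q x) (at x)" using flat_exp_deriv by blast
    have "continuous_on UNIV (flat_exp p)"
      using q by (intro DERIV_continuous_on) (auto intro: has_field_derivative_at_within)
    then show ?case
      using smooth_continuous[OF assms] by (auto intro: continuous_on_compose2)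
  next
    case (Suc k)
    obtain q where q: "\<And>x. (flat_exp p has_real_derivative flat_exp q x) (at x)" using flat_exp_deriv by blast
    have "((\<lambda>x. flat_exp p (g x)) has_derivative (\<lambda>h. flat_exp q (g x) * frechet_derivative g (at x) h)) (at x)" for x
      using has_derivative_compose[OF smooth_has_derivative[OF assms], of "flat_exp p" "(*) (flat_exp q (g x))"] q
      by (simp add: has_field_derivative_def)
    then show ?case
      by (rule Ck_SucI) (use Suc smooth_partial[OF assms] in \<open>auto intro!: Ck_mult simp: smooth_def\<close>)
  qed
qed

section \<open>Test functions and their closure properties\<close>

lemma test_functionsI:
  assumes "smooth \<psi>" "compact K" "K \<subseteq> \<Omega>" "\<And>x. \<psi> x \<noteq> 0 \<Longrightarrow> x \<in> K"
  shows "\<psi> \<in> test_functions \<Omega>"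
proof -
  have "closure {x. \<psi> x \<noteq> 0} \<subseteq> K"
    using assms by (intro closure_minimal compact_imp_closed) auto
  moreover have "bounded {x. \<psi> x \<noteq> 0}"
    using assms by (intro bounded_subset[OF compact_imp_bounded[OF assms(2)]]) auto
  ultimately show ?thesis
    using assms by (auto simp: test_functions_def smooth_def)
qed

lemma test_functionsE:
  assumes "\<psi> \<in> test_functions \<Omega>"
  obtains K where "smooth \<psi>" "compact K" "K \<subseteq> \<Omega>" "\<And>x. x \<notin> K \<Longrightarrow> \<psi> x = 0"
    "\<And>x h. x \<notin> K \<Longrightarrow> frechet_derivative \<psi> (at x) h = 0"
proof -
  define K where "K = closure {x. \<psi> x \<noteq> 0}"
  have s: "smooth \<psi>" and K: "compact K" "K \<subseteq> \<Omega>"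
    using assms by (auto simp: test_functions_def smooth_def K_def)
  have z: "\<psi> x = 0" if "x \<notin> K" for x
    using that closure_subset[of "{x. \<psi> x \<noteq> 0}"] unfolding K_def by blast
  have "frechet_derivative \<psi> (at x) h = 0" if "x \<notin> K" for x h
  proof -
    have "((\<lambda>x. 0::real) has_derivative (\<lambda>h. 0)) (at x)" by simp
    then have "(\<psi> has_derivative (\<lambda>h. 0)) (at x)"
      by (rule has_derivative_transform_within_open[where s="- K"]) (use that z compact_imp_closed[OF K(1)] in \<open>auto simp: open_Compl\<close>)
    then show ?thesis using frechet_derivative_at by metis
  qed
  with s K z show ?thesis using that by blast
qed

lemma test_function_partial:
  assumes "\<psi> \<in> test_functions \<Omega>"
  shows "(\<lambda>x. frechet_derivative \<psi> (at x) h) \<in> test_functions \<Omega>"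
  by (rule test_functionsE[OF assms]) (rule test_functionsI, auto intro: smooth_directional)

lemma test_function_mult:
  assumes "\<psi> \<in> test_functions \<Omega>" "smooth f"
  shows "(\<lambda>x. f x * \<psi> x) \<in> test_functions \<Omega>"
  by (rule test_functionsE[OF assms(1)]) (rule test_functionsI, auto intro: smooth_mult assms(2))

lemma test_functions_mono: "S \<subseteq> S' \<Longrightarrow> \<psi> \<in> test_functions S \<Longrightarrow> \<psi> \<in> test_functions S'"
  by (auto simp: test_functions_def)

lemma test_function_add_cmul:
  assumes "\<psi> \<in> test_functions \<Omega>" "\<phi> \<in> test_functions \<Omega>"
  shows "(\<lambda>x. \<psi> x + c * \<phi> x) \<in> test_functions \<Omega>"
proof -
  obtain K where K: "smooth \<psi>" "compact K" "K \<subseteq> \<Omega>" "\<And>x. x \<notin> K \<Longrightarrow> \<psi> x = 0"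
    using test_functionsE[OF assms(1)] by metis
  obtain K' where K': "smooth \<phi>" "compact K'" "K' \<subseteq> \<Omega>" "\<And>x. x \<notin> K' \<Longrightarrow> \<phi> x = 0"
    using test_functionsE[OF assms(2)] by metis
  show ?thesis
    by (rule test_functionsI[where K="K \<union> K'"])
       (use K K' in \<open>force intro!: smooth_add smooth_mult smooth_const\<close>)+
qed

lemma test_function_zero: "(\<lambda>x. 0) \<in> test_functions \<Omega>"
  by (rule test_functionsI[of _ "{}"]) (auto simp: smooth_const)

lemma test_function_translate:
  assumes "\<psi> \<in> test_functions UNIV"
  shows "(\<lambda>x. \<psi> (x + a)) \<in> test_functions UNIV"
proof -
  obtain K where K: "smooth \<psi>" "compact K" "\<And>x. x \<notin> K \<Longrightarrow> \<psi> x = 0"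
    using test_functionsE[OF assms(1)] by metis
  have "x \<in> (\<lambda>x. x - a) ` K" if "\<psi> (x + a) \<noteq> 0" for x
    using K(3)[of "x + a"] that by (intro image_eqI[of _ _ "x + a"]) auto
  moreover have "compact ((\<lambda>x. x - a) ` K)"
    by (intro compact_continuous_image K continuous_intros)
  ultimately show ?thesis
    using smooth_translate(1)[OF K(1)] by (intro test_functionsI) auto
qed

lemma test_function_bounded:
  assumes "\<psi> \<in> test_functions \<Omega>"
  obtains C where "C > 0" "\<And>x. \<bar>\<psi> x\<bar> \<le> C"
proof -
  obtain K where K: "smooth \<psi>" "compact K" "\<And>x. x \<notin> K \<Longrightarrow> \<psi> x = 0"
    using test_functionsE[OF assms(1)] by metis
  have "bounded (\<psi> ` K)"
    by (intro compact_imp_bounded compact_continuous_image K smooth_continuous)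
  then obtain C where "C > 0" "\<And>x. x \<in> K \<Longrightarrow> \<bar>\<psi> x\<bar> \<le> C"
    by (auto simp: bounded_pos)
  with K(3) have "\<bar>\<psi> x\<bar> \<le> C" for x by (cases "x \<in> K") auto
  with \<open>C > 0\<close> that show ?thesis by blast
qed

section \<open>Integration by parts and the fundamental lemma\<close>

lemma continuous_lebesgue_measurable:
  "continuous_on UNIV f \<Longrightarrow> f \<in> borel_measurable lebesgue"
  for f :: "'a::euclidean_space \<Rightarrow> 'b::euclidean_space"
  by (rule measurable_completion) (simp add: borel_measurable_continuous_onI)

lemma indicator_mult_measurable:
  assumes "S \<in> sets borel" "f \<in> borel_measurable lebesgue"
  shows "(\<lambda>x. indicat_real S x * f x) \<in> borel_measurable lebesgue"
  using assms by (intro borel_measurable_times borel_measurable_indicator) auto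

lemma integrable_lebesgue_compact_support:
  fixes f :: "'a::euclidean_space \<Rightarrow> real"
  assumes "continuous_on UNIV f" "compact K" "\<And>x. x \<notin> K \<Longrightarrow> f x = 0"
  shows "integrable lebesgue f"
proof -
  have "integrable lborel (\<lambda>x. indicator K x *\<^sub>R f x)"
    using borel_integrable_compact[OF assms(2)] continuous_on_subset[OF assms(1)] by blast
  moreover have "(\<lambda>x. indicator K x *\<^sub>R f x) = f"
    using assms(3) by (auto simp: indicator_def fun_eq_iff)
  ultimately have "integrable lborel f" by simp
  then show ?thesis
    using integrable_completion[of f lborel] borel_measurable_continuous_onI[OF assms(1)] by auto
qed

lemma test_function_continuous: "\<psi> \<in> test_functions \<Omega> \<Longrightarrow> continuous_on S \<psi>"
  by (erule test_functionsE) (rule smooth_continuous)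

lemma test_function_measurable: "\<psi> \<in> test_functions \<Omega> \<Longrightarrow> \<psi> \<in> borel_measurable lebesgue"
  by (intro continuous_lebesgue_measurable test_function_continuous)

lemma test_function_integrable:
  assumes "\<psi> \<in> test_functions \<Omega>"
  shows "integrable lebesgue \<psi>"
proof -
  obtain K where "compact K" "\<And>x. x \<notin> K \<Longrightarrow> \<psi> x = 0"
    using test_functionsE[OF assms] by metis
  then show ?thesis
    by (rule integrable_lebesgue_compact_support[OF test_function_continuous[OF assms]])
qed

lemma test_function_set_integral:
  assumes "\<psi> \<in> test_functions \<Omega>"
  shows "(LINT x:\<Omega>|lebesgue. f x * \<psi> x) = (LINT x|lebesgue. f x * \<psi> x)"
    and "(LINT x:\<Omega>|lebesgue. \<psi> x * f x) = (LINT x|lebesgue. \<psi> x * f x)"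
proof -
  have "indicator \<Omega> x * \<psi> x = \<psi> x" for x
    by (rule test_functionsE[OF assms]) (auto simp: indicator_def)
  then show "(LINT x:\<Omega>|lebesgue. f x * \<psi> x) = (LINT x|lebesgue. f x * \<psi> x)"
    and "(LINT x:\<Omega>|lebesgue. \<psi> x * f x) = (LINT x|lebesgue. \<psi> x * f x)"
    unfolding set_lebesgue_integral_def real_scaleR_def
    by (auto intro!: Bochner_Integration.integral_cong simp: algebra_simps) (metis mult.left_commute, metis mult.assoc)
qed

section \<open>Differentiation under the integral sign\<close>

lemma smooth_line_deriv:
  assumes "smooth F"
  shows "((\<lambda>s. F (x + s *\<^sub>R h)) has_real_derivative frechet_derivative F (at (x + s *\<^sub>R h)) h) (at s)"
proof -
  have "((\<lambda>s. x + s *\<^sub>R h) has_derivative (\<lambda>s. s *\<^sub>R h)) (at s)"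
    by (auto intro!: derivative_eq_intros)
  from has_derivative_compose[OF this smooth_has_derivative[OF assms]]
  have "((\<lambda>s. F (x + s *\<^sub>R h)) has_derivative (\<lambda>r. frechet_derivative F (at (x + s *\<^sub>R h)) (r *\<^sub>R h))) (at s)" .
  moreover have "frechet_derivative F (at (x + s *\<^sub>R h)) (r *\<^sub>R h) = r * frechet_derivative F (at (x + s *\<^sub>R h)) h" for r
    using linear_scale[OF has_derivative_linear[OF smooth_has_derivative[OF assms]]] by simp
  moreover have "(\<lambda>r. r * frechet_derivative F (at (x + s *\<^sub>R h)) h) = (*) (frechet_derivative F (at (x + s *\<^sub>R h)) h)"
    by (simp add: fun_eq_iff)
  ultimately show ?thesis
    unfolding has_field_derivative_def by (simp only:)
qed

text \<open>Dominated convergence for difference quotients: the mean value inequality bounds them by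
  C, and nearby translates of F live on a common compact set, where \<open>w\<close> is integrable.
  The derivative falls on F alone, so the lemma serves both for \<open>w\<close> = 1 and for a rough
  \<open>w\<close> that is being mollified.\<close>

lemma has_derivative_integral_translate:
  fixes F :: "'a::euclidean_space \<Rightarrow> real"
  assumes w: "\<And>K. compact K \<Longrightarrow> set_integrable lebesgue K w"
    and wm: "w \<in> borel_measurable lebesgue"
    and F: "F \<in> test_functions UNIV"
  shows "((\<lambda>t. LINT y|lebesgue. w y * F (y + t *\<^sub>R h)) has_real_derivative
          (LINT y|lebesgue. w y * frechet_derivative F (at (y + t *\<^sub>R h)) h)) (at t)"
proof -
  obtain K where K: "smooth F" "compact K" "\<And>x. x \<notin> K \<Longrightarrow> F x = 0"
    using test_functionsE[OF F] by metis
  obtain C where C: "C > 0" "\<And>x. \<bar>frechet_derivative F (at x) h\<bar> \<le> C"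
    using test_function_bounded[OF test_function_partial[OF F]] by metis
  have meas: "(\<lambda>y. F (y + a)) \<in> borel_measurable lebesgue" for a
    using test_function_measurable[OF test_function_translate[OF F]] .
  have int: "integrable lebesgue (\<lambda>y. w y * F (y + a))" for a
  proof -
    obtain K' where K': "compact K'" "\<And>x. x \<notin> K' \<Longrightarrow> F (x + a) = 0"
      using test_functionsE[OF test_function_translate[OF F, of a]] by metis
    obtain B where B: "\<And>x. \<bar>F x\<bar> \<le> B" using test_function_bounded[OF F] by metis
    have "\<bar>w y * F (y + a)\<bar> \<le> \<bar>B * (indicator K' y *\<^sub>R w y)\<bar>" for y
    proof (cases "y \<in> K'")
      case True
      then show ?thesis
        using mult_left_mono[OF B[of "y + a"], of "\<bar>w y\<bar>"] B[of "y+a"] by (simp add: abs_mult mult.commute)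
    qed (use K' in auto)
    then have "AE y in lebesgue. norm (w y * F (y + a)) \<le> norm (B * (indicator K' y *\<^sub>R w y))"
      by (intro AE_I2) (simp only: real_norm_def)
    moreover have "integrable lebesgue (\<lambda>y. B * (indicator K' y *\<^sub>R w y))"
      using w[OF K'(1)] unfolding set_integrable_def by (rule integrable_mult_right)
    moreover have "(\<lambda>y. w y * F (y + a)) \<in> borel_measurable lebesgue"
      using wm meas by (rule borel_measurable_times)
    ultimately show ?thesis
      using Bochner_Integration.integrable_bound by blast
  qed
  have "((\<lambda>s. ((LINT y|lebesgue. w y * F (y + (t + s) *\<^sub>R h)) - (LINT y|lebesgue. w y * F (y + t *\<^sub>R h))) / s)
      \<longlongrightarrow> (LINT y|lebesgue. w y * frechet_derivative F (at (y + t *\<^sub>R h)) h)) (at 0)"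
    unfolding tendsto_at_iff_sequentially
  proof (intro allI impI)
    fix X :: "nat \<Rightarrow> real" assume X: "\<forall>i. X i \<in> UNIV - {0}" "X \<longlonglongrightarrow> 0"
    then obtain R where R: "\<And>n. \<bar>X n\<bar> \<le> R"
      using convergent_imp_Bseq[OF convergentI[OF X(2)]] by (auto simp: Bseq_def)
    \<comment> \<open>A compact set outside which every translate of F with parameter t + s,
      \<bar>s\<bar> \<le> R, vanishes; R bounds the sequence of increments.\<close>
    define K' where "K' = (\<lambda>(k, s). k - (t + s) *\<^sub>R h) ` (K \<times> cbox (-R) R)"
    have K': "compact K'" unfolding K'_def split_def
      by (intro compact_continuous_image compact_Times K continuous_intros) auto
    have out: "F (y + (t + s) *\<^sub>R h) = 0" if "y \<notin> K'" "\<bar>s\<bar> \<le> R" for y s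
    proof (rule K(3), rule notI)
      assume "y + (t + s) *\<^sub>R h \<in> K"
      then have "y \<in> K'" unfolding K'_def
        using that(2) by (intro image_eqI[of _ _ "(y + (t + s) *\<^sub>R h, s)"]) auto
      with that show False by simp
    qed
    have R0: "R \<ge> 0" using R[of 0] by linarith
    let ?s = "\<lambda>n y. w y * ((F (y + (t + X n) *\<^sub>R h) - F (y + t *\<^sub>R h)) / X n)"
    have "(\<lambda>n. LINT y|lebesgue. ?s n y) \<longlonglongrightarrow> (LINT y|lebesgue. w y * frechet_derivative F (at (y + t *\<^sub>R h)) h)"
    proof (rule integral_dominated_convergence[where w="\<lambda>y. C * \<bar>indicator K' y *\<^sub>R w y\<bar>"])
      show "(\<lambda>y. w y * frechet_derivative F (at (y + t *\<^sub>R h)) h) \<in> borel_measurable lebesgue"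
        using test_function_measurable[OF test_function_translate[OF test_function_partial[OF F]], of "t *\<^sub>R h" h] wm
        by auto
      show "?s i \<in> borel_measurable lebesgue" for i
        using wm meas by auto
      show "integrable lebesgue (\<lambda>y. C * \<bar>indicator K' y *\<^sub>R w y\<bar>)"
        using w[OF K'] unfolding set_integrable_def by auto
      show "AE y in lebesgue. (\<lambda>n. ?s n y) \<longlonglongrightarrow> w y * frechet_derivative F (at (y + t *\<^sub>R h)) h"
      proof (rule AE_I2)
        fix y :: 'a
        have "((\<lambda>s. (F (y + (t + s) *\<^sub>R h) - F (y + t *\<^sub>R h)) / s) \<longlongrightarrow> frechet_derivative F (at (y + t *\<^sub>R h)) h) (at 0)"
          using smooth_line_deriv[OF K(1), of y h t] by (simp add: DERIV_def)
        then have "((\<lambda>s. (F (y + (t + s) *\<^sub>R h) - F (y + t *\<^sub>R h)) / s) \<circ> X) \<longlonglongrightarrow> frechet_derivative F (at (y + t *\<^sub>R h)) h"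
          using X unfolding tendsto_at_iff_sequentially by blast
        then show "(\<lambda>n. ?s n y) \<longlonglongrightarrow> w y * frechet_derivative F (at (y + t *\<^sub>R h)) h"
          by (intro tendsto_intros) (simp add: o_def)
      qed
      show "AE y in lebesgue. norm (?s n y) \<le> C * \<bar>indicator K' y *\<^sub>R w y\<bar>" for n
      proof (rule AE_I2)
        fix y :: 'a
        show "norm (?s n y) \<le> C * \<bar>indicator K' y *\<^sub>R w y\<bar>"
        proof (cases "y \<in> K'")
          case True
          have "norm (F (y + (t + X n) *\<^sub>R h) - F (y + t *\<^sub>R h)) \<le> C * norm ((t + X n) - t)"
            by (rule field_differentiable_bound[where S=UNIV and f="\<lambda>s. F (y + s *\<^sub>R h)"
                and f'="\<lambda>s. frechet_derivative F (at (y + s *\<^sub>R h)) h"])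
               (use smooth_line_deriv[OF K(1)] C in auto)
          then have "\<bar>(F (y + (t + X n) *\<^sub>R h) - F (y + t *\<^sub>R h)) / X n\<bar> \<le> C"
            using X(1) by (simp add: divide_le_eq)
          then show ?thesis
            using True mult_left_mono[of "\<bar>(F (y + (t + X n) *\<^sub>R h) - F (y + t *\<^sub>R h)) / X n\<bar>" C "\<bar>w y\<bar>"]
            by (simp add: abs_mult mult.commute)
        next
          case False
          then show ?thesis using out[of y "X n"] out[of y 0] R R0 by simp
        qed
      qed
    qed
    moreover have "(LINT y|lebesgue. ?s n y) =
      ((LINT y|lebesgue. w y * F (y + (t + X n) *\<^sub>R h)) - (LINT y|lebesgue. w y * F (y + t *\<^sub>R h))) / X n" for n
    proof -
      have "(LINT y|lebesgue. ?s n y) = (LINT y|lebesgue. (w y * F (y + (t + X n) *\<^sub>R h) - w y * F (y + t *\<^sub>R h)) / X n)"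
        by (intro Bochner_Integration.integral_cong) (auto simp: field_simps)
      also have "\<dots> = ((LINT y|lebesgue. w y * F (y + (t + X n) *\<^sub>R h)) - (LINT y|lebesgue. w y * F (y + t *\<^sub>R h))) / X n"
        using int by simp
      finally show ?thesis .
    qed
    ultimately show "((\<lambda>s. ((LINT y|lebesgue. w y * F (y + (t + s) *\<^sub>R h)) - (LINT y|lebesgue. w y * F (y + t *\<^sub>R h))) / s) \<circ> X)
      \<longlonglongrightarrow> (LINT y|lebesgue. w y * frechet_derivative F (at (y + t *\<^sub>R h)) h)"
      unfolding o_def by (simp only:)
  qed
  then show ?thesis by (simp add: DERIV_def)
qed

lemma integral_lebesgue_translate:
  fixes f :: "'a::euclidean_space \<Rightarrow> real"
  assumes "continuous_on UNIV f"
  shows "(LINT y|lebesgue. f (y + a)) = (LINT y|lebesgue. f y)"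
proof -
  have f: "f \<in> borel_measurable borel" using assms by (rule borel_measurable_continuous_onI)
  then have fa: "(\<lambda>y. f (y + a)) \<in> borel_measurable borel" by measurable
  have "(LINT y|lebesgue. f y) = (LINT y|distr lborel borel ((+) a). f y)"
    using f by (simp add: integral_completion lborel_distr_plus)
  also have "\<dots> = (LINT y|lborel. f (a + y))"
    using f by (intro integral_distr) auto
  also have "\<dots> = (LINT y|lebesgue. f (y + a))"
    using fa by (simp add: integral_completion add.commute)
  finally show ?thesis by simp
qed

lemma set_integrable_compact_const: "compact K \<Longrightarrow> set_integrable lebesgue K (\<lambda>x::'a::euclidean_space. c::real)"
  unfolding set_integrable_def
  using lmeasurable_compact[of K] by (auto simp: fmeasurable_def top.not_eq_extremum)

text \<open>By translation invariance the integral of F(y + t h) is constant in t, and its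
  derivative at t = 0 is the integral in question.\<close>

lemma integral_partial_test_function:
  assumes "F \<in> test_functions UNIV"
  shows "(LINT y|lebesgue. frechet_derivative F (at y) h) = 0"
proof -
  have "((\<lambda>t. LINT y|lebesgue. 1 * F (y + t *\<^sub>R h)) has_real_derivative
          (LINT y|lebesgue. 1 * frechet_derivative F (at (y + 0 *\<^sub>R h)) h)) (at 0)"
    by (rule has_derivative_integral_translate[OF set_integrable_compact_const _ assms]) auto
  moreover have "(LINT y|lebesgue. F (y + t *\<^sub>R h)) = (LINT y|lebesgue. F y)" for t
    by (rule integral_lebesgue_translate[OF test_function_continuous[OF assms]])
  ultimately have "((\<lambda>t. LINT y|lebesgue. F y) has_real_derivative
          (LINT y|lebesgue. frechet_derivative F (at y) h)) (at (0::real))" by simp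
  from DERIV_unique[OF this DERIV_const] show ?thesis by simp
qed

text \<open>Integrate the product rule for f \<psi>, whose directional derivative has integral zero.
  Here f is merely smooth, so that affine functions qualify.\<close>

lemma integration_by_parts:
  assumes "\<psi> \<in> test_functions UNIV" "smooth f"
  shows "(LINT y|lebesgue. f y * frechet_derivative \<psi> (at y) h) = - (LINT y|lebesgue. frechet_derivative f (at y) h * \<psi> y)"
proof -
  have s: "smooth \<psi>" using assms(1) by (rule test_functionsE)
  have "frechet_derivative (\<lambda>y. f y * \<psi> y) (at y) h = f y * frechet_derivative \<psi> (at y) h + frechet_derivative f (at y) h * \<psi> y" for y
    using frechet_derivative_at[OF has_derivative_mult[OF smooth_has_derivative[OF assms(2)] smooth_has_derivative[OF s]], of y]
    by metis
  moreover have "integrable lebesgue (\<lambda>y. f y * frechet_derivative \<psi> (at y) h)"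
    by (rule test_function_integrable[OF test_function_mult[OF test_function_partial[OF assms(1)] assms(2)]])
  moreover have "integrable lebesgue (\<lambda>y. frechet_derivative f (at y) h * \<psi> y)"
    by (rule test_function_integrable[OF test_function_mult[OF assms(1) smooth_directional[OF assms(2)]]])
  ultimately show ?thesis
    using integral_partial_test_function[OF test_function_mult[OF assms], of h] by simp
qed

section \<open>Bump functions and mollifiers\<close>

abbreviation bump1 :: "real \<Rightarrow> real" where "bump1 \<equiv> flat_exp 1"

lemma bump1_pos: "x > 0 \<Longrightarrow> bump1 x > 0" and bump1_nonpos: "x \<le> 0 \<Longrightarrow> bump1 x = 0"
  and bump1_nonneg: "bump1 x \<ge> 0" and bump1_le: "bump1 x \<le> 1"
  by (auto simp: flat_exp_def)

text \<open>Rescaling the argument turns the flat function into a smooth approximation of the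
  indicator of the positive half-line.\<close>

lemma bump1_limit: "(\<lambda>n. bump1 (real n * x)) \<longlonglongrightarrow> (if x > 0 then 1 else 0)"
proof (cases "x > 0")
  case True
  have "(\<lambda>n. exp (- (1 / (real n * x)))) \<longlonglongrightarrow> exp (- 0)"
  proof (intro tendsto_intros)
    have "(\<lambda>n. (1 / real n) * (1 / x)) \<longlonglongrightarrow> 0 * (1 / x)"
      by (intro tendsto_mult_right lim_1_over_n)
    then show "(\<lambda>n. 1 / (real n * x)) \<longlonglongrightarrow> 0" by simp
  qed
  moreover have "\<forall>\<^sub>F n in sequentially. exp (- (1 / (real n * x))) = bump1 (real n * x)"
    using eventually_gt_at_top[of 0] by eventually_elim (use True in \<open>auto simp: flat_exp_def\<close>)
  ultimately show ?thesis using True by (auto intro: Lim_transform_eventually)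
next
  case False
  then have "bump1 (real n * x) = 0" for n
    by (intro bump1_nonpos) (simp add: mult_nonneg_nonpos)
  then show ?thesis using False by simp
qed

text \<open>The kernel is a normalised flat function of \<epsilon>^2 - |x|^2. That it is even is
  recorded for \<open>mollification\<close>, where it turns \<eta>(z) into \<eta>(x - t).\<close>

lemma ex_mollifier:
  assumes "\<epsilon> > 0"
  obtains \<eta> :: "'a::euclidean_space \<Rightarrow> real" where "\<eta> \<in> test_functions UNIV" "\<And>x. \<eta> x \<ge> 0"
    "\<And>x. \<epsilon> \<le> norm x \<Longrightarrow> \<eta> x = 0" "(LINT x|lebesgue. \<eta> x) = 1" "\<And>x. \<eta> (- x) = \<eta> x"
proof -
  define f :: "'a \<Rightarrow> real" where "f = (\<lambda>x. bump1 (\<epsilon>\<^sup>2 - (\<Sum>b\<in>Basis. (x \<bullet> b) * (x \<bullet> b))))"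
  have f: "f x = bump1 (\<epsilon>\<^sup>2 - (norm x)\<^sup>2)" for x
    unfolding f_def power2_norm_eq_inner euclidean_inner[of x x] by simp
  have z: "f x = 0" if "\<epsilon> \<le> norm x" for x
    using that assms by (auto simp: f intro!: bump1_nonpos power_mono)
  have sm: "smooth f" unfolding f_def
    by (intro smooth_flat_exp smooth_diff smooth_sum smooth_mult smooth_const smooth_inner)
  have t: "f \<in> test_functions UNIV"
    by (rule test_functionsI[OF sm, of "cball 0 \<epsilon>"]) (use z in \<open>force+\<close>)
  have nn: "f x \<ge> 0" for x by (simp add: f bump1_nonneg)
  \<comment> \<open>A zero integral would force the nonnegative function to vanish almost
    everywhere, but it is positive on a ball, which has positive measure.\<close>
  have I: "(LINT x|lebesgue. f x) > 0"
  proof (rule ccontr)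
    assume "\<not> ?thesis"
    moreover have "(LINT x|lebesgue. f x) \<ge> 0" using nn by (intro Bochner_Integration.integral_nonneg) auto
    ultimately have "(LINT x|lebesgue. f x) = 0" by simp
    then have ae: "AE x in lebesgue. f x = 0"
      using integral_nonneg_eq_0_iff_AE[OF test_function_integrable[OF t]] nn by simp
    have "f x > 0" if "x \<in> ball 0 \<epsilon>" for x
      using that assms unfolding f by (intro bump1_pos) (auto simp: power_strict_mono)
    then have out: "x \<notin> ball 0 \<epsilon>" if "f x = 0" for x using that by fastforce
    have "AE x in lebesgue. x \<notin> ball (0::'a) \<epsilon>"
      by (rule eventually_mono[OF ae]) (rule out)
    then have "ball 0 \<epsilon> \<in> null_sets (lebesgue :: 'a measure)"
      by (subst (asm) AE_iff_null_sets[symmetric]) auto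
    then have "measure lebesgue (ball (0::'a) \<epsilon>) = 0" by (simp add: measure_eq_0_null_sets)
    moreover have "measure lebesgue (ball (0::'a) \<epsilon>) > 0"
      using content_ball_pos[OF assms, of 0] by simp
    ultimately show False by simp
  qed
  define \<eta> where "\<eta> = (\<lambda>x. (1 / (LINT x|lebesgue. f x)) * f x)"
  have "\<eta> \<in> test_functions UNIV" unfolding \<eta>_def
    by (rule test_function_mult[OF t smooth_const])
  moreover have "\<eta> x \<ge> 0" for x using nn I by (simp add: \<eta>_def)
  moreover have "\<eta> x = 0" if "\<epsilon> \<le> norm x" for x using z that by (simp add: \<eta>_def)
  moreover have "(LINT x|lebesgue. \<eta> x) = 1" using I test_function_integrable[OF t] by (simp add: \<eta>_def)
  moreover have "\<eta> (- x) = \<eta> x" for x by (simp add: \<eta>_def f)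
  ultimately show ?thesis using that by blast
qed

text \<open>Products of one-dimensional bumps, two for each coordinate, that open up towards the two
  faces of the box. Their supports stay in the closed box while the limit is the indicator of the
  open one.\<close>

lemma ex_box_approximation:
  fixes a b :: "'a::euclidean_space"
  assumes "cbox a b \<subseteq> \<Omega>"
  obtains \<psi> :: "nat \<Rightarrow> 'a \<Rightarrow> real" where "\<And>n. \<psi> n \<in> test_functions \<Omega>" "\<And>n x. \<bar>\<psi> n x\<bar> \<le> 1"
    "\<And>x. (\<lambda>n. \<psi> n x) \<longlonglongrightarrow> indicator (box a b) x"
proof -
  define \<psi> where "\<psi> = (\<lambda>n x. \<Prod>i\<in>Basis. bump1 (real n * (x \<bullet> i - a \<bullet> i)) * bump1 (real n * (b \<bullet> i - x \<bullet> i)))"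
  have "\<psi> n \<in> test_functions \<Omega>" for n
  proof (rule test_functionsI[of _ "cbox a b"])
    show "smooth (\<psi> n)" unfolding \<psi>_def
      by (intro smooth_prod smooth_flat_exp smooth_diff smooth_mult smooth_const smooth_inner)
    show "x \<in> cbox a b" if "\<psi> n x \<noteq> 0" for x
    proof -
      have "real n * (x \<bullet> i - a \<bullet> i) > 0" "real n * (b \<bullet> i - x \<bullet> i) > 0" if "i \<in> Basis" for i
        using \<open>\<psi> n x \<noteq> 0\<close> that unfolding \<psi>_def by (auto simp: not_le[symmetric] bump1_nonpos simp del: not_le)
      then show ?thesis by (auto simp: mem_box zero_less_mult_iff less_imp_le)
    qed
  qed (use assms in auto)
  moreover have "\<bar>\<psi> n x\<bar> \<le> 1" for n x
  proof -
    have "\<bar>\<psi> n x\<bar> = \<psi> n x" unfolding \<psi>_def by (intro abs_of_nonneg prod_nonneg mult_nonneg_nonneg bump1_nonneg)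
    also have "\<dots> \<le> 1" unfolding \<psi>_def
      by (intro prod_le_1 conjI mult_nonneg_nonneg bump1_nonneg mult_le_one bump1_le)
    finally show ?thesis .
  qed
  moreover have "(\<lambda>n. \<psi> n x) \<longlonglongrightarrow> indicator (box a b) x" for x
  proof -
    have "(\<lambda>n. \<psi> n x) \<longlonglongrightarrow> (\<Prod>i\<in>Basis. (if x \<bullet> i - a \<bullet> i > 0 then 1 else 0) * (if b \<bullet> i - x \<bullet> i > 0 then 1 else 0))"
      unfolding \<psi>_def by (intro tendsto_prod tendsto_mult bump1_limit)
    moreover have "(\<Prod>i\<in>Basis. (if x \<bullet> i - a \<bullet> i > 0 then 1 else 0) * (if b \<bullet> i - x \<bullet> i > 0 then 1 else 0)) = indicat_real (box a b) x"
    proof (cases "x \<in> box a b")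
      case True
      then show ?thesis by (simp add: mem_box)
    next
      case False
      then obtain i where "i \<in> Basis" "\<not> (a \<bullet> i < x \<bullet> i \<and> x \<bullet> i < b \<bullet> i)" by (auto simp: mem_box)
      then have "(\<Prod>i\<in>Basis. (if x \<bullet> i - a \<bullet> i > 0 then 1 else 0) * (if b \<bullet> i - x \<bullet> i > 0 then 1 else 0)) = (0::real)"
        by (intro prod_zero bexI[of _ i]) auto
      then show ?thesis using False by simp
    qed
    ultimately show ?thesis by simp
  qed
  ultimately show ?thesis using that by blast
qed

text \<open>Open boxes form an intersection-stable generator of the Borel sets, so the integrals
  vanish over every Borel set and the density is zero. The argument runs on a Borel version
  \<open>g'\<close> of \<open>g\<close>.\<close>

lemma AE_zero_if_box_integrals_zero:
  fixes g :: "'a::euclidean_space \<Rightarrow> real"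
  assumes g: "integrable lebesgue g" and z: "\<And>a b. (LINT x:box a b|lebesgue. g x) = 0"
  shows "AE x in lebesgue. g x = 0"
proof -
  obtain g' where g': "g' \<in> borel_measurable lborel" "AE x in lborel. g x = g' x"
    using completion_ex_borel_measurable_real[of g lborel] g by auto
  then have ae: "AE x in lebesgue. g x = g' x" by (simp add: AE_completion)
  have gm: "g \<in> borel_measurable lebesgue" using g by auto
  have g'm: "g' \<in> borel_measurable lebesgue" using g'(1) measurable_completion by blast
  have i': "integrable lebesgue g'"
    using integrable_cong_AE[OF gm g'm ae] g by simp
  then have i: "integrable lborel g'" using integrable_completion[OF g'(1)] by simp
  have z': "set_lebesgue_integral lborel (box a b) g' = 0" for a b
  proof -
    have "set_lebesgue_integral lborel (box a b) g' = set_lebesgue_integral lebesgue (box a b) g'"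
      unfolding set_lebesgue_integral_def using g'(1) by (subst integral_completion) auto
    also have "\<dots> = set_lebesgue_integral lebesgue (box a b) g"
      unfolding set_lebesgue_integral_def using ae gm g'm indicator_mult_measurable[OF _ gm, of "box a b"] indicator_mult_measurable[OF _ g'm, of "box a b"]
      by (intro integral_cong_AE) auto
    finally show ?thesis using z by simp
  qed
  have si: "set_integrable lborel A g'" if "A \<in> sets borel" for A
    using i that unfolding set_integrable_def by (intro integrable_mult_indicator) auto
  have UN: "set_lebesgue_integral lborel (\<Union>i. A i) g' = (\<Sum>i. set_lebesgue_integral lborel (A i) g')"
    if "range A \<subseteq> sets borel" "disjoint_family A" for A :: "nat \<Rightarrow> 'a set"
  proof (rule lebesgue_integral_countable_add)
    show "set_integrable lborel (\<Union> (range A)) g'" using that by (intro si) auto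
    show "A i \<in> sets lborel" for i using that by auto
    show "A i \<inter> A j = {}" if "i \<noteq> j" for i j
      using \<open>disjoint_family A\<close> that by (auto simp: disjoint_family_on_def)
  qed
  define E where "E = range (\<lambda>(a, b). box a b :: 'a set)"
  have sE: "sigma_sets UNIV E = sets borel"
    by (simp add: E_def borel_eq_box)
  \<comment> \<open>The whole space is not an open box, so it is exhausted by growing boxes. The
    complement step of the induction below subtracts from this value.\<close>
  have U: "set_lebesgue_integral lborel UNIV g' = 0"
  proof -
    have "(\<lambda>n. LINT x|lborel. indicator (box (- (real n *\<^sub>R One)) (real n *\<^sub>R One)) x *\<^sub>R g' x) \<longlonglongrightarrow> (LINT x|lborel. g' x)"
    proof (rule integral_dominated_convergence[where w="\<lambda>x. \<bar>g' x\<bar>"])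
      show "AE x in lborel. (\<lambda>n. indicat_real (box (- (real n *\<^sub>R One)) (real n *\<^sub>R One)) x *\<^sub>R g' x) \<longlonglongrightarrow> g' x"
      proof (rule AE_I2)
        fix x :: 'a
        obtain n0 where n0: "x \<in> box (- (real n0 *\<^sub>R One)) (real n0 *\<^sub>R One)"
          using UN_box_eq_UNIV by blast
        have "\<forall>\<^sub>F n in sequentially. indicat_real (box (- (real n *\<^sub>R One)) (real n *\<^sub>R One)) x *\<^sub>R g' x = g' x"
          using eventually_ge_at_top[of n0]
        proof eventually_elim
          case (elim n)
          then have "x \<in> box (- (real n *\<^sub>R One)) (real n *\<^sub>R One)"
            using n0 by (fastforce simp: mem_box)
          then show ?case by simp
        qed
        then show "(\<lambda>n. indicat_real (box (- (real n *\<^sub>R One)) (real n *\<^sub>R One)) x *\<^sub>R g' x) \<longlonglongrightarrow> g' x"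
          by (rule tendsto_eventually)
      qed
    qed (use i g'(1) in \<open>auto simp: indicator_def\<close>)
    then have "(\<lambda>n. 0::real) \<longlonglongrightarrow> (LINT x|lborel. g' x)"
      using z' by (simp add: set_lebesgue_integral_def)
    then show ?thesis by (simp add: set_lebesgue_integral_def LIMSEQ_const_iff)
  qed
  have all: "set_lebesgue_integral lborel A g' = 0" if "A \<in> sigma_sets UNIV E" for A
  proof -
    have "Int_stable E" by (auto simp: E_def Int_stable_def box_Int_box)
    moreover have "E \<subseteq> Pow UNIV" by simp
    ultimately show ?thesis using that
    proof (induction rule: sigma_sets_induct_disjoint)
      fix A assume "A \<in> E" then show "set_lebesgue_integral lborel A g' = 0" using z' by (auto simp: E_def)
    next
      show "set_lebesgue_integral lborel {} g' = 0" by (simp add: set_lebesgue_integral_def)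
    next
      fix A assume A: "A \<in> sigma_sets UNIV E" "set_lebesgue_integral lborel A g' = 0"
      then have Ab: "A \<in> sets borel" using sE by simp
      have "set_lebesgue_integral lborel (A \<union> (UNIV - A)) g' = set_lebesgue_integral lborel A g' + set_lebesgue_integral lborel (UNIV - A) g'"
        using Ab by (intro set_integral_Un si) auto
      then show "set_lebesgue_integral lborel (UNIV - A) g' = 0"
        using U A(2) by (simp add: Un_Diff_cancel)
    next
      fix A :: "nat \<Rightarrow> 'a set"
      assume "disjoint_family A" "range A \<subseteq> sigma_sets UNIV E" "\<And>i. set_lebesgue_integral lborel (A i) g' = 0"
      then show "set_lebesgue_integral lborel (\<Union> (range A)) g' = 0"
        using UN[of A] sE by simp
    qed
  qed
  have "AE x in lborel. g' x = 0"
    by (rule sigma_finite_measure.density_zero[OF sigma_finite_lborel i]) (use all sE in auto)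
  then have "AE x in lebesgue. g' x = 0" by (rule AE_completion)
  with ae show ?thesis by eventually_elim simp
qed

text \<open>On a box with closure in \<Omega> the indicator is a bounded limit of test functions, so
  all box integrals inside vanish. An open set is a countable union of such closed boxes, whence the
  exceptional sets together are null.\<close>

theorem fundamental_lemma:
  fixes f :: "'a::euclidean_space \<Rightarrow> real"
  assumes "open \<Omega>" and f: "set_integrable lebesgue \<Omega> f"
    and z: "\<And>\<psi>. \<psi> \<in> test_functions \<Omega> \<Longrightarrow> (LINT x:\<Omega>|lebesgue. f x * \<psi> x) = 0"
  shows "AE x in lebesgue. x \<in> \<Omega> \<longrightarrow> f x = 0"
proof -
  define g where "g = (\<lambda>x. indicator \<Omega> x * f x)"
  have g: "integrable lebesgue g" using f by (simp add: g_def set_integrable_def)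
  have box0: "(LINT x:box a b|lebesgue. g x) = 0" if ab: "cbox a b \<subseteq> \<Omega>" for a b
  proof -
    obtain \<psi> :: "nat \<Rightarrow> 'a \<Rightarrow> real" where \<psi>: "\<And>n. \<psi> n \<in> test_functions \<Omega>" "\<And>n x. \<bar>\<psi> n x\<bar> \<le> 1"
      "\<And>x. (\<lambda>n. \<psi> n x) \<longlonglongrightarrow> indicator (box a b) x"
      using ex_box_approximation[OF ab] by metis
    have "(\<lambda>n. LINT x|lebesgue. \<psi> n x * g x) \<longlonglongrightarrow> (LINT x|lebesgue. indicator (box a b) x * g x)"
    proof (rule integral_dominated_convergence[where w="\<lambda>x. \<bar>g x\<bar>"])
      show "AE x in lebesgue. (\<lambda>n. \<psi> n x * g x) \<longlonglongrightarrow> indicator (box a b) x * g x"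
        using \<psi>(3) by (intro AE_I2 tendsto_mult_right)
      show "AE x in lebesgue. norm (\<psi> i x * g x) \<le> \<bar>g x\<bar>" for i
        using \<psi>(2) mult_right_mono[OF \<psi>(2)] by (intro AE_I2) (fastforce simp: abs_mult)
    qed (use g test_function_measurable[OF \<psi>(1)] in \<open>auto intro: indicator_mult_measurable\<close>)
    moreover have "(LINT x|lebesgue. \<psi> n x * g x) = 0" for n
      using z[OF \<psi>(1)[of n]] by (simp add: g_def set_lebesgue_integral_def mult_ac)
    ultimately show ?thesis
      by (simp add: set_lebesgue_integral_def LIMSEQ_const_iff)
  qed
  have loc: "AE x in lebesgue. x \<in> cbox a b \<longrightarrow> f x = 0" if ab: "cbox a b \<subseteq> \<Omega>" for a b
  proof (cases "box a b = {}")
    case True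
    then have "cbox a b \<in> null_sets lebesgue"
      by (simp add: content_eq_0_interior negligible_iff_null_sets[symmetric] negligible_interval)
    from AE_not_in[OF this] show ?thesis by (rule eventually_mono) blast
  next
    case False
    \<comment> \<open>After the cut-off, an integral over an arbitrary box is one over the
      intersection with \<open>box a b\<close>. If that is nonempty, it is again a box with closure
      in \<Omega>.\<close>
    have ae: "AE x in lebesgue. indicator (box a b) x * g x = 0"
    proof (rule AE_zero_if_box_integrals_zero)
      show "integrable lebesgue (\<lambda>x. indicator (box a b) x * g x)"
        using integrable_mult_indicator[OF _ g, of "box a b"] by simp
      fix c d :: 'a
      obtain p q where pq: "box a b \<inter> box c d = box p q" by (rule that) (rule box_Int_box)
      have "(LINT x:box p q|lebesgue. g x) = 0"
      proof (cases "box p q = {}")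
        case False
        then have "cbox p q = closure (box p q)" by simp
        also have "\<dots> \<subseteq> cbox a b" using pq by (metis Int_lower1 box_subset_cbox closed_cbox closure_minimal order_trans)
        finally show ?thesis using ab by (intro box0) auto
      qed (simp add: set_lebesgue_integral_def)
      then show "(LINT x:box c d|lebesgue. indicator (box a b) x * g x) = 0"
        unfolding pq[symmetric] set_lebesgue_integral_def by (simp add: indicator_inter_arith mult_ac)
    qed
    have "cbox a b - box a b \<in> null_sets lebesgue"
      using negligible_frontier_interval by (simp add: negligible_iff_null_sets)
    from AE_not_in[OF this] ae show ?thesis
    proof eventually_elim
      case (elim x)
      show ?case
      proof
        assume x: "x \<in> cbox a b"
        with elim(1) have "x \<in> box a b" by blast
        moreover have "x \<in> \<Omega>" using x ab by blast
        ultimately show "f x = 0" using elim(2) by (simp add: g_def)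
      qed
    qed
  qed
  obtain D where D: "countable D" "D \<subseteq> Pow \<Omega>" "\<And>X. X \<in> D \<Longrightarrow> \<exists>a b. X = cbox a b" "\<Union>D = \<Omega>"
    using open_countable_Union_open_cbox[OF assms(1)] by metis
  have "AE x in lebesgue. x \<in> X \<longrightarrow> f x = 0" if X: "X \<in> D" for X :: "'a set"
  proof -
    obtain a b where "X = cbox a b" using D(3)[OF X] by blast
    then show ?thesis using loc[of a b] D(2) X by blast
  qed
  then have "\<forall>X\<in>D. AE x in lebesgue. x \<in> X \<longrightarrow> f x = 0" ..
  then have ae: "AE x in lebesgue. \<forall>X\<in>D. x \<in> X \<longrightarrow> f x = 0"
    unfolding AE_ball_countable[OF D(1)] .
  show ?thesis
  proof (rule eventually_mono[OF ae])
    fix x assume "\<forall>X\<in>D. x \<in> X \<longrightarrow> f x = 0"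
    then show "x \<in> \<Omega> \<longrightarrow> f x = 0" unfolding D(4)[symmetric] by blast
  qed
qed

section \<open>Positive semidefinite forms\<close>

definition fsubspace :: "('x \<Rightarrow> 'b::real_vector) set \<Rightarrow> bool" where
  "fsubspace V \<longleftrightarrow> (\<lambda>x. 0) \<in> V \<and> (\<forall>u\<in>V. \<forall>w\<in>V. \<forall>c. (\<lambda>x. u x + c *\<^sub>R w x) \<in> V)"

definition fspan :: "('x \<Rightarrow> 'b::real_vector) set \<Rightarrow> ('x \<Rightarrow> 'b) set" where
  "fspan \<Phi> = \<Inter>{W. fsubspace W \<and> \<Phi> \<subseteq> W}"

text \<open>Semidefinite rather than definite, because a function that vanishes almost everywhere
  need not be the zero function although its norm is zero.\<close>

definition psd_form :: "('x \<Rightarrow> 'b::real_vector) set \<Rightarrow> (('x \<Rightarrow> 'b) \<Rightarrow> ('x \<Rightarrow> 'b) \<Rightarrow> real) \<Rightarrow> bool" where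
  "psd_form V m \<longleftrightarrow> (\<forall>u\<in>V. \<forall>w\<in>V. m u w = m w u) \<and> (\<forall>u\<in>V. 0 \<le> m u u) \<and>
     (\<forall>u\<in>V. \<forall>v\<in>V. \<forall>w\<in>V. \<forall>c. m (\<lambda>x. u x + c *\<^sub>R v x) w = m u w + c * m v w)"

lemma fsubspaceD:
  assumes "fsubspace V"
  shows "(\<lambda>x. 0) \<in> V" "u \<in> V \<Longrightarrow> w \<in> V \<Longrightarrow> (\<lambda>x. u x + c *\<^sub>R w x) \<in> V"
  using assms by (auto simp: fsubspace_def)

lemma fsubspace_scale:
  assumes "fsubspace V" "w \<in> V"
  shows "(\<lambda>x. c *\<^sub>R w x) \<in> V"
  using fsubspaceD(2)[OF assms(1) fsubspaceD(1)[OF assms(1)] assms(2), of c] by simp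

lemma fsubspace_sum:
  assumes "fsubspace V" "\<And>i. i \<in> I \<Longrightarrow> f i \<in> V"
  shows "(\<lambda>x. \<Sum>i\<in>I. c i *\<^sub>R f i x) \<in> V"
  using assms(2)
proof (induction I rule: infinite_finite_induct)
  case (insert i I)
  have "(\<lambda>x. (\<Sum>i\<in>I. c i *\<^sub>R f i x) + c i *\<^sub>R f i x) \<in> V"
    using insert by (intro fsubspaceD(2)[OF assms(1)]) auto
  moreover have "(\<lambda>x. (\<Sum>i\<in>I. c i *\<^sub>R f i x) + c i *\<^sub>R f i x) = (\<lambda>x. \<Sum>i\<in>insert i I. c i *\<^sub>R f i x)"
    using insert.hyps by (simp add: add.commute)
  ultimately show ?case by (simp only:)
qed (use fsubspaceD(1)[OF assms(1)] in auto)

lemma fsubspace_fspan: "fsubspace (fspan \<Phi>)"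
  by (auto simp: fspan_def fsubspace_def)

lemma fspan_superset: "\<Phi> \<subseteq> fspan \<Phi>"
  by (auto simp: fspan_def)

lemma fspan_minimal: "fsubspace W \<Longrightarrow> \<Phi> \<subseteq> W \<Longrightarrow> fspan \<Phi> \<subseteq> W"
  by (auto simp: fspan_def)

lemma psd_formD:
  assumes "psd_form V m"
  shows "u \<in> V \<Longrightarrow> w \<in> V \<Longrightarrow> m u w = m w u"
    and "u \<in> V \<Longrightarrow> 0 \<le> m u u"
    and "u \<in> V \<Longrightarrow> v \<in> V \<Longrightarrow> w \<in> V \<Longrightarrow> m (\<lambda>x. u x + c *\<^sub>R v x) w = m u w + c * m v w"
  using assms unfolding psd_form_def by blast+

lemma psd_form_right:
  assumes "psd_form V m" "fsubspace V" "u \<in> V" "v \<in> V" "w \<in> V"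
  shows "m w (\<lambda>x. u x + c *\<^sub>R v x) = m w u + c * m w v"
proof -
  have "m w (\<lambda>x. u x + c *\<^sub>R v x) = m (\<lambda>x. u x + c *\<^sub>R v x) w"
    using assms by (intro psd_formD(1)[OF assms(1)] fsubspaceD) auto
  then show ?thesis
    using psd_formD(3)[OF assms(1,3,4,5), of c] psd_formD(1)[OF assms(1)] assms by simp
qed

lemma psd_form_subset: "psd_form V m \<Longrightarrow> W \<subseteq> V \<Longrightarrow> psd_form W m"
  unfolding psd_form_def by blast

lemma psd_form_zero:
  assumes "psd_form V m" "fsubspace V" "w \<in> V"
  shows "m (\<lambda>x. 0) w = 0" "m w (\<lambda>x. 0) = 0"
proof -
  have z: "(\<lambda>x. 0) \<in> V" by (rule fsubspaceD(1)[OF assms(2)])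
  show "m (\<lambda>x. 0) w = 0" using psd_formD(3)[OF assms(1) z z assms(3), of 1] by simp
  then show "m w (\<lambda>x. 0) = 0" using psd_formD(1)[OF assms(1) z assms(3)] by simp
qed

lemma psd_form_sum_left:
  assumes "psd_form V m" "fsubspace V" "\<And>i. i \<in> I \<Longrightarrow> f i \<in> V" "w \<in> V"
  shows "m (\<lambda>x. \<Sum>i\<in>I. c i *\<^sub>R f i x) w = (\<Sum>i\<in>I. c i * m (f i) w)"
  using assms(3)
proof (induction I rule: infinite_finite_induct)
  case (insert i I)
  have "m (\<lambda>x. (\<Sum>i\<in>I. c i *\<^sub>R f i x) + c i *\<^sub>R f i x) w = m (\<lambda>x. \<Sum>i\<in>I. c i *\<^sub>R f i x) w + c i * m (f i) w"
    using insert assms by (intro psd_formD(3)[OF assms(1)] fsubspace_sum) auto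
  moreover have "(\<lambda>x. (\<Sum>i\<in>I. c i *\<^sub>R f i x) + c i *\<^sub>R f i x) = (\<lambda>x. \<Sum>i\<in>insert i I. c i *\<^sub>R f i x)"
    using insert.hyps by (simp add: add.commute)
  ultimately have "m (\<lambda>x. \<Sum>i\<in>insert i I. c i *\<^sub>R f i x) w = m (\<lambda>x. \<Sum>i\<in>I. c i *\<^sub>R f i x) w + c i * m (f i) w"
    by (simp only:)
  then show ?case using insert by simp
qed (use psd_form_zero(1)[OF assms(1,2,4)] in auto)

lemma psd_form_expand:
  assumes "psd_form V m" "fsubspace V" "u \<in> V" "v \<in> V"
  shows "m (\<lambda>x. u x + c *\<^sub>R v x) (\<lambda>x. u x + c *\<^sub>R v x) = m u u + 2 * c * m u v + c\<^sup>2 * m v v"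
proof -
  have "(\<lambda>x. u x + c *\<^sub>R v x) \<in> V" using assms fsubspaceD by blast
  then have "m (\<lambda>x. u x + c *\<^sub>R v x) (\<lambda>x. u x + c *\<^sub>R v x) = m u (\<lambda>x. u x + c *\<^sub>R v x) + c * m v (\<lambda>x. u x + c *\<^sub>R v x)"
    using psd_formD(3)[OF assms(1)] assms by blast
  also have "\<dots> = m u u + c * m u v + c * (m v u + c * m v v)"
    using assms by (simp add: psd_form_right[OF assms(1,2)])
  also have "m v u = m u v" using assms psd_formD(1) by blast
  finally show ?thesis by (simp add: algebra_simps power2_eq_square)
qed

text \<open>The degenerate case is the one used most: a vector of norm zero is orthogonal to
  everything, so null vectors can be ignored in every form.\<close>

lemma psd_form_cauchy:
  assumes "psd_form V m" "fsubspace V" "u \<in> V" "v \<in> V"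
  shows "(m u v)\<^sup>2 \<le> m u u * m v v"
proof -
  have q: "0 \<le> m u u + 2 * c * m u v + c\<^sup>2 * m v v" for c
    using psd_formD(2)[OF assms(1) fsubspaceD(2)[OF assms(2,3,4), of c]] psd_form_expand[OF assms, of c] by simp
  have vv: "0 \<le> m v v" using psd_formD(2)[OF assms(1,4)] .
  show ?thesis
  proof (cases "m v v = 0")
    case True
    have "m u v = 0"
    proof (rule ccontr)
      assume "m u v \<noteq> 0"
      \<comment> \<open>At this parameter the quadratic takes the value -1.\<close>
      then show False
        using q[of "- (m u u + 1) / (2 * m u v)"] True psd_formD(2)[OF assms(1,3)] by (simp add: field_simps)
    qed
    then show ?thesis using True by simp
  next
    case False
    with vv have p: "m v v > 0" by simp
    have "0 \<le> (m u u + 2 * (- m u v / m v v) * m u v + (- m u v / m v v)\<^sup>2 * m v v) * m v v"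
      using q[of "- m u v / m v v"] p by (intro mult_nonneg_nonneg) auto
    also have "\<dots> = m u u * m v v - (m u v)\<^sup>2"
      using p by (simp add: field_simps power2_eq_square)
    finally show ?thesis by simp
  qed
qed

lemma psd_form_triangle:
  assumes "psd_form V m" "fsubspace V" "u \<in> V" "v \<in> V"
  shows "sqrt (m (\<lambda>x. u x + c *\<^sub>R v x) (\<lambda>x. u x + c *\<^sub>R v x)) \<le> sqrt (m u u) + \<bar>c\<bar> * sqrt (m v v)"
proof (rule real_le_lsqrt)
  have n: "0 \<le> m u u" "0 \<le> m v v" using psd_formD(2)[OF assms(1)] assms by auto
  then show "0 \<le> sqrt (m u u) + \<bar>c\<bar> * sqrt (m v v)" by simp
  have "\<bar>m u v\<bar> \<le> sqrt (m u u) * sqrt (m v v)"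
    using real_le_rsqrt[OF psd_form_cauchy[OF assms]] psd_form_cauchy[OF assms]
    by (metis real_sqrt_abs real_sqrt_le_mono real_sqrt_mult)
  then have "c * m u v \<le> \<bar>c\<bar> * (sqrt (m u u) * sqrt (m v v))"
    by (metis abs_ge_self abs_mult abs_ge_zero mult_left_mono order_trans)
  then show "m (\<lambda>x. u x + c *\<^sub>R v x) (\<lambda>x. u x + c *\<^sub>R v x) \<le> (sqrt (m u u) + \<bar>c\<bar> * sqrt (m v v))\<^sup>2"
    unfolding psd_form_expand[OF assms] using n by (simp add: power2_sum power_mult_distrib mult.left_commute)
qed

lemma psd_form_add:
  assumes "psd_form V m" "psd_form V m'"
  shows "psd_form V (\<lambda>u v. m u v + m' u v)"
  using assms unfolding psd_form_def by (auto simp: algebra_simps)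

text \<open>Gram-Schmidt as an induction over the generators: solve on the old span, then correct
  along the part of the new generator that is orthogonal to it. That the functional kills null
  vectors is what allows this residual to have norm zero.\<close>

lemma psd_form_riesz:
  fixes \<Phi> :: "('x \<Rightarrow> 'b::real_vector) set"
  assumes V: "fsubspace V" and m: "psd_form V m" and "finite \<Phi>" "\<Phi> \<subseteq> V"
    and lin: "\<And>u v c. u \<in> V \<Longrightarrow> v \<in> V \<Longrightarrow> \<l> (\<lambda>x. u x + c *\<^sub>R v x) = \<l> u + c * \<l> v"
    and null: "\<And>u. u \<in> V \<Longrightarrow> m u u = 0 \<Longrightarrow> \<l> u = 0"
  shows "\<exists>w\<in>fspan \<Phi>. \<forall>z\<in>fspan \<Phi>. m w z = \<l> z"
  using assms(3,4) lin null
proof (induction \<Phi> arbitrary: \<l> rule: finite_induct)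
  case empty
  have "fspan {} \<subseteq> {\<lambda>x. 0::'b}" by (intro fspan_minimal) (auto simp: fsubspace_def)
  moreover have z: "(\<lambda>x. 0::'b) \<in> V" using V fsubspaceD by blast
  moreover have "\<l> (\<lambda>x. 0) = 0" using empty.prems(3)[OF z] psd_form_zero[OF m V z] by blast
  ultimately have "m (\<lambda>x. 0) z = \<l> z" if "z \<in> fspan {}" for z
    using psd_form_zero(1)[OF m V z] that by (simp add: subset_singleton_iff) auto
  then show ?case using fsubspaceD(1)[OF fsubspace_fspan] by (intro bexI[of _ "\<lambda>x. 0"] ballI)
next
  case (insert \<phi> \<Phi>)
  have sub: "fspan \<Phi> \<subseteq> fspan (insert \<phi> \<Phi>)"
    by (intro fspan_minimal fsubspace_fspan) (use fspan_superset in blast)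
  have subV: "fspan (insert \<phi> \<Phi>) \<subseteq> V" using insert.prems(1) V by (intro fspan_minimal)
  have \<phi>: "\<phi> \<in> V" "\<phi> \<in> fspan (insert \<phi> \<Phi>)" using insert.prems(1) fspan_superset[of "insert \<phi> \<Phi>"] by auto
  obtain w0 where w0: "w0 \<in> fspan \<Phi>" "\<And>z. z \<in> fspan \<Phi> \<Longrightarrow> m w0 z = \<l> z"
    using insert.IH[of \<l>] insert.prems by auto
  \<comment> \<open>The induction hypothesis for the functional \<open>m \<phi>\<close> yields an
    orthogonal projection of the new generator onto the old span. This is why the functional is kept
    arbitrary in the induction.\<close>
  have "\<exists>w\<in>fspan \<Phi>. \<forall>z\<in>fspan \<Phi>. m w z = m \<phi> z"
  proof (rule insert.IH)
    show "\<Phi> \<subseteq> V" using insert.prems by auto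
    show "m \<phi> (\<lambda>x. u x + c *\<^sub>R v x) = m \<phi> u + c * m \<phi> v" if "u \<in> V" "v \<in> V" for u v c
      using psd_form_right[OF m V that \<phi>(1)] .
    show "m \<phi> u = 0" if "u \<in> V" "m u u = 0" for u
      using psd_form_cauchy[OF m V \<phi>(1) that(1)] that(2) by simp
  qed
  then obtain u0 where u0: "u0 \<in> fspan \<Phi>" "\<And>z. z \<in> fspan \<Phi> \<Longrightarrow> m u0 z = m \<phi> z" by blast
  have V0: "w0 \<in> V" "u0 \<in> V" using w0 u0 sub subV by auto
  define e where "e = (\<lambda>x. \<phi> x + (-1) *\<^sub>R u0 x)"
  have e: "e \<in> V" "e \<in> fspan (insert \<phi> \<Phi>)"
    unfolding e_def using fsubspaceD(2)[OF V \<phi>(1) V0(2)] fsubspaceD(2)[OF fsubspace_fspan \<phi>(2)] u0(1) sub by blast+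
  have orth: "m e z = 0" if "z \<in> fspan \<Phi>" for z
    using that u0(2)[OF that] psd_formD(3)[OF m \<phi>(1) V0(2), of z "-1"] sub subV unfolding e_def by auto
  have le: "\<l> e = \<l> \<phi> - \<l> u0" unfolding e_def using insert.prems(2)[OF \<phi>(1) V0(2), of "-1"] by simp
  have me: "m w e = m w \<phi> - m w u0" if "w \<in> V" for w
    unfolding e_def using psd_form_right[OF m V \<phi>(1) V0(2) that, of "-1"] by simp
  have w0e: "m w0 e = 0" using orth[OF w0(1)] psd_formD(1)[OF m V0(1) e(1)] by simp
  \<comment> \<open>If e is a null vector, division by zero gives t = 0, and the functional vanishes
    at e as well, so the next equation survives.\<close>
  define t where "t = \<l> e / m e e"
  have te: "t * m e e = \<l> e"
    using insert.prems(3)[OF e(1)] by (cases "m e e = 0") (auto simp: t_def)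
  define w where "w = (\<lambda>x. w0 x + t *\<^sub>R e x)"
  have w: "w \<in> fspan (insert \<phi> \<Phi>)" unfolding w_def
    using fsubspaceD(2)[OF fsubspace_fspan] w0(1) sub e(2) by blast
  have mw: "m w z = m w0 z + t * m e z" if "z \<in> V" for z
    unfolding w_def using psd_formD(3)[OF m V0(1) e(1) that] .
  have good1: "m w z = \<l> z" if "z \<in> fspan \<Phi>" for z
    using mw[of z] orth[OF that] w0(2)[OF that] that sub subV by auto
  have "m w e = \<l> e" using mw[OF e(1)] w0e te by simp
  then have good2: "m w \<phi> = \<l> \<phi>"
    using me[of w] good1[OF u0(1)] le w subV by auto
  define Z where "Z = {z \<in> V. m w z = \<l> z}"
  have wV: "w \<in> V" using w subV by auto
  have "fsubspace Z" unfolding fsubspace_def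
  proof (intro conjI ballI allI)
    have z: "(\<lambda>x. 0) \<in> V" by (rule fsubspaceD(1)[OF V])
    then show "(\<lambda>x. 0) \<in> Z"
      using psd_form_zero[OF m V wV] psd_form_zero[OF m V z] insert.prems(3)[OF z] by (simp add: Z_def)
    fix u v c assume "u \<in> Z" "v \<in> Z"
    then show "(\<lambda>x. u x + c *\<^sub>R v x) \<in> Z"
      using fsubspaceD(2)[OF V] psd_form_right[OF m V _ _ wV] insert.prems(2) by (simp add: Z_def)
  qed
  moreover have "insert \<phi> \<Phi> \<subseteq> Z"
    using good2 \<phi>(1) good1 fspan_superset[of \<Phi>] insert.prems(1) by (auto simp: Z_def)
  ultimately have "fspan (insert \<phi> \<Phi>) \<subseteq> Z" by (rule fspan_minimal)
  then show ?case using w by (auto simp: Z_def)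
qed

section \<open>Weak gradients\<close>

definition l2v :: "'a::euclidean_space set \<Rightarrow> ('a \<Rightarrow> 'b::euclidean_space) \<Rightarrow> ('a \<Rightarrow> 'b) \<Rightarrow> real" where
  "l2v \<Omega> f g = (LINT x:\<Omega>|lebesgue. f x \<bullet> g x)"

lemma l2_inner_eq_l2v: "l2_inner = l2v"
  by (intro ext) (simp add: l2_inner_def l2v_def)

lemma dirichlet_form_eq_l2v: "dirichlet_form \<Omega> v w = l2v \<Omega> (weak_grad \<Omega> v) (weak_grad \<Omega> w)"
  by (simp add: dirichlet_form_def l2v_def)

section \<open>Square integrable functions\<close>

lemma L2_iff:
  "f \<in> L2 \<Omega> \<longleftrightarrow> (\<lambda>x. indicat_real \<Omega> x *\<^sub>R f x) \<in> borel_measurable lebesgue \<and>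
     integrable lebesgue (\<lambda>x. (norm (indicat_real \<Omega> x *\<^sub>R f x))\<^sup>2)"
proof -
  have "(norm (indicat_real \<Omega> x *\<^sub>R f x))\<^sup>2 = indicat_real \<Omega> x *\<^sub>R (norm (f x))\<^sup>2" for x
    by (auto simp: indicator_def)
  then show ?thesis
    unfolding L2_def set_borel_measurable_def set_integrable_def by simp
qed

lemma L2_inner_integrable:
  assumes "f \<in> L2 \<Omega>" "g \<in> L2 \<Omega>"
  shows "set_integrable lebesgue \<Omega> (\<lambda>x. f x \<bullet> g x)"
proof -
  let ?F = "\<lambda>x. indicat_real \<Omega> x *\<^sub>R f x" and ?G = "\<lambda>x. indicat_real \<Omega> x *\<^sub>R g x"
  have m: "?F \<in> borel_measurable lebesgue" "?G \<in> borel_measurable lebesgue"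
    and i: "integrable lebesgue (\<lambda>x. (norm (?F x))\<^sup>2)" "integrable lebesgue (\<lambda>x. (norm (?G x))\<^sup>2)"
    using assms by (auto simp only: L2_iff)
  have "integrable lebesgue (\<lambda>x. ?F x \<bullet> ?G x)"
  proof (rule Bochner_Integration.integrable_bound)
    show "integrable lebesgue (\<lambda>x. (norm (?F x))\<^sup>2 + (norm (?G x))\<^sup>2)"
      using i by (rule Bochner_Integration.integrable_add)
    show "(\<lambda>x. ?F x \<bullet> ?G x) \<in> borel_measurable lebesgue"
      by (rule borel_measurable_inner[OF m])
    have "\<bar>?F x \<bullet> ?G x\<bar> \<le> (norm (?F x))\<^sup>2 + (norm (?G x))\<^sup>2" for x
    proof -
      have "\<bar>?F x \<bullet> ?G x\<bar> \<le> norm (?F x) * norm (?G x)" by (rule Cauchy_Schwarz_ineq2)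
      moreover have "0 \<le> (norm (?F x) - norm (?G x))\<^sup>2" by simp
      moreover have "0 \<le> norm (?F x) * norm (?G x)" by simp
      ultimately show ?thesis unfolding power2_diff by linarith
    qed
    then show "AE x in lebesgue. norm (?F x \<bullet> ?G x) \<le> norm ((norm (?F x))\<^sup>2 + (norm (?G x))\<^sup>2)"
      by (intro AE_I2) (metis abs_ge_self order_trans real_norm_def)
  qed
  moreover have "?F x \<bullet> ?G x = indicat_real \<Omega> x *\<^sub>R (f x \<bullet> g x)" for x
    by (auto simp: indicator_def)
  ultimately show ?thesis unfolding set_integrable_def by (simp only:)
qed

lemma L2_add_scale:
  assumes "f \<in> L2 \<Omega>" "g \<in> L2 \<Omega>"
  shows "(\<lambda>x. f x + c *\<^sub>R g x) \<in> L2 \<Omega>"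
proof -
  let ?F = "\<lambda>x. indicat_real \<Omega> x *\<^sub>R f x" and ?G = "\<lambda>x. indicat_real \<Omega> x *\<^sub>R g x"
  have m: "?F \<in> borel_measurable lebesgue" "?G \<in> borel_measurable lebesgue"
    using assms by (auto simp only: L2_iff)
  have eq: "indicat_real \<Omega> x *\<^sub>R (f x + c *\<^sub>R g x) = ?F x + c *\<^sub>R ?G x" for x
    by (simp add: algebra_simps)
  have "integrable lebesgue (\<lambda>x. indicat_real \<Omega> x *\<^sub>R (f x \<bullet> f x) + 2 * c * (indicat_real \<Omega> x *\<^sub>R (f x \<bullet> g x)) + c\<^sup>2 * (indicat_real \<Omega> x *\<^sub>R (g x \<bullet> g x)))"
    using L2_inner_integrable[OF assms] L2_inner_integrable[OF assms(1,1)] L2_inner_integrable[OF assms(2,2)]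
    unfolding set_integrable_def by (intro Bochner_Integration.integrable_add integrable_mult_right)
  moreover have "indicat_real \<Omega> x *\<^sub>R (f x \<bullet> f x) + 2 * c * (indicat_real \<Omega> x *\<^sub>R (f x \<bullet> g x)) + c\<^sup>2 * (indicat_real \<Omega> x *\<^sub>R (g x \<bullet> g x))
      = (norm (?F x + c *\<^sub>R ?G x))\<^sup>2" for x
    unfolding power2_norm_eq_inner
    by (auto simp: indicator_def inner_add_left inner_add_right inner_commute algebra_simps power2_eq_square)
  ultimately have "integrable lebesgue (\<lambda>x. (norm (?F x + c *\<^sub>R ?G x))\<^sup>2)" by (simp only:)
  moreover have "(\<lambda>x. ?F x + c *\<^sub>R ?G x) \<in> borel_measurable lebesgue"
    by (intro borel_measurable_add borel_measurable_scaleR m borel_measurable_const)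
  ultimately show ?thesis unfolding L2_iff eq by blast
qed

lemma L2_zero: "(\<lambda>x. 0) \<in> L2 \<Omega>"
  by (simp add: L2_iff)

lemma fsubspace_L2: "fsubspace (L2 \<Omega>)"
  unfolding fsubspace_def using L2_zero L2_add_scale by blast

lemma psd_form_l2v: "psd_form (L2 \<Omega>) (l2v \<Omega>)"
  unfolding psd_form_def
proof (intro conjI ballI allI)
  fix u v w :: "'a \<Rightarrow> 'b" and c :: real assume L: "u \<in> L2 \<Omega>" "v \<in> L2 \<Omega>" "w \<in> L2 \<Omega>"
  have "l2v \<Omega> (\<lambda>x. u x + c *\<^sub>R v x) w = (LINT x:\<Omega>|lebesgue. (u x \<bullet> w x) + c * (v x \<bullet> w x))"
    unfolding l2v_def by (simp add: inner_add_left)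
  also have "\<dots> = l2v \<Omega> u w + c * l2v \<Omega> v w"
    unfolding l2v_def using L2_inner_integrable L
    by (subst set_integral_add(2)) auto
  finally show "l2v \<Omega> (\<lambda>x. u x + c *\<^sub>R v x) w = l2v \<Omega> u w + c * l2v \<Omega> v w" .
next
  fix u :: "'a \<Rightarrow> 'b"
  show "0 \<le> l2v \<Omega> u u" unfolding l2v_def set_lebesgue_integral_def
    by (intro Bochner_Integration.integral_nonneg) auto
qed (simp add: l2v_def inner_commute)

text \<open>Lebesgue measure is complete: preimages under f and g differ by a subset of a null
  set.\<close>

lemma borel_measurable_lebesgue_ae:
  fixes f g :: "'a::euclidean_space \<Rightarrow> real"
  assumes "f \<in> borel_measurable lebesgue" "AE x in lebesgue. f x = g x"
  shows "g \<in> borel_measurable lebesgue"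
proof (rule measurableI)
  fix A :: "real set" assume A: "A \<in> sets borel"
  have "AE x in lebesgue. x \<in> f -` A \<longleftrightarrow> x \<in> g -` A"
    using assms(2) by eventually_elim simp
  moreover have "f -` A \<in> sets lebesgue" using measurable_sets[OF assms(1) A] by simp
  ultimately have "g -` A \<in> sets lebesgue" by (rule completion.in_sets_AE) simp
  then show "g -` A \<inter> space lebesgue \<in> sets lebesgue" by simp
qed simp

text \<open>By completeness the two restricted functions are measurable together. If they are not
  measurable, neither is integrable and both integrals have the default value 0.\<close>

lemma set_integral_cong_ae:
  fixes f g :: "'a::euclidean_space \<Rightarrow> real"
  assumes "AE x in lebesgue. x \<in> \<Omega> \<longrightarrow> f x = g x"
  shows "(LINT x:\<Omega>|lebesgue. f x) = (LINT x:\<Omega>|lebesgue. g x)"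
    and "set_integrable lebesgue \<Omega> f \<longleftrightarrow> set_integrable lebesgue \<Omega> g"
proof -
  let ?F = "\<lambda>x. indicat_real \<Omega> x *\<^sub>R f x" and ?G = "\<lambda>x. indicat_real \<Omega> x *\<^sub>R g x"
  have ae: "AE x in lebesgue. ?F x = ?G x"
    using assms by eventually_elim (auto simp: indicator_def)
  then have ae': "AE x in lebesgue. ?G x = ?F x" by eventually_elim (rule sym)
  have meas: "?F \<in> borel_measurable lebesgue \<longleftrightarrow> ?G \<in> borel_measurable lebesgue"
  proof
    assume "?F \<in> borel_measurable lebesgue"
    then show "?G \<in> borel_measurable lebesgue"
      using ae by (rule borel_measurable_lebesgue_ae)
  next
    assume "?G \<in> borel_measurable lebesgue"
    then show "?F \<in> borel_measurable lebesgue"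
      using ae' by (rule borel_measurable_lebesgue_ae)
  qed
  show i: "set_integrable lebesgue \<Omega> f \<longleftrightarrow> set_integrable lebesgue \<Omega> g"
  proof (cases "?F \<in> borel_measurable lebesgue")
    case True
    then show ?thesis unfolding set_integrable_def
      by (intro integrable_cong_AE[OF _ _ ae]) (use meas in blast)+
  next
    case False
    then have "\<not> integrable lebesgue ?F" "\<not> integrable lebesgue ?G"
      using meas borel_measurable_integrable[of lebesgue ?F] borel_measurable_integrable[of lebesgue ?G] by blast+
    then show ?thesis unfolding set_integrable_def by blast
  qed
  show "(LINT x:\<Omega>|lebesgue. f x) = (LINT x:\<Omega>|lebesgue. g x)"
  proof (cases "?F \<in> borel_measurable lebesgue")
    case True
    then show ?thesis unfolding set_lebesgue_integral_def using meas integral_cong_AE[OF _ _ ae] by blast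
  next
    case False
    then have "\<not> integrable lebesgue ?F" "\<not> integrable lebesgue ?G"
      using meas borel_measurable_integrable[of lebesgue ?F] borel_measurable_integrable[of lebesgue ?G] by blast+
    from this[THEN not_integrable_integral_eq] show ?thesis unfolding set_lebesgue_integral_def by argo
  qed
qed

lemma l2v_cong_ae:
  assumes "AE x in lebesgue. x \<in> \<Omega> \<longrightarrow> f x = f' x" "AE x in lebesgue. x \<in> \<Omega> \<longrightarrow> g x = g' x"
  shows "l2v \<Omega> f g = l2v \<Omega> f' g'"
  unfolding l2v_def
  by (rule set_integral_cong_ae(1)) (use assms in eventually_elim, auto)

lemma l2v_eq_0_imp_ae:
  assumes "f \<in> L2 \<Omega>" "l2v \<Omega> f f = 0"
  shows "AE x in lebesgue. x \<in> \<Omega> \<longrightarrow> f x = 0"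
proof -
  have "integrable lebesgue (\<lambda>x. indicat_real \<Omega> x *\<^sub>R (f x \<bullet> f x))"
    using L2_inner_integrable[OF assms(1,1)] unfolding set_integrable_def .
  moreover have "(LINT x|lebesgue. indicat_real \<Omega> x *\<^sub>R (f x \<bullet> f x)) = 0"
    using assms(2) unfolding l2v_def set_lebesgue_integral_def .
  ultimately have "AE x in lebesgue. indicat_real \<Omega> x *\<^sub>R (f x \<bullet> f x) = 0"
    by (subst (asm) integral_nonneg_eq_0_iff_AE) auto
  then show ?thesis by eventually_elim auto
qed

lemma bounded_measurable_L2:
  fixes f :: "'a::euclidean_space \<Rightarrow> 'b::euclidean_space"
  assumes "bounded \<Omega>" "\<Omega> \<in> sets lebesgue" "f \<in> borel_measurable lebesgue" "AE x in lebesgue. x \<in> \<Omega> \<longrightarrow> norm (f x) \<le> C"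
  shows "f \<in> L2 \<Omega>"
  unfolding L2_iff
proof
  show m: "(\<lambda>x. indicat_real \<Omega> x *\<^sub>R f x) \<in> borel_measurable lebesgue"
    using assms by (intro borel_measurable_scaleR borel_measurable_indicator)
  have "\<Omega> \<in> lmeasurable" using assms bounded_set_imp_lmeasurable by blast
  then have "integrable lebesgue (\<lambda>x. C\<^sup>2 * indicat_real \<Omega> x)"
    by (intro integrable_mult_right integrable_real_indicator) (auto simp: fmeasurable_def)
  moreover have "(\<lambda>x. (norm (indicat_real \<Omega> x *\<^sub>R f x))\<^sup>2) \<in> borel_measurable lebesgue"
    by (intro borel_measurable_power measurable_compose[OF m borel_measurable_norm])
  moreover have "AE x in lebesgue. norm ((norm (indicat_real \<Omega> x *\<^sub>R f x))\<^sup>2) \<le> norm (C\<^sup>2 * indicat_real \<Omega> x)"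
    using assms(4)
  proof eventually_elim
    case (elim x)
    then show ?case by (cases "x \<in> \<Omega>") (auto intro!: power_mono)
  qed
  ultimately show "integrable lebesgue (\<lambda>x. (norm (indicat_real \<Omega> x *\<^sub>R f x))\<^sup>2)"
    by (rule Bochner_Integration.integrable_bound)
qed

lemma test_function_L2:
  assumes "\<psi> \<in> test_functions \<Omega>'" "bounded \<Omega>" "\<Omega> \<in> sets lebesgue"
  shows "\<psi> \<in> L2 \<Omega>"
proof -
  obtain C where "\<And>x. \<bar>\<psi> x\<bar> \<le> C" using test_function_bounded[OF assms(1)] by metis
  then show ?thesis
    by (intro bounded_measurable_L2[where C=C] assms test_function_measurable[OF assms(1)] AE_I2) simp
qed

section \<open>Classical and weak gradients\<close>

definition grad :: "('a::euclidean_space \<Rightarrow> real) \<Rightarrow> 'a \<Rightarrow> 'a" where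
  "grad \<psi> x = (\<Sum>b\<in>Basis. frechet_derivative \<psi> (at x) b *\<^sub>R b)"

lemma grad_inner_Basis: "b \<in> Basis \<Longrightarrow> grad \<psi> x \<bullet> b = frechet_derivative \<psi> (at x) b"
  by (simp add: grad_def inner_sum_left_Basis)

lemma grad_inner: "smooth \<psi> \<Longrightarrow> grad \<psi> x \<bullet> h = frechet_derivative \<psi> (at x) h"
  by (subst smooth_frechet_expand) (auto simp: grad_def inner_sum_left inner_commute[of h] intro!: sum.cong)

lemma L2_component:
  assumes "g \<in> L2 \<Omega>"
  shows "(\<lambda>x. g x \<bullet> b) \<in> L2 \<Omega>"
  unfolding L2_iff
proof
  have m: "(\<lambda>x. indicat_real \<Omega> x *\<^sub>R g x) \<in> borel_measurable lebesgue"
    and i: "integrable lebesgue (\<lambda>x. (norm (indicat_real \<Omega> x *\<^sub>R g x))\<^sup>2)"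
    using assms by (auto simp only: L2_iff)
  have "(\<lambda>x. (indicat_real \<Omega> x *\<^sub>R g x) \<bullet> b) \<in> borel_measurable lebesgue"
    by (intro borel_measurable_inner m borel_measurable_const)
  then show m': "(\<lambda>x. indicat_real \<Omega> x *\<^sub>R (g x \<bullet> b)) \<in> borel_measurable lebesgue" by simp
  show "integrable lebesgue (\<lambda>x. (norm (indicat_real \<Omega> x *\<^sub>R (g x \<bullet> b)))\<^sup>2)"
  proof (rule Bochner_Integration.integrable_bound)
    show "integrable lebesgue (\<lambda>x. (norm b)\<^sup>2 * (norm (indicat_real \<Omega> x *\<^sub>R g x))\<^sup>2)"
      by (intro integrable_mult_right i)
    show "(\<lambda>x. (norm (indicat_real \<Omega> x *\<^sub>R (g x \<bullet> b)))\<^sup>2) \<in> borel_measurable lebesgue"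
      by (intro borel_measurable_power measurable_compose[OF m' borel_measurable_norm])
    have "(norm (indicat_real \<Omega> x *\<^sub>R (g x \<bullet> b)))\<^sup>2 \<le> (norm b)\<^sup>2 * (norm (indicat_real \<Omega> x *\<^sub>R g x))\<^sup>2" for x
    proof (cases "x \<in> \<Omega>")
      case True
      have "\<bar>g x \<bullet> b\<bar>\<^sup>2 \<le> (norm (g x) * norm b)\<^sup>2"
        by (intro power_mono Cauchy_Schwarz_ineq2) auto
      with True show ?thesis by (simp add: power_mult_distrib mult.commute)
    qed auto
    then show "AE x in lebesgue. norm ((norm (indicat_real \<Omega> x *\<^sub>R (g x \<bullet> b)))\<^sup>2) \<le> norm ((norm b)\<^sup>2 * (norm (indicat_real \<Omega> x *\<^sub>R g x))\<^sup>2)"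
      by (intro AE_I2) simp
  qed
qed

lemma weak_gradient_add_scale:
  assumes \<Omega>: "bounded \<Omega>" "\<Omega> \<in> sets lebesgue"
    and v: "v \<in> L2 \<Omega>" "g \<in> L2 \<Omega>" "has_weak_gradient \<Omega> v g"
    and w: "w \<in> L2 \<Omega>" "k \<in> L2 \<Omega>" "has_weak_gradient \<Omega> w k"
  shows "has_weak_gradient \<Omega> (\<lambda>x. v x + c *\<^sub>R w x) (\<lambda>x. g x + c *\<^sub>R k x)"
  unfolding has_weak_gradient_def
proof (intro ballI)
  fix \<psi> b assume \<psi>: "\<psi> \<in> test_functions \<Omega>" and b: "(b::'a) \<in> Basis"
  have L: "\<psi> \<in> L2 \<Omega>" "(\<lambda>x. frechet_derivative \<psi> (at x) b) \<in> L2 \<Omega>"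
    using test_function_L2[OF \<psi> \<Omega>] test_function_L2[OF test_function_partial[OF \<psi>] \<Omega>] by auto
  have gk: "(\<lambda>x. g x \<bullet> b) \<in> L2 \<Omega>" "(\<lambda>x. k x \<bullet> b) \<in> L2 \<Omega>"
    using v w L2_component by auto
  have "l2v \<Omega> (\<lambda>x. v x + c *\<^sub>R w x) (\<lambda>x. frechet_derivative \<psi> (at x) b) =
        - l2v \<Omega> (\<lambda>x. (g x \<bullet> b) + c *\<^sub>R (k x \<bullet> b)) \<psi>"
    using v(3) w(3) \<psi> b unfolding has_weak_gradient_def
    by (simp only: psd_formD(3)[OF psd_form_l2v v(1) w(1) L(2)] psd_formD(3)[OF psd_form_l2v gk L(1)])
       (simp add: l2v_def)
  then show "(LINT x:\<Omega>|lebesgue. (v x + c *\<^sub>R w x) * frechet_derivative \<psi> (at x) b) =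
       - (LINT x:\<Omega>|lebesgue. (g x + c *\<^sub>R k x) \<bullet> b * \<psi> x)"
    by (simp add: l2v_def inner_add_left)
qed

text \<open>Each component of the difference integrates to zero against all test functions, so the
  fundamental lemma applies; finitely many exceptional sets are then merged.\<close>

lemma weak_gradient_unique:
  assumes \<Omega>: "bounded \<Omega>" "open \<Omega>"
    and v: "g \<in> L2 \<Omega>" "has_weak_gradient \<Omega> v g"
    and w: "k \<in> L2 \<Omega>" "has_weak_gradient \<Omega> v k"
  shows "AE x in lebesgue. x \<in> \<Omega> \<longrightarrow> g x = k x"
proof -
  have sl: "\<Omega> \<in> sets lebesgue" using \<Omega> by auto
  \<comment> \<open>Pairing with the constant 1 shows that square integrable functions on a bounded
    set are integrable.\<close>
  have one: "(\<lambda>x. 1::real) \<in> L2 \<Omega>"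
    by (rule bounded_measurable_L2[OF \<Omega>(1) sl, where C=1]) auto
  have "AE x in lebesgue. x \<in> \<Omega> \<longrightarrow> (g x - k x) \<bullet> b = 0" if b: "b \<in> Basis" for b
  proof (rule fundamental_lemma[OF \<Omega>(2)])
    have gk: "(\<lambda>x. g x \<bullet> b) \<in> L2 \<Omega>" "(\<lambda>x. k x \<bullet> b) \<in> L2 \<Omega>"
      using v w L2_component by auto
    from L2_add_scale[OF this, of "-1"] have d: "(\<lambda>x. (g x - k x) \<bullet> b) \<in> L2 \<Omega>"
      by (simp add: inner_diff_left)
    from L2_inner_integrable[OF this one] show "set_integrable lebesgue \<Omega> (\<lambda>x. (g x - k x) \<bullet> b)" by simp
    fix \<psi> assume \<psi>: "\<psi> \<in> test_functions \<Omega>"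
    have L: "\<psi> \<in> L2 \<Omega>" using test_function_L2[OF \<psi> \<Omega>(1) sl] .
    have "l2v \<Omega> (\<lambda>x. g x \<bullet> b + (-1) *\<^sub>R (k x \<bullet> b)) \<psi> = l2v \<Omega> (\<lambda>x. g x \<bullet> b) \<psi> - l2v \<Omega> (\<lambda>x. k x \<bullet> b) \<psi>"
      by (subst psd_formD(3)[OF psd_form_l2v gk L]) simp
    also have "\<dots> = 0"
      using v(2) w(2) \<psi> b unfolding has_weak_gradient_def l2v_def by fastforce
    finally show "(LINT x:\<Omega>|lebesgue. (g x - k x) \<bullet> b * \<psi> x) = 0"
      by (simp add: l2v_def inner_diff_left)
  qed
  then have "\<forall>b\<in>Basis. AE x in lebesgue. x \<in> \<Omega> \<longrightarrow> (g x - k x) \<bullet> b = 0" ..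
  then have ae: "AE x in lebesgue. \<forall>b\<in>Basis. x \<in> \<Omega> \<longrightarrow> (g x - k x) \<bullet> b = 0"
    unfolding AE_ball_countable[OF countable_finite[OF finite_Basis]] .
  show ?thesis
  proof (rule eventually_mono[OF ae], intro impI)
    fix x assume "\<forall>b\<in>Basis. x \<in> \<Omega> \<longrightarrow> (g x - k x) \<bullet> b = 0" "x \<in> \<Omega>"
    then have "g x \<bullet> b = k x \<bullet> b" if "b \<in> Basis" for b using that by (simp add: inner_diff_left)
    then show "g x = k x" by (rule euclidean_eqI)
  qed
qed

lemma has_weak_gradient_ae:
  assumes "AE x in lebesgue. x \<in> \<Omega> \<longrightarrow> v x = v' x" "AE x in lebesgue. x \<in> \<Omega> \<longrightarrow> g x = g' x"
    and "has_weak_gradient \<Omega> v g"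
  shows "has_weak_gradient \<Omega> v' g'"
proof -
  have "(LINT x:\<Omega>|lebesgue. v x * f x) = (LINT x:\<Omega>|lebesgue. v' x * f x)" for f
    by (rule set_integral_cong_ae(1)) (use assms(1) in eventually_elim, auto)
  moreover have "(LINT x:\<Omega>|lebesgue. (g x \<bullet> b) * f x) = (LINT x:\<Omega>|lebesgue. (g' x \<bullet> b) * f x)" for f b
    by (rule set_integral_cong_ae(1)) (use assms(2) in eventually_elim, auto)
  ultimately show ?thesis using assms(3) unfolding has_weak_gradient_def by simp
qed

lemma H1_D:
  assumes "v \<in> H1 \<Omega>"
  shows "v \<in> L2 \<Omega>" "weak_grad \<Omega> v \<in> L2 \<Omega>" "has_weak_gradient \<Omega> v (weak_grad \<Omega> v)"
proof -
  have ex: "\<exists>g. g \<in> L2 \<Omega> \<and> has_weak_gradient \<Omega> v g" using assms by (auto simp: H1_def)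
  show "v \<in> L2 \<Omega>" using assms by (auto simp: H1_def)
  show "weak_grad \<Omega> v \<in> L2 \<Omega>" "has_weak_gradient \<Omega> v (weak_grad \<Omega> v)"
    using someI_ex[OF ex] unfolding weak_grad_def by auto
qed

lemma H1_I: "v \<in> L2 \<Omega> \<Longrightarrow> g \<in> L2 \<Omega> \<Longrightarrow> has_weak_gradient \<Omega> v g \<Longrightarrow> v \<in> H1 \<Omega>"
  by (auto simp: H1_def)

lemma weak_grad_unique:
  assumes "bounded \<Omega>" "open \<Omega>" "v \<in> H1 \<Omega>" "g \<in> L2 \<Omega>" "has_weak_gradient \<Omega> v g"
  shows "AE x in lebesgue. x \<in> \<Omega> \<longrightarrow> weak_grad \<Omega> v x = g x"
  using weak_gradient_unique[OF assms(1,2) H1_D(2,3)[OF assms(3)] assms(4,5)] .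

section \<open>Linear structure of the Sobolev spaces\<close>

lemma fsubspace_H1:
  assumes "bounded \<Omega>" "open \<Omega>"
  shows "fsubspace (H1 \<Omega>)"
  unfolding fsubspace_def
proof (intro conjI ballI allI)
  have "has_weak_gradient \<Omega> (\<lambda>x. 0) (\<lambda>x. 0)" by (auto simp: has_weak_gradient_def)
  then show "(\<lambda>x. 0) \<in> H1 \<Omega>" by (intro H1_I[OF L2_zero L2_zero])
  fix u w c assume u: "u \<in> H1 \<Omega>" and w: "w \<in> H1 \<Omega>"
  have "\<Omega> \<in> sets lebesgue" using assms by auto
  then show "(\<lambda>x. u x + c *\<^sub>R w x) \<in> H1 \<Omega>"
    using weak_gradient_add_scale[OF assms(1) _ H1_D[OF u] H1_D[OF w], of c]
      L2_add_scale[OF H1_D(1)[OF u] H1_D(1)[OF w]] L2_add_scale[OF H1_D(2)[OF u] H1_D(2)[OF w]]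
    by (meson H1_I)
qed

text \<open>\<open>weak_grad\<close> picks a representative and is linear only up to null sets.
  Uniqueness almost everywhere is enough, because the form is an integral.\<close>

lemma psd_form_dirichlet:
  assumes "bounded \<Omega>" "open \<Omega>"
  shows "psd_form (H1 \<Omega>) (dirichlet_form \<Omega>)"
  unfolding psd_form_def
proof (intro conjI ballI allI)
  show "dirichlet_form \<Omega> u w = dirichlet_form \<Omega> w u" if "u \<in> H1 \<Omega>" "w \<in> H1 \<Omega>" for u w
    unfolding dirichlet_form_eq_l2v using psd_formD(1)[OF psd_form_l2v] H1_D that by blast
  show "0 \<le> dirichlet_form \<Omega> u u" if "u \<in> H1 \<Omega>" for u
    unfolding dirichlet_form_eq_l2v using psd_formD(2)[OF psd_form_l2v] H1_D that by blast
  fix u v w c assume u: "u \<in> H1 \<Omega>" and v: "v \<in> H1 \<Omega>" and w: "w \<in> H1 \<Omega>"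
  have sl: "\<Omega> \<in> sets lebesgue" using assms by auto
  have "AE x in lebesgue. x \<in> \<Omega> \<longrightarrow> weak_grad \<Omega> (\<lambda>x. u x + c *\<^sub>R v x) x = weak_grad \<Omega> u x + c *\<^sub>R weak_grad \<Omega> v x"
    by (rule weak_grad_unique[OF assms fsubspaceD(2)[OF fsubspace_H1[OF assms] u v]
          L2_add_scale[OF H1_D(2)[OF u] H1_D(2)[OF v]]
          weak_gradient_add_scale[OF assms(1) sl H1_D[OF u] H1_D[OF v]]])
  then have "dirichlet_form \<Omega> (\<lambda>x. u x + c *\<^sub>R v x) w = l2v \<Omega> (\<lambda>x. weak_grad \<Omega> u x + c *\<^sub>R weak_grad \<Omega> v x) (weak_grad \<Omega> w)"
    unfolding dirichlet_form_eq_l2v by (rule l2v_cong_ae) simp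
  also have "\<dots> = dirichlet_form \<Omega> u w + c * dirichlet_form \<Omega> v w"
    unfolding dirichlet_form_eq_l2v by (rule psd_formD(3)[OF psd_form_l2v H1_D(2)[OF u] H1_D(2)[OF v] H1_D(2)[OF w]])
  finally show "dirichlet_form \<Omega> (\<lambda>x. u x + c *\<^sub>R v x) w = dirichlet_form \<Omega> u w + c * dirichlet_form \<Omega> v w" .
qed

lemma psd_form_l2_inner: "psd_form (L2 \<Omega>) (l2_inner \<Omega>)"
  unfolding l2_inner_eq_l2v by (rule psd_form_l2v)

lemma H1_subset_L2: "H1 \<Omega> \<subseteq> L2 \<Omega>"
  by (auto simp: H1_def)

lemma psd_form_H1_inner:
  assumes "bounded \<Omega>" "open \<Omega>"
  shows "psd_form (H1 \<Omega>) (\<lambda>u v. l2_inner \<Omega> u v + dirichlet_form \<Omega> u v)"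
  by (intro psd_form_add psd_form_subset[OF psd_form_l2_inner H1_subset_L2] psd_form_dirichlet assms)

lemma test_function_weak_gradient:
  assumes "bounded \<Omega>" "open \<Omega>" "\<psi> \<in> test_functions \<Omega>"
  shows "has_weak_gradient \<Omega> \<psi> (grad \<psi>)" "grad \<psi> \<in> L2 \<Omega>" "\<psi> \<in> H1 \<Omega>"
proof -
  have sl: "\<Omega> \<in> sets lebesgue" using assms by auto
  have sm: "smooth \<psi>" using assms(3) by (rule test_functionsE)
  show w: "has_weak_gradient \<Omega> \<psi> (grad \<psi>)"
    unfolding has_weak_gradient_def
  proof (intro ballI)
    fix \<phi> b assume \<phi>: "\<phi> \<in> test_functions \<Omega>" and b: "(b::'a) \<in> Basis"
    have "(LINT x:\<Omega>|lebesgue. \<psi> x * frechet_derivative \<phi> (at x) b) = (LINT x|lebesgue. \<psi> x * frechet_derivative \<phi> (at x) b)"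
      by (rule test_function_set_integral(2)[OF assms(3)])
    also have "\<dots> = - (LINT x|lebesgue. frechet_derivative \<psi> (at x) b * \<phi> x)"
      by (rule integration_by_parts[OF test_functions_mono[OF _ \<phi>] sm]) simp
    also have "(LINT x|lebesgue. frechet_derivative \<psi> (at x) b * \<phi> x) = (LINT x:\<Omega>|lebesgue. (grad \<psi> x \<bullet> b) * \<phi> x)"
      using test_function_set_integral(1)[OF \<phi>] b by (simp add: grad_inner_Basis)
    finally show "(LINT x:\<Omega>|lebesgue. \<psi> x * frechet_derivative \<phi> (at x) b) = - (LINT x:\<Omega>|lebesgue. (grad \<psi> x \<bullet> b) * \<phi> x)" .
  qed
  have L: "(\<lambda>x. frechet_derivative \<psi> (at x) b) \<in> L2 \<Omega>" for b
    by (rule test_function_L2[OF test_function_partial[OF assms(3)] assms(1) sl])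
  have meas: "grad \<psi> \<in> borel_measurable lebesgue" unfolding grad_def
    by (intro borel_measurable_sum borel_measurable_scaleR borel_measurable_const
        test_function_measurable[OF test_function_partial[OF assms(3)]])
  have "\<exists>C. \<forall>x. \<bar>frechet_derivative \<psi> (at x) b\<bar> \<le> C" for b
    by (rule test_function_bounded[OF test_function_partial[OF assms(3), of b]]) blast
  then obtain C where C: "\<And>b x. \<bar>frechet_derivative \<psi> (at x) b\<bar> \<le> C b" by metis
  have "norm (grad \<psi> x) \<le> (\<Sum>b\<in>Basis. C b)" for x
    unfolding grad_def by (rule sum_norm_le) (use C in auto)
  then show g: "grad \<psi> \<in> L2 \<Omega>"
    by (intro bounded_measurable_L2[OF assms(1) sl meas]) auto
  show "\<psi> \<in> H1 \<Omega>"
    by (rule H1_I[OF test_function_L2[OF assms(3,1) sl] g w])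
qed

lemma fsubspace_H10:
  assumes "bounded \<Omega>" "open \<Omega>"
  shows "fsubspace (H10 \<Omega>)"
  unfolding fsubspace_def
proof (intro conjI ballI allI)
  note H = fsubspace_H1[OF assms] and P = psd_form_H1_inner[OF assms]
  have nz: "H1_norm \<Omega> (\<lambda>x. 0) = 0"
    using psd_form_zero[OF P H fsubspaceD(1)[OF H]] by (simp add: H1_norm_def)
  show "(\<lambda>x. 0) \<in> H10 \<Omega>"
    using fsubspaceD(1)[OF H] nz test_function_zero[of \<Omega>] by (auto simp: H10_def intro!: bexI[of _ "\<lambda>x. 0"])
  fix u w c assume u: "u \<in> H10 \<Omega>" and w: "w \<in> H10 \<Omega>"
  have u1: "u \<in> H1 \<Omega>" and w1: "w \<in> H1 \<Omega>" using u w by (auto simp: H10_def)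
  have "\<exists>\<psi>\<in>test_functions \<Omega>. H1_norm \<Omega> (\<lambda>x. u x + c *\<^sub>R w x - \<psi> x) < \<epsilon>" if "\<epsilon> > 0" for \<epsilon>
  proof -
    \<comment> \<open>Half of \<epsilon> is spent on u and half on c w; the summand 1 keeps the
      denominator positive for c = 0.\<close>
    define \<delta> where "\<delta> = \<epsilon> / (2 * (\<bar>c\<bar> + 1))"
    have \<delta>: "\<delta> > 0" "\<delta> \<le> \<epsilon> / 2" "\<bar>c\<bar> * \<delta> < \<epsilon> / 2"
      using that by (auto simp: \<delta>_def field_simps)
    obtain \<psi> where \<psi>: "\<psi> \<in> test_functions \<Omega>" "H1_norm \<Omega> (\<lambda>x. u x - \<psi> x) < \<delta>"
      using u \<delta>(1) by (auto simp: H10_def)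
    obtain \<phi> where \<phi>: "\<phi> \<in> test_functions \<Omega>" "H1_norm \<Omega> (\<lambda>x. w x - \<phi> x) < \<delta>"
      using w \<delta>(1) by (auto simp: H10_def)
    have a: "(\<lambda>x. u x - \<psi> x) \<in> H1 \<Omega>"
      using fsubspaceD(2)[OF H u1 test_function_weak_gradient(3)[OF assms \<psi>(1)], of "-1"] by simp
    have b: "(\<lambda>x. w x - \<phi> x) \<in> H1 \<Omega>"
      using fsubspaceD(2)[OF H w1 test_function_weak_gradient(3)[OF assms \<phi>(1)], of "-1"] by simp
    have "(\<lambda>x. u x + c *\<^sub>R w x - (\<psi> x + c * \<phi> x)) = (\<lambda>x. (u x - \<psi> x) + c *\<^sub>R (w x - \<phi> x))"
      by (simp add: fun_eq_iff algebra_simps)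
    then have "H1_norm \<Omega> (\<lambda>x. u x + c *\<^sub>R w x - (\<psi> x + c * \<phi> x)) \<le> H1_norm \<Omega> (\<lambda>x. u x - \<psi> x) + \<bar>c\<bar> * H1_norm \<Omega> (\<lambda>x. w x - \<phi> x)"
      using psd_form_triangle[OF P H a b, of c] unfolding H1_norm_def by (simp only:)
    also have "\<dots> \<le> \<delta> + \<bar>c\<bar> * \<delta>"
      using \<psi>(2) \<phi>(2) by (intro add_mono mult_left_mono) auto
    also have "\<dots> < \<epsilon>" using \<delta> by simp
    finally show ?thesis
      by (intro bexI[where x="\<lambda>x. \<psi> x + c * \<phi> x"] test_function_add_cmul[OF \<psi>(1) \<phi>(1)])
  qed
  then show "(\<lambda>x. u x + c *\<^sub>R w x) \<in> H10 \<Omega>"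
    using fsubspaceD(2)[OF H u1 w1] by (auto simp: H10_def)
qed

section \<open>Piecewise affine elements of H10 are Lipschitz\<close>

lemma L2_subset:
  assumes "g \<in> L2 \<Omega>" "\<tau> \<subseteq> \<Omega>" "\<tau> \<in> sets lebesgue"
  shows "g \<in> L2 \<tau>"
  unfolding L2_iff
proof
  have m: "(\<lambda>x. indicat_real \<Omega> x *\<^sub>R g x) \<in> borel_measurable lebesgue"
    and i: "integrable lebesgue (\<lambda>x. (norm (indicat_real \<Omega> x *\<^sub>R g x))\<^sup>2)"
    using assms(1) by (auto simp only: L2_iff)
  have "(\<lambda>x. indicat_real \<tau> x *\<^sub>R (indicat_real \<Omega> x *\<^sub>R g x)) \<in> borel_measurable lebesgue"
    by (intro borel_measurable_scaleR m borel_measurable_indicator assms)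
  moreover have eq: "indicat_real \<tau> x *\<^sub>R (indicat_real \<Omega> x *\<^sub>R g x) = indicat_real \<tau> x *\<^sub>R g x" for x
    using assms(2) by (auto simp: indicator_def)
  ultimately show "(\<lambda>x. indicat_real \<tau> x *\<^sub>R g x) \<in> borel_measurable lebesgue" by (simp only:)
  have "integrable lebesgue (\<lambda>x. indicat_real \<tau> x *\<^sub>R (norm (indicat_real \<Omega> x *\<^sub>R g x))\<^sup>2)"
    by (rule integrable_mult_indicator[OF assms(3) i])
  moreover have "indicat_real \<tau> x *\<^sub>R (norm (indicat_real \<Omega> x *\<^sub>R g x))\<^sup>2 = (norm (indicat_real \<tau> x *\<^sub>R g x))\<^sup>2" for x
    using assms(2) by (auto simp: indicator_def)
  ultimately show "integrable lebesgue (\<lambda>x. (norm (indicat_real \<tau> x *\<^sub>R g x))\<^sup>2)" by simp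
qed

lemma smooth_affine: "smooth (\<lambda>x. p \<bullet> x + c)"
  using smooth_add[OF smooth_inner[of p] smooth_const[of c]] by (simp add: inner_commute)

lemma frechet_affine: "frechet_derivative (\<lambda>x. p \<bullet> x + c) (at x) h = p \<bullet> h"
proof -
  have "((\<lambda>x. p \<bullet> x + c) has_derivative (\<lambda>h. p \<bullet> h)) (at x)"
    by (auto intro!: derivative_eq_intros)
  then show ?thesis using frechet_derivative_at by metis
qed

lemma affine_weak_gradient:
  assumes "\<And>x. x \<in> \<tau> \<Longrightarrow> v x = p \<bullet> x + c"
  shows "has_weak_gradient \<tau> v (\<lambda>x. p)"
  unfolding has_weak_gradient_def
proof (intro ballI)
  fix \<psi> b assume \<psi>: "\<psi> \<in> test_functions \<tau>" and b: "(b::'a) \<in> Basis"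
  have "(LINT x:\<tau>|lebesgue. v x * frechet_derivative \<psi> (at x) b) = (LINT x:\<tau>|lebesgue. (p \<bullet> x + c) * frechet_derivative \<psi> (at x) b)"
    unfolding set_lebesgue_integral_def using assms
    by (intro Bochner_Integration.integral_cong) (auto simp: indicator_def)
  also have "\<dots> = (LINT x|lebesgue. (p \<bullet> x + c) * frechet_derivative \<psi> (at x) b)"
    by (rule test_function_set_integral(1)[OF test_function_partial[OF \<psi>]])
  also have "\<dots> = - (LINT x|lebesgue. frechet_derivative (\<lambda>x. p \<bullet> x + c) (at x) b * \<psi> x)"
    by (rule integration_by_parts[OF test_functions_mono[OF _ \<psi>] smooth_affine]) simp
  also have "\<dots> = - (LINT x:\<tau>|lebesgue. (p \<bullet> b) * \<psi> x)"
    unfolding frechet_affine test_function_set_integral(1)[OF \<psi>] ..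
  finally show "(LINT x:\<tau>|lebesgue. v x * frechet_derivative \<psi> (at x) b) = - (LINT x:\<tau>|lebesgue. (p \<bullet> b) * \<psi> x)" .
qed

lemma has_weak_gradient_subset:
  assumes "has_weak_gradient \<Omega> v g" "\<tau> \<subseteq> \<Omega>"
  shows "has_weak_gradient \<tau> v g"
  unfolding has_weak_gradient_def
proof (intro ballI)
  fix \<psi> b assume \<psi>: "\<psi> \<in> test_functions \<tau>" and b: "(b::'a) \<in> Basis"
  have \<psi>': "\<psi> \<in> test_functions \<Omega>" using test_functions_mono[OF assms(2) \<psi>] .
  have "(LINT x:\<Omega>|lebesgue. v x * frechet_derivative \<psi> (at x) b) = - (LINT x:\<Omega>|lebesgue. (g x \<bullet> b) * \<psi> x)"
    using assms(1) \<psi>' b unfolding has_weak_gradient_def by blast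
  then show "(LINT x:\<tau>|lebesgue. v x * frechet_derivative \<psi> (at x) b) = - (LINT x:\<tau>|lebesgue. (g x \<bullet> b) * \<psi> x)"
    unfolding test_function_set_integral(1)[OF \<psi>] test_function_set_integral(1)[OF \<psi>']
        test_function_set_integral(1)[OF test_function_partial[OF \<psi>]]
        test_function_set_integral(1)[OF test_function_partial[OF \<psi>']] .
qed

text \<open>Weak gradients are local: on \<tau> both the constant p and the restriction of the
  global weak gradient are weak gradients of v.\<close>

lemma weak_grad_affine_piece:
  assumes "bounded \<Omega>" "open \<Omega>" "v \<in> H1 \<Omega>" "\<tau> \<subseteq> \<Omega>" "open \<tau>"
    and "\<And>x. x \<in> \<tau> \<Longrightarrow> v x = p \<bullet> x + c"
  shows "AE x in lebesgue. x \<in> \<tau> \<longrightarrow> weak_grad \<Omega> v x = p"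
proof (rule weak_gradient_unique)
  have b: "bounded \<tau>" using assms bounded_subset by blast
  then show "bounded \<tau>" .
  have s: "\<tau> \<in> sets lebesgue" using assms(5) by auto
  show "weak_grad \<Omega> v \<in> L2 \<tau>" by (rule L2_subset[OF H1_D(2)[OF assms(3)] assms(4) s])
  show "has_weak_gradient \<tau> v (weak_grad \<Omega> v)"
    by (rule has_weak_gradient_subset[OF H1_D(3)[OF assms(3)] assms(4)])
  show "(\<lambda>x. p) \<in> L2 \<tau>" by (rule bounded_measurable_L2[OF b s, where C="norm p"]) auto
  show "has_weak_gradient \<tau> v (\<lambda>x. p)" by (rule affine_weak_gradient[OF assms(6)])
qed (rule assms)

lemma dirichlet_form_eq:
  assumes "bounded \<Omega>" "open \<Omega>" "v \<in> L2 \<Omega>" "g \<in> L2 \<Omega>" "has_weak_gradient \<Omega> v g"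
  shows "dirichlet_form \<Omega> v v = l2v \<Omega> g g"
  unfolding dirichlet_form_eq_l2v
  by (intro l2v_cong_ae weak_grad_unique assms H1_I[OF assms(3-5)])

text \<open>Membership in the closure of the test functions lets one integrate by parts against test
  functions that do not vanish on the boundary.\<close>

lemma H10_integration_by_parts:
  assumes \<Omega>: "bounded \<Omega>" "open \<Omega>" and v: "v \<in> H10 \<Omega>"
    and \<xi>: "\<xi> \<in> test_functions UNIV" and b: "b \<in> Basis"
  shows "(LINT x:\<Omega>|lebesgue. v x * frechet_derivative \<xi> (at x) b) = - (LINT x:\<Omega>|lebesgue. (weak_grad \<Omega> v x \<bullet> b) * \<xi> x)"
proof -
  have sl: "\<Omega> \<in> sets lebesgue" using \<Omega> by auto
  have v1: "v \<in> H1 \<Omega>" using v by (simp add: H10_def)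
  define g where "g = weak_grad \<Omega> v"
  have g: "g \<in> L2 \<Omega>" "has_weak_gradient \<Omega> v g" and vL: "v \<in> L2 \<Omega>" using H1_D[OF v1] by (auto simp: g_def)
  define d where "d = (\<lambda>x. frechet_derivative \<xi> (at x) b)"
  define e where "e = (\<lambda>x. \<xi> x *\<^sub>R b)"
  have d: "d \<in> L2 \<Omega>" unfolding d_def by (rule test_function_L2[OF test_function_partial[OF \<xi>] \<Omega>(1) sl])
  have e: "e \<in> L2 \<Omega>"
  proof -
    obtain C where "\<And>x. \<bar>\<xi> x\<bar> \<le> C" using test_function_bounded[OF \<xi>] by metis
    then show ?thesis unfolding e_def
      by (intro bounded_measurable_L2[OF \<Omega>(1) sl, where C=C] borel_measurable_scaleR test_function_measurable[OF \<xi>])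
         (use b in auto)
  qed
  \<comment> \<open>The defect in the claimed identity. It is zero for a test function in place of
    v, and it depends on v continuously in the H1 norm with constant at most M.\<close>
  define E where "E = l2v \<Omega> v d + l2v \<Omega> g e"
  define M where "M = sqrt (l2v \<Omega> d d) + sqrt (l2v \<Omega> e e)"
  have M: "0 \<le> M" unfolding M_def
    by (intro add_nonneg_nonneg real_sqrt_ge_zero psd_formD(2)[OF psd_form_l2v d] psd_formD(2)[OF psd_form_l2v e])
  have "\<bar>E\<bar> \<le> \<epsilon> * M" if \<epsilon>: "\<epsilon> > 0" for \<epsilon>
  proof -
    obtain \<psi> where \<psi>: "\<psi> \<in> test_functions \<Omega>" "H1_norm \<Omega> (\<lambda>x. v x - \<psi> x) < \<epsilon>"
      using v \<epsilon> by (auto simp: H10_def)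
    note W = test_function_weak_gradient[OF \<Omega> \<psi>(1)]
    have \<psi>L: "\<psi> \<in> L2 \<Omega>" using W(3) H1_D(1) by blast
    define u where "u = (\<lambda>x. v x + (-1) *\<^sub>R \<psi> x)"
    define k where "k = (\<lambda>x. g x + (-1) *\<^sub>R grad \<psi> x)"
    have u: "u \<in> L2 \<Omega>" "k \<in> L2 \<Omega>" unfolding u_def k_def
      by (rule L2_add_scale[OF vL \<psi>L], rule L2_add_scale[OF g(1) W(2)])
    have "has_weak_gradient \<Omega> u k" unfolding u_def k_def
      by (rule weak_gradient_add_scale[OF \<Omega>(1) sl vL g \<psi>L W(2) W(1)])
    from dirichlet_form_eq[OF \<Omega> u this] have D: "dirichlet_form \<Omega> u u = l2v \<Omega> k k" .
    have nn: "0 \<le> l2v \<Omega> u u" "0 \<le> l2v \<Omega> k k" using psd_formD(2)[OF psd_form_l2v] u by auto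
    have "sqrt (l2v \<Omega> u u + l2v \<Omega> k k) < \<epsilon>"
      using \<psi>(2) D unfolding H1_norm_def l2_inner_eq_l2v u_def by simp
    then have less: "sqrt (l2v \<Omega> u u) \<le> \<epsilon>" "sqrt (l2v \<Omega> k k) \<le> \<epsilon>"
      using nn by (smt (verit) real_sqrt_le_mono)+
    have cs: "\<bar>l2v \<Omega> p q\<bar> \<le> sqrt (l2v \<Omega> p p) * sqrt (l2v \<Omega> q q)" if "p \<in> L2 \<Omega>" "q \<in> L2 \<Omega>" for p q :: "'a \<Rightarrow> 'c::euclidean_space"
      using real_sqrt_le_mono[OF psd_form_cauchy[OF psd_form_l2v fsubspace_L2 that]] by (simp add: real_sqrt_mult)
    \<comment> \<open>\<psi> has compact support inside \<Omega>, so the integrals extend to the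
      whole space, where \<xi> and \<psi> may be integrated by parts.\<close>
    have "l2v \<Omega> \<psi> d + l2v \<Omega> (grad \<psi>) e = 0"
    proof -
      have "smooth \<xi>" "smooth \<psi>" using \<xi> \<psi>(1) by (auto elim: test_functionsE)
      have "l2v \<Omega> \<psi> d = (LINT x|lebesgue. \<psi> x * d x)"
        unfolding l2v_def inner_real_def by (rule test_function_set_integral(2)[OF \<psi>(1)])
      also have "\<dots> = - (LINT x|lebesgue. frechet_derivative \<psi> (at x) b * \<xi> x)"
        unfolding d_def by (rule integration_by_parts[OF \<xi> \<open>smooth \<psi>\<close>])
      also have "(LINT x|lebesgue. frechet_derivative \<psi> (at x) b * \<xi> x) = l2v \<Omega> (grad \<psi>) e"
        unfolding l2v_def e_def inner_scaleR_right grad_inner_Basis[OF b]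
        using test_function_set_integral(1)[OF test_function_partial[OF \<psi>(1)], of \<xi> b] by (simp add: mult.commute)
      finally show ?thesis by simp
    qed
    moreover have "l2v \<Omega> u d = l2v \<Omega> v d - l2v \<Omega> \<psi> d" "l2v \<Omega> k e = l2v \<Omega> g e - l2v \<Omega> (grad \<psi>) e"
      unfolding u_def k_def using psd_formD(3)[OF psd_form_l2v vL \<psi>L d, of "-1"] psd_formD(3)[OF psd_form_l2v g(1) W(2) e, of "-1"] by auto
    ultimately have "E = l2v \<Omega> u d + l2v \<Omega> k e" by (simp add: E_def)
    then have "\<bar>E\<bar> \<le> sqrt (l2v \<Omega> u u) * sqrt (l2v \<Omega> d d) + sqrt (l2v \<Omega> k k) * sqrt (l2v \<Omega> e e)"
      using cs[OF u(1) d] cs[OF u(2) e] by linarith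
    also have "\<dots> \<le> \<epsilon> * sqrt (l2v \<Omega> d d) + \<epsilon> * sqrt (l2v \<Omega> e e)"
      using less psd_formD(2)[OF psd_form_l2v d] psd_formD(2)[OF psd_form_l2v e]
      by (intro add_mono mult_right_mono real_sqrt_ge_zero)
    finally show ?thesis by (simp add: M_def algebra_simps)
  qed
  then have "\<bar>E\<bar> \<le> 0"
  proof -
    assume *: "\<And>\<epsilon>. \<epsilon> > 0 \<Longrightarrow> \<bar>E\<bar> \<le> \<epsilon> * M"
    show ?thesis
    proof (rule field_le_epsilon)
      fix \<epsilon> :: real assume \<epsilon>: "\<epsilon> > 0"
      have "\<bar>E\<bar> \<le> \<epsilon> / (M + 1) * M" using \<epsilon> M by (intro *) simp
      also have "\<dots> \<le> \<epsilon>" using \<epsilon> M by (simp add: field_simps)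
      finally show "\<bar>E\<bar> \<le> 0 + \<epsilon>" by simp
    qed
  qed
  then have "E = 0" by simp
  then show ?thesis unfolding E_def l2v_def d_def e_def g_def inner_scaleR_right inner_real_def by (simp add: mult.commute)
qed

section \<open>Mollified averages and Lipschitz bounds\<close>

lemma integrable_mult_test_function:
  fixes w :: "'a::euclidean_space \<Rightarrow> real"
  assumes "integrable lebesgue w" "\<psi> \<in> test_functions UNIV"
  shows "integrable lebesgue (\<lambda>x. w x * \<psi> x)"
proof -
  obtain C where C: "\<And>x. \<bar>\<psi> x\<bar> \<le> C" using test_function_bounded[OF assms(2)] by metis
  have "norm (w x * \<psi> x) \<le> norm (C * w x)" for x
    using mult_left_mono[OF C[of x], of "\<bar>w x\<bar>"] C[of x] by (simp add: abs_mult mult.commute)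
  moreover have "integrable lebesgue (\<lambda>x. C * w x)" using assms(1) by simp
  moreover have "(\<lambda>x. w x * \<psi> x) \<in> borel_measurable lebesgue"
    using assms test_function_measurable by (intro borel_measurable_times) auto
  ultimately show ?thesis using Bochner_Integration.integrable_bound by blast
qed

text \<open>A weighted average with nonnegative weights of total mass 1 stays within \<delta> of c
  if the function does so wherever the weight is nonzero.\<close>

lemma mollify_close:
  fixes w :: "'a::euclidean_space \<Rightarrow> real"
  assumes w: "integrable lebesgue (\<lambda>z. w z * \<eta> (z + a))" and \<eta>: "\<eta> \<in> test_functions UNIV" "\<And>x. \<eta> x \<ge> 0"
    "\<And>x. \<epsilon> \<le> norm x \<Longrightarrow> \<eta> x = 0" "(LINT x|lebesgue. \<eta> x) = 1"
    and close: "\<And>z. norm (z + a) < \<epsilon> \<Longrightarrow> \<bar>w z - c\<bar> \<le> \<delta>"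
  shows "\<bar>(LINT z|lebesgue. w z * \<eta> (z + a)) - c\<bar> \<le> \<delta>"
proof -
  have i\<eta>: "integrable lebesgue (\<lambda>z. \<eta> (z + a))" by (rule test_function_integrable[OF test_function_translate[OF \<eta>(1)]])
  have one: "(LINT z|lebesgue. \<eta> (z + a)) = 1"
    using integral_lebesgue_translate[OF test_function_continuous[OF \<eta>(1)]] \<eta>(4) by simp
  have "(LINT z|lebesgue. w z * \<eta> (z + a)) - c = (LINT z|lebesgue. w z * \<eta> (z + a) - c * \<eta> (z + a))"
    using w i\<eta> one by simp
  also have "\<bar>\<dots>\<bar> \<le> (LINT z|lebesgue. \<bar>w z * \<eta> (z + a) - c * \<eta> (z + a)\<bar>)"
    by (rule integral_abs_bound)
  also have "\<dots> \<le> (LINT z|lebesgue. \<delta> * \<eta> (z + a))"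
  proof (rule integral_mono)
    show "integrable lebesgue (\<lambda>z. \<bar>w z * \<eta> (z + a) - c * \<eta> (z + a)\<bar>)" using w i\<eta> by simp
    show "integrable lebesgue (\<lambda>z. \<delta> * \<eta> (z + a))" using i\<eta> by simp
    fix z
    show "\<bar>w z * \<eta> (z + a) - c * \<eta> (z + a)\<bar> \<le> \<delta> * \<eta> (z + a)"
    proof (cases "norm (z + a) < \<epsilon>")
      case True
      have "\<bar>w z * \<eta> (z + a) - c * \<eta> (z + a)\<bar> = \<bar>w z - c\<bar> * \<eta> (z + a)"
        using \<eta>(2)[of "z + a"] by (simp add: abs_mult left_diff_distrib[symmetric])
      then show ?thesis using mult_right_mono[OF close[OF True] \<eta>(2)[of "z + a"]] by simp
    qed (use \<eta>(3) in auto)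
  qed
  finally show ?thesis using one by simp
qed

text \<open>Mollify and differentiate along the segment from \<open>x\<close> to \<open>y\<close>.\<close>

lemma bounded_weak_gradient_lipschitz:
  fixes w :: "'a::euclidean_space \<Rightarrow> real"
  assumes w: "integrable lebesgue w" and G: "\<And>b. b \<in> Basis \<Longrightarrow> integrable lebesgue (\<lambda>x. G x \<bullet> b)"
    and wg: "\<And>\<xi> b. \<xi> \<in> test_functions UNIV \<Longrightarrow> b \<in> Basis \<Longrightarrow>
      (LINT x|lebesgue. w x * frechet_derivative \<xi> (at x) b) = - (LINT x|lebesgue. (G x \<bullet> b) * \<xi> x)"
    and L: "AE x in lebesgue. norm (G x) \<le> L"
    and x: "isCont w x" and y: "isCont w y"
  shows "\<bar>w y - w x\<bar> \<le> L * norm (y - x)"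
proof (rule field_le_epsilon)
  fix \<delta> :: real assume "\<delta> > 0"
  then have d2: "\<delta> / 2 > 0" by simp
  obtain \<epsilon>x \<epsilon>y where ex: "\<epsilon>x > 0" "\<And>z. dist z x < \<epsilon>x \<Longrightarrow> \<bar>w z - w x\<bar> < \<delta> / 2"
    and ey: "\<epsilon>y > 0" "\<And>z. dist z y < \<epsilon>y \<Longrightarrow> \<bar>w z - w y\<bar> < \<delta> / 2"
    using x y d2 unfolding continuous_at_eps_delta dist_real_def by metis
  define \<epsilon> where "\<epsilon> = min \<epsilon>x \<epsilon>y"
  have "\<epsilon> > 0" using ex ey by (simp add: \<epsilon>_def)
  from ex_mollifier[OF this] obtain \<eta> :: "'a \<Rightarrow> real" where \<eta>: "\<eta> \<in> test_functions UNIV" "\<And>x. \<eta> x \<ge> 0"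
    "\<And>x. \<epsilon> \<le> norm x \<Longrightarrow> \<eta> x = 0" "(LINT x|lebesgue. \<eta> x) = 1" by metis
  define h where "h = y - x"
  define F where "F = (\<lambda>z. \<eta> (z + (- x)))"
  have F: "F \<in> test_functions UNIV" unfolding F_def by (rule test_function_translate[OF \<eta>(1)])
  have sF: "smooth F" using F by (rule test_functionsE)
  have wm: "w \<in> borel_measurable lebesgue" using w by auto
  have wK: "set_integrable lebesgue K w" if "compact K" for K
    unfolding set_integrable_def using that by (intro integrable_mult_indicator[OF _ w]) (auto simp: borel_compact)
  \<comment> \<open>The kernel is centred at x + t h, so \<open>m t\<close> is the mollified w at
    that point; t = 0 and t = 1 are the two ends of the segment.\<close>
  define m where "m = (\<lambda>t. LINT z|lebesgue. w z * F (z + t *\<^sub>R (- h)))"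
  define m' where "m' = (\<lambda>t. LINT z|lebesgue. w z * frechet_derivative F (at (z + t *\<^sub>R (- h))) (- h))"
  have deriv: "(m has_real_derivative m' t) (at t)" for t
    unfolding m_def m'_def by (rule has_derivative_integral_translate[OF wK wm F])
  have bound: "norm (m' t) \<le> L * norm h" for t
  proof -
    define Ft where "Ft = (\<lambda>z. F (z + t *\<^sub>R (- h)))"
    have Ft: "Ft \<in> test_functions UNIV" unfolding Ft_def by (rule test_function_translate[OF F])
    have sFt: "smooth Ft" using Ft by (rule test_functionsE)
    have fd: "frechet_derivative F (at (z + t *\<^sub>R (- h))) = frechet_derivative Ft (at z)" for z
      unfolding Ft_def using smooth_translate(2)[OF sF] by metis
    have nn: "Ft z \<ge> 0" for z by (simp add: Ft_def F_def \<eta>(2))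
    have one: "(LINT z|lebesgue. Ft z) = 1"
      unfolding Ft_def F_def add.assoc
      using integral_lebesgue_translate[OF test_function_continuous[OF \<eta>(1)]] \<eta>(4) by simp
    \<comment> \<open>The weak gradient identity is given for basis directions, so the direction -h
      is expanded. Its sign cancels the one from integration by parts.\<close>
    have "m' t = (LINT z|lebesgue. (\<Sum>b\<in>Basis. ((- h) \<bullet> b) * (w z * frechet_derivative Ft (at z) b)))"
      unfolding m'_def fd by (subst smooth_frechet_expand[OF sFt]) (simp add: sum_distrib_left mult_ac)
    also have "\<dots> = (\<Sum>b\<in>Basis. ((- h) \<bullet> b) * (LINT z|lebesgue. w z * frechet_derivative Ft (at z) b))"
      using integrable_mult_test_function[OF w test_function_partial[OF Ft]]
      by (subst Bochner_Integration.integral_sum) auto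
    also have "\<dots> = (\<Sum>b\<in>Basis. (h \<bullet> b) * (LINT z|lebesgue. (G z \<bullet> b) * Ft z))"
      using wg[OF Ft] by (intro sum.cong) auto
    also have "\<dots> = (LINT z|lebesgue. (\<Sum>b\<in>Basis. (h \<bullet> b) * ((G z \<bullet> b) * Ft z)))"
      using integrable_mult_test_function[OF G Ft]
      by (subst Bochner_Integration.integral_sum) auto
    also have "\<dots> = (LINT z|lebesgue. (G z \<bullet> h) * Ft z)"
      by (intro Bochner_Integration.integral_cong) (auto simp: euclidean_inner[of _ h] sum_distrib_right sum_distrib_left mult_ac)
    finally have m': "m' t = (LINT z|lebesgue. (G z \<bullet> h) * Ft z)" .
    have "norm (m' t) \<le> (LINT z|lebesgue. (L * norm h) * Ft z)"
      unfolding m'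
    proof (rule order_trans[OF Bochner_Integration.integral_norm_bound], rule integral_mono_AE)
      show "integrable lebesgue (\<lambda>z. (L * norm h) * Ft z)" using test_function_integrable[OF Ft] by simp
      have "integrable lebesgue (\<lambda>z. (\<Sum>b\<in>Basis. (h \<bullet> b) * ((G z \<bullet> b) * Ft z)))"
        using integrable_mult_test_function[OF G Ft] by (intro Bochner_Integration.integrable_sum) auto
      moreover have "(\<lambda>z. (\<Sum>b\<in>Basis. (h \<bullet> b) * ((G z \<bullet> b) * Ft z))) = (\<lambda>z. (G z \<bullet> h) * Ft z)"
        by (auto simp: euclidean_inner[of _ h] sum_distrib_right sum_distrib_left mult_ac)
      ultimately show "integrable lebesgue (\<lambda>z. norm ((G z \<bullet> h) * Ft z))"
        using integrable_norm[of lebesgue "\<lambda>z. (G z \<bullet> h) * Ft z"] by (simp only:)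
      show "AE z in lebesgue. norm ((G z \<bullet> h) * Ft z) \<le> (L * norm h) * Ft z"
        using L
      proof eventually_elim
        case (elim z)
        have "\<bar>G z \<bullet> h\<bar> \<le> norm (G z) * norm h" by (rule Cauchy_Schwarz_ineq2)
        also have "\<dots> \<le> L * norm h" using elim by (intro mult_right_mono) auto
        finally show ?case using nn[of z] by (simp add: abs_mult mult_right_mono)
      qed
    qed
    then show ?thesis using one by simp
  qed
  have "norm (m 1 - m 0) \<le> (L * norm h) * norm (1 - 0 :: real)"
    by (rule field_differentiable_bound[where S=UNIV and f'=m']) (use deriv bound in auto)
  then have m01: "\<bar>m 1 - m 0\<bar> \<le> L * norm (y - x)" by (simp add: h_def)
  have iw: "integrable lebesgue (\<lambda>z. w z * \<eta> (z + a))" for a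
    by (rule integrable_mult_test_function[OF w test_function_translate[OF \<eta>(1)]])
  have "\<bar>(LINT z|lebesgue. w z * \<eta> (z + - x)) - w x\<bar> \<le> \<delta> / 2"
    by (rule mollify_close[OF iw \<eta>]) (use ex(2)[THEN less_imp_le] in \<open>auto simp: \<epsilon>_def dist_norm\<close>)
  moreover have "\<bar>(LINT z|lebesgue. w z * \<eta> (z + - y)) - w y\<bar> \<le> \<delta> / 2"
    by (rule mollify_close[OF iw \<eta>]) (use ey(2)[THEN less_imp_le] in \<open>auto simp: \<epsilon>_def dist_norm\<close>)
  moreover have "m 0 = (LINT z|lebesgue. w z * \<eta> (z + - x))" "m 1 = (LINT z|lebesgue. w z * \<eta> (z + - y))"
    by (simp_all add: m_def F_def h_def)
  ultimately show "\<bar>w y - w x\<bar> \<le> L * norm (y - x) + \<delta>" using m01 by linarith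
qed

text \<open>The first bound makes vertex values independent of the element, the second makes them vanish at
  boundary vertices; neither needs traces on faces.\<close>

lemma H10_piecewise_affine_lipschitz:
  fixes v :: "'a::euclidean_space \<Rightarrow> real"
  assumes \<Omega>: "bounded \<Omega>" "open \<Omega>" and v: "v \<in> H10 \<Omega>" and T: "finite T" "\<And>\<tau>. \<tau> \<in> T \<Longrightarrow> open \<tau> \<and> \<tau> \<subseteq> \<Omega>"
    and null: "\<Omega> - \<Union>T \<in> null_sets lebesgue"
    and aff: "\<And>\<tau> x. \<tau> \<in> T \<Longrightarrow> x \<in> \<tau> \<Longrightarrow> v x = p \<tau> \<bullet> x + c \<tau>"
  shows "\<exists>L\<ge>0. (\<forall>x\<in>\<Union>T. \<forall>y\<in>\<Union>T. \<bar>v x - v y\<bar> \<le> L * norm (x - y)) \<and>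
                (\<forall>x\<in>\<Union>T. \<forall>y. y \<notin> closure \<Omega> \<longrightarrow> \<bar>v x\<bar> \<le> L * norm (x - y))"
proof -
  have sl: "\<Omega> \<in> sets lebesgue" using \<Omega> by auto
  have v1: "v \<in> H1 \<Omega>" using v by (simp add: H10_def)
  have one: "(\<lambda>x. 1::real) \<in> L2 \<Omega>"
    by (rule bounded_measurable_L2[OF \<Omega>(1) sl, where C=1]) auto
  \<comment> \<open>A common bound for the finitely many gradients; the sum is meaningful for an
    empty family too.\<close>
  define L where "L = (\<Sum>\<tau>\<in>T. norm (p \<tau>))"
  \<comment> \<open>Extension by zero. Because \<open>H10_integration_by_parts\<close> admits test
    functions that do not vanish on the boundary, G is the weak gradient of w on the whole space,
    with no jump term.\<close>
  define w where "w = (\<lambda>x. indicat_real \<Omega> x * v x)"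
  define G where "G = (\<lambda>x. indicat_real \<Omega> x *\<^sub>R weak_grad \<Omega> v x)"
  have wi: "integrable lebesgue w"
    using L2_inner_integrable[OF H1_D(1)[OF v1] one] unfolding set_integrable_def w_def by simp
  have Gi: "integrable lebesgue (\<lambda>x. G x \<bullet> b)" if "b \<in> Basis" for b
    using L2_inner_integrable[OF L2_component[OF H1_D(2)[OF v1], of b] one]
    unfolding set_integrable_def G_def by simp
  have wg: "(LINT x|lebesgue. w x * frechet_derivative \<xi> (at x) b) = - (LINT x|lebesgue. (G x \<bullet> b) * \<xi> x)"
    if "\<xi> \<in> test_functions UNIV" "b \<in> Basis" for \<xi> b
    using H10_integration_by_parts[OF \<Omega> v that] unfolding set_lebesgue_integral_def w_def G_def by (simp add: mult.assoc)
  have L: "AE x in lebesgue. norm (G x) \<le> L"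
  proof -
    have "AE x in lebesgue. x \<in> \<tau> \<longrightarrow> weak_grad \<Omega> v x = p \<tau>" if "\<tau> \<in> T" for \<tau>
      using weak_grad_affine_piece[OF \<Omega> v1 _ _ aff[OF that]] T(2)[OF that] by blast
    then have "\<forall>\<tau>\<in>T. AE x in lebesgue. x \<in> \<tau> \<longrightarrow> weak_grad \<Omega> v x = p \<tau>" ..
    then have "AE x in lebesgue. \<forall>\<tau>\<in>T. x \<in> \<tau> \<longrightarrow> weak_grad \<Omega> v x = p \<tau>"
      unfolding AE_ball_countable[OF countable_finite[OF T(1)]] .
    then show ?thesis using AE_not_in[OF null]
    proof eventually_elim
      case (elim x)
      show ?case
      proof (cases "x \<in> \<Omega>")
        case True
        then obtain \<tau> where \<tau>: "\<tau> \<in> T" "x \<in> \<tau>" using elim by blast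
        then have "G x = p \<tau>" using elim True by (simp add: G_def)
        also have "norm (p \<tau>) \<le> L" unfolding L_def using \<tau> T(1) by (intro member_le_sum) auto
        finally show ?thesis .
      qed (auto simp: G_def L_def intro!: sum_nonneg)
    qed
  qed
  \<comment> \<open>The Lipschitz bound holds between points of continuity. Those are available
    inside the open pieces and outside the closed domain; on the skeleton the values of v are
    arbitrary.\<close>
  have cont1: "isCont w x" if "x \<in> \<Union>T" for x
  proof -
    obtain \<tau> where \<tau>: "\<tau> \<in> T" "x \<in> \<tau>" using \<open>x \<in> \<Union>T\<close> by blast
    have "continuous_on \<tau> (\<lambda>x. p \<tau> \<bullet> x + c \<tau>)" by (intro continuous_intros)
    then have "continuous_on \<tau> w"
      by (rule continuous_on_eq) (use T(2)[OF \<tau>(1)] aff[OF \<tau>(1)] in \<open>auto simp: w_def indicator_def\<close>)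
    then show ?thesis using T(2)[OF \<tau>(1)] \<tau>(2) continuous_on_eq_continuous_at by blast
  qed
  have cont2: "isCont w y" if "y \<notin> closure \<Omega>" for y
  proof -
    have "continuous_on (- closure \<Omega>) (\<lambda>x. 0::real)" by simp
    then have "continuous_on (- closure \<Omega>) w"
      by (rule continuous_on_eq) (use closure_subset[of \<Omega>] in \<open>auto simp: w_def indicator_def\<close>)
    then show ?thesis using that continuous_on_eq_continuous_at[of "- closure \<Omega>" w] by auto
  qed
  have wv: "w x = v x" if "x \<in> \<Union>T" for x using that T(2) by (auto simp: w_def indicator_def)
  have w0: "w y = 0" if "y \<notin> closure \<Omega>" for y using that closure_subset[of \<Omega>] by (auto simp: w_def indicator_def)
  have lip: "\<bar>w y - w x\<bar> \<le> L * norm (y - x)" if "isCont w x" "isCont w y" for x y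
    by (rule bounded_weak_gradient_lipschitz[OF wi _ _ L that]) (use Gi wg in auto)
  show ?thesis
  proof (intro exI[of _ L] conjI ballI allI impI)
    show "0 \<le> L" by (simp add: L_def sum_nonneg)
    show "\<bar>v x - v y\<bar> \<le> L * norm (x - y)" if "x \<in> \<Union>T" "y \<in> \<Union>T" for x y
      using lip[OF cont1[OF that(2)] cont1[OF that(1)]] wv that by simp
    show "\<bar>v x\<bar> \<le> L * norm (x - y)" if "x \<in> \<Union>T" "y \<notin> closure \<Omega>" for x y
      using lip[OF cont2[OF that(2)] cont1[OF that(1)]] wv[OF that(1)] w0[OF that(2)] by simp
  qed
qed

section \<open>Lipschitz piecewise affine functions belong to H10\<close>

text \<open>Differentiating in x falls on the kernel and produces a convolution with a partial
  derivative of \<eta>, so the induction over the order varies the kernel. A fixed box as domain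
  makes the Leibniz rule applicable.\<close>

lemma Ck_convolution:
  fixes f :: "'a::euclidean_space \<Rightarrow> real"
  assumes f: "continuous_on UNIV f" and \<eta>: "smooth \<eta>"
  shows "Ck k (\<lambda>x. integral (cbox a b) (\<lambda>t. f t * \<eta> (x - t)))"
  using \<eta>
proof (induction k arbitrary: \<eta>)
  have cont: "continuous_on S (\<lambda>(x, t). f t * \<eta> (x - t))" if "smooth \<eta>" for \<eta> S
    unfolding split_beta
    by (intro continuous_intros continuous_on_compose2[OF f] continuous_on_compose2[OF smooth_continuous[OF that, of UNIV]]) auto
  {
    case 0
    show ?case using continuous_on_subset[OF cont[OF 0, of "UNIV \<times> cbox a b"]]
      by (simp, intro integral_continuous_on_param) (auto simp: split_beta)
  next
    case (Suc k)
    \<comment> \<open>The derivative of the integrand in x as a bounded linear map, assembled from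
      partial derivatives so that its joint continuity reduces to that of scalar
      coefficients.\<close>
    define D where "D = (\<lambda>x t. \<Sum>i\<in>Basis. (f t * frechet_derivative \<eta> (at (x - t)) i) *\<^sub>R (blinfun_inner_left i :: 'a \<Rightarrow>\<^sub>L real))"
    have D: "blinfun_apply (D x t) h = f t * frechet_derivative \<eta> (at (x - t)) h" for x t h
    proof -
      have "blinfun_apply (D x t) h = f t * (\<Sum>i\<in>Basis. (h \<bullet> i) * frechet_derivative \<eta> (at (x - t)) i)"
        by (simp add: D_def blinfun.sum_left blinfun.scaleR_left sum_distrib_left mult_ac)
      also have "(\<Sum>i\<in>Basis. (h \<bullet> i) * frechet_derivative \<eta> (at (x - t)) i) = frechet_derivative \<eta> (at (x - t)) h"
        by (rule smooth_frechet_expand[OF Suc.prems, symmetric])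
      finally show ?thesis .
    qed
    have Dcont: "continuous_on S (\<lambda>(x, t). D x t)" for S
    proof -
      have "continuous_on S (\<lambda>z. f (snd z) * frechet_derivative \<eta> (at (fst z - snd z)) i)" if "i \<in> Basis" for i
        using cont[OF smooth_partial[OF Suc.prems that]] by (simp add: split_beta)
      then show ?thesis unfolding split_beta D_def
        by (intro continuous_on_sum continuous_on_scaleR continuous_on_const)
    qed
    have "((\<lambda>x. integral (cbox a b) (\<lambda>t. f t * \<eta> (x - t))) has_derivative blinfun_apply (integral (cbox a b) (D x))) (at x within UNIV)" for x
    proof (rule leibniz_rule)
      fix x t
      have "((\<lambda>x. \<eta> (x - t)) has_derivative frechet_derivative \<eta> (at (x - t))) (at x)"
        using has_derivative_translate[OF smooth_has_derivative[OF Suc.prems, of "x + (- t)"]] by simp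
      then have "((\<lambda>x. f t * \<eta> (x - t)) has_derivative (\<lambda>h. f t * frechet_derivative \<eta> (at (x - t)) h)) (at x)"
        by (rule has_derivative_mult_right)
      moreover have "blinfun_apply (D x t) = (\<lambda>h. f t * frechet_derivative \<eta> (at (x - t)) h)"
        using D by blast
      ultimately show "((\<lambda>x. f t * \<eta> (x - t)) has_derivative blinfun_apply (D x t)) (at x within UNIV)" by simp
      have "continuous_on (cbox a b) (\<lambda>t. f t * \<eta> (x - t))"
        by (intro continuous_intros continuous_on_subset[OF f] continuous_on_compose2[OF smooth_continuous[OF Suc.prems, of UNIV]]) auto
      then show "(\<lambda>t. f t * \<eta> (x - t)) integrable_on cbox a b" by (rule integrable_continuous)
    qed (use Dcont in auto)
    then have der: "((\<lambda>x. integral (cbox a b) (\<lambda>t. f t * \<eta> (x - t))) has_derivative blinfun_apply (integral (cbox a b) (D x))) (at x)" for x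
      by simp
    have "D x integrable_on cbox a b" for x
    proof -
      have "continuous_on (cbox a b) (\<lambda>t. D x t)"
        using continuous_on_compose2[OF Dcont[of UNIV], of "cbox a b" "\<lambda>t. (x, t)", OF continuous_on_Pair[OF continuous_on_const continuous_on_id]]
        by simp
      then show ?thesis by (rule integrable_continuous)
    qed
    then have "blinfun_apply (integral (cbox a b) (D x)) i = integral (cbox a b) (\<lambda>t. f t * frechet_derivative \<eta> (at (x - t)) i)" for x i
      by (simp add: blinfun_apply_integral D)
    then show ?case
      by (intro Ck_SucI[OF der]) (simp add: Suc.IH[OF smooth_partial[OF Suc.prems]])
  }
qed

text \<open>After the shift t = x + z and by evenness of \<eta>, the variable x occurs only in the
  kernel, and the compact support of f confines t to a box that does not depend on x.\<close>

lemma mollification: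
  fixes f :: "'a::euclidean_space \<Rightarrow> real"
  assumes f: "continuous_on UNIV f" and K: "compact K" "\<And>x. x \<notin> K \<Longrightarrow> f x = 0"
    and \<eta>: "\<eta> \<in> test_functions UNIV" "\<And>x. \<eta> (- x) = \<eta> x"
  shows "smooth (\<lambda>x. LINT z|lebesgue. f (x + z) * \<eta> z)"
proof -
  obtain a b where ab: "K \<subseteq> cbox a b"
    using K(1) bounded_subset_cbox_symmetric compact_imp_bounded by metis
  have sm: "smooth \<eta>" using \<eta>(1) by (rule test_functionsE)
  have "(LINT z|lebesgue. f (x + z) * \<eta> z) = integral (cbox a b) (\<lambda>t. f t * \<eta> (x - t))" for x
  proof -
    have c: "continuous_on UNIV (\<lambda>t. f t * \<eta> (x - t))"
      by (intro continuous_intros f continuous_on_compose2[OF smooth_continuous[OF sm, of UNIV]]) auto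
    have "(LINT z|lebesgue. f (x + z) * \<eta> z) = (LINT z|lebesgue. (\<lambda>t. f t * \<eta> (x - t)) (z + x))"
      by (intro Bochner_Integration.integral_cong) (auto simp: \<eta>(2) add.commute)
    also have "\<dots> = (LINT t|lebesgue. f t * \<eta> (x - t))" by (rule integral_lebesgue_translate[OF c])
    also have "\<dots> = integral UNIV (\<lambda>t. f t * \<eta> (x - t))"
      using K(2) by (intro integral_lebesgue[symmetric] integrable_lebesgue_compact_support[OF c K(1)]) auto
    also have "\<dots> = integral UNIV (\<lambda>t. if t \<in> cbox a b then f t * \<eta> (x - t) else 0)"
      by (intro Henstock_Kurzweil_Integration.integral_cong) (use K(2) ab in auto)
    also have "\<dots> = integral (cbox a b) (\<lambda>t. f t * \<eta> (x - t))"
      by (rule integral_restrict_UNIV)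
    finally show ?thesis .
  qed
  then show ?thesis using Ck_convolution[OF f sm, of _ a b] by (simp add: smooth_def)
qed

text \<open>Dilate towards an interior point to push the support into \<open>\<Omega>\<close>, then mollify.\<close>

lemma lipschitz_test_function_approximation:
  fixes f :: "'a::euclidean_space \<Rightarrow> real"
  assumes \<Omega>: "bounded \<Omega>" "open \<Omega>" "convex \<Omega>"
    and lip: "\<And>x y. \<bar>f x - f y\<bar> \<le> L * norm (x - y)" and f0: "\<And>x. x \<notin> \<Omega> \<Longrightarrow> f x = 0"
  obtains \<psi> :: "nat \<Rightarrow> 'a \<Rightarrow> real" where "\<And>n. \<psi> n \<in> test_functions \<Omega>"
    "\<And>x. (\<lambda>n. \<psi> n x) \<longlonglongrightarrow> f x"
    "\<And>n x y. \<bar>\<psi> n x - \<psi> n y\<bar> \<le> 2 * L * norm (x - y)"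
    "\<And>x p c \<delta> h. \<delta> > 0 \<Longrightarrow> (\<And>y. y \<in> ball x \<delta> \<Longrightarrow> f y = p \<bullet> y + c) \<Longrightarrow>
        (\<lambda>n. frechet_derivative (\<psi> n) (at x) h) \<longlonglongrightarrow> p \<bullet> h"
proof -
  have L0: "L \<ge> 0"
  proof -
    obtain b :: 'a where "b \<in> Basis" using nonempty_Basis by blast
    then show ?thesis using lip[of b 0] by simp
  qed
  have fc: "continuous_on UNIV f"
  proof -
    have "L-lipschitz_on UNIV f" using lip L0 by (intro lipschitz_onI) (auto simp: dist_norm)
    then show ?thesis by (rule lipschitz_on_continuous_on)
  qed
  show ?thesis
  proof (cases "\<Omega> = {}")
    \<comment> \<open>Here there is no point to dilate towards; f is zero and is its own
      approximation. A zero function that is affine on a ball has p = 0.\<close>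
    case True
    then have fz: "f x = 0" for x using f0 by simp
    show ?thesis
    proof (rule that[of "\<lambda>n x. 0"])
      fix x p :: 'a and c \<delta> :: real and h assume d: "\<delta> > 0" and a: "\<And>y. y \<in> ball x \<delta> \<Longrightarrow> f y = p \<bullet> y + c"
      have p0: "p = 0"
      proof (rule ccontr)
        assume "p \<noteq> 0"
        define y where "y = x + (\<delta> / (2 * norm p)) *\<^sub>R p"
        have "y \<in> ball x \<delta>" using d \<open>p \<noteq> 0\<close> by (simp add: y_def dist_norm)
        then have "p \<bullet> y = p \<bullet> x" using a[of y] a[of x] d fz by simp
        then have "(\<delta> / (2 * norm p)) * (p \<bullet> p) = 0" by (simp add: y_def inner_add_right)
        then show False using d \<open>p \<noteq> 0\<close> by simp
      qed
      show "(\<lambda>n. frechet_derivative (\<lambda>x. 0) (at x) h) \<longlonglongrightarrow> p \<bullet> h"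
        using p0 by (simp add: frechet_derivative_const)
    qed (use fz L0 test_function_zero in auto)
  next
    case False
    then obtain x0 where x0: "x0 \<in> \<Omega>" by blast
    \<comment> \<open>Dilation factors above 1 that tend to 1, so x \<mapsto> f (S n x) is supported
      in a copy of the closed domain shrunk towards x0. The bound t n \<le> 2 is the source of the
      factor 2 in the Lipschitz constant.\<close>
    define t where "t = (\<lambda>n::nat. 1 + 1 / (real n + 1))"
    have t: "1 < t n" "t n \<le> 2" for n by (auto simp: t_def field_simps)
    have tl: "(\<lambda>n. t n) \<longlonglongrightarrow> 1"
      unfolding t_def using tendsto_add[OF tendsto_const[of 1] LIMSEQ_inverse_real_of_nat] by (simp add: inverse_eq_divide add.commute)
    define S where "S = (\<lambda>n x. x0 + t n *\<^sub>R (x - x0))"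
    define K where "K = (\<lambda>n. (\<lambda>z. x0 + (1 / t n) *\<^sub>R (z - x0)) ` closure \<Omega>)"
    have K: "compact (K n)" for n unfolding K_def
      by (intro compact_continuous_image continuous_intros) (use \<Omega> in auto)
    have K\<Omega>: "K n \<subseteq> \<Omega>" for n
    proof
      fix x assume "x \<in> K n"
      then obtain z where z: "z \<in> closure \<Omega>" "x = x0 + (1 / t n) *\<^sub>R (z - x0)" by (auto simp: K_def)
      have "z - (1 - 1 / t n) *\<^sub>R (z - x0) \<in> interior \<Omega>"
        using x0 \<Omega>(2) z(1) t[of n] by (intro mem_interior_closure_convex_shrink[OF \<Omega>(3)]) (auto simp: interior_open)
      moreover have "z - (1 - 1 / t n) *\<^sub>R (z - x0) = x" by (simp add: z(2) algebra_simps)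
      ultimately show "x \<in> \<Omega>" using interior_subset by auto
    qed
    have fK: "f (S n x) = 0" if "x \<notin> K n" for n x
    proof (rule f0, rule notI)
      assume "S n x \<in> \<Omega>"
      then have "x \<in> K n" unfolding K_def
        using closure_subset[of \<Omega>] t[of n] by (intro image_eqI[of _ _ "S n x"]) (auto simp: S_def)
      with that show False by simp
    qed
    \<comment> \<open>The mollification radius must be small enough to keep the support inside
      \<Omega>, and it must tend to zero.\<close>
    have "\<exists>e>0. (\<Union>x\<in>K n. cball x e) \<subseteq> \<Omega> \<and> e \<le> 1 / (real n + 1)" for n
    proof -
      obtain e where "e > 0" "(\<Union>x\<in>K n. cball x e) \<subseteq> \<Omega>"
        using compact_subset_open_imp_cball_epsilon_subset[OF K \<Omega>(2) K\<Omega>] by metis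
      moreover have "(\<Union>x\<in>K n. cball x (min e (1 / (real n + 1)))) \<subseteq> (\<Union>x\<in>K n. cball x e)"
        by (intro UN_mono) auto
      ultimately show ?thesis by (intro exI[of _ "min e (1 / (real n + 1))"]) auto
    qed
    then obtain e where e: "\<And>n. e n > 0" "\<And>n. (\<Union>x\<in>K n. cball x (e n)) \<subseteq> \<Omega>" "\<And>n. e n \<le> 1 / (real n + 1)" by metis
    have el: "e \<longlonglongrightarrow> 0"
    proof (rule tendsto_sandwich[OF _ _ tendsto_const])
      show "(\<lambda>n. 1 / (real n + 1)) \<longlonglongrightarrow> 0"
        using LIMSEQ_inverse_real_of_nat by (simp add: inverse_eq_divide add.commute)
    qed (auto intro!: always_eventually less_imp_le e(1) e(3))
    have "\<exists>\<eta>\<in>test_functions UNIV. (\<forall>x. \<eta> x \<ge> 0) \<and> (\<forall>x. e n \<le> norm x \<longrightarrow> \<eta> x = 0) \<and> (LINT x|lebesgue. \<eta> x) = 1 \<and> (\<forall>x. \<eta> (- x :: 'a) = \<eta> x)" for n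
      by (rule ex_mollifier[OF e(1)[of n]]) blast
    then obtain \<eta> :: "nat \<Rightarrow> 'a \<Rightarrow> real" where \<eta>: "\<And>n. \<eta> n \<in> test_functions UNIV" "\<And>n x. \<eta> n x \<ge> 0" "\<And>n x. e n \<le> norm x \<Longrightarrow> \<eta> n x = 0"
      "\<And>n. (LINT x|lebesgue. \<eta> n x) = 1" "\<And>n x. \<eta> n (- x) = \<eta> n x" by metis
    define \<psi> where "\<psi> = (\<lambda>n x. LINT z|lebesgue. f (S n (x + z)) * \<eta> n z)"
    have fSc: "continuous_on UNIV (\<lambda>x. f (S n x))" for n
      unfolding S_def by (intro continuous_on_compose2[OF fc] continuous_intros) auto
    have sm: "smooth (\<psi> n)" for n
      unfolding \<psi>_def by (rule mollification[OF fSc K fK \<eta>(1,5)])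
    have test: "\<psi> n \<in> test_functions \<Omega>" for n
    proof (rule test_functionsI[OF sm])
      show "compact {x + y | x y. x \<in> K n \<and> y \<in> cball 0 (e n)}"
        by (intro compact_sums K compact_cball)
      show "{x + y | x y. x \<in> K n \<and> y \<in> cball 0 (e n)} \<subseteq> \<Omega>"
        using e(2)[of n] by (force simp: dist_norm)
      fix x assume nz: "\<psi> n x \<noteq> 0"
      show "x \<in> {x + y | x y. x \<in> K n \<and> y \<in> cball 0 (e n)}"
      proof (rule ccontr)
        assume out: "x \<notin> {x + y | x y. x \<in> K n \<and> y \<in> cball 0 (e n)}"
        have zero: "f (S n (x + z)) * \<eta> n z = 0" for z
        proof (cases "e n \<le> norm z")
          case False
          have "x + z \<notin> K n"
          proof
            assume "x + z \<in> K n"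
            moreover have "x = (x + z) + (- z)" "- z \<in> cball 0 (e n)" using False by auto
            ultimately show False using out by blast
          qed
          then show ?thesis using fK by simp
        qed (use \<eta>(3) in simp)
        have "\<psi> n x = 0" unfolding \<psi>_def zero by simp
        with nz show False by simp
      qed
    qed
    have int: "integrable lebesgue (\<lambda>z. f (S n (x + z)) * \<eta> n z)" for n x
    proof (rule integrable_lebesgue_compact_support[where K="cball 0 (e n)"])
      show "continuous_on UNIV (\<lambda>z. f (S n (x + z)) * \<eta> n z)"
        by (intro continuous_intros continuous_on_compose2[OF fSc] test_function_continuous[OF \<eta>(1)]) auto
    qed (use \<eta>(3) in auto)
    have i\<eta>: "integrable lebesgue (\<eta> n)" for n by (rule test_function_integrable[OF \<eta>(1)])
    have avg: "\<bar>(LINT z|lebesgue. F z * \<eta> n z)\<bar> \<le> B"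
      if "integrable lebesgue (\<lambda>z. F z * \<eta> n z)" "\<And>z. norm z < e n \<Longrightarrow> \<bar>F z\<bar> \<le> B" for F B n
    proof -
      have "\<bar>(LINT z|lebesgue. F z * \<eta> n z)\<bar> \<le> (LINT z|lebesgue. \<bar>F z * \<eta> n z\<bar>)" by (rule integral_abs_bound)
      also have "\<dots> \<le> (LINT z|lebesgue. B * \<eta> n z)"
      proof (rule integral_mono)
        fix z show "\<bar>F z * \<eta> n z\<bar> \<le> B * \<eta> n z"
          using that(2)[of z] \<eta>(2)[of n z] \<eta>(3)[of n z]
          by (cases "norm z < e n") (auto simp: abs_mult mult_right_mono)
      qed (use that(1) i\<eta> in auto)
      finally show ?thesis using \<eta>(4) by simp
    qed
    show ?thesis
    proof (rule that[of \<psi>])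
      show "\<psi> n \<in> test_functions \<Omega>" for n by (rule test)
      show "\<bar>\<psi> n x - \<psi> n y\<bar> \<le> 2 * L * norm (x - y)" for n x y
      proof -
        have "\<psi> n x - \<psi> n y = (LINT z|lebesgue. (f (S n (x + z)) - f (S n (y + z))) * \<eta> n z)"
          unfolding \<psi>_def using int by (simp add: left_diff_distrib)
        also have "\<bar>\<dots>\<bar> \<le> 2 * L * norm (x - y)"
        proof (rule avg)
          show "integrable lebesgue (\<lambda>z. (f (S n (x + z)) - f (S n (y + z))) * \<eta> n z)"
            using int[of n x] int[of n y] by (simp add: left_diff_distrib)
          fix z
          have "S n (x + z) - S n (y + z) = t n *\<^sub>R (x - y)" by (simp add: S_def algebra_simps)
          then have "\<bar>f (S n (x + z)) - f (S n (y + z))\<bar> \<le> L * (t n * norm (x - y))"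
            using lip[of "S n (x + z)" "S n (y + z)"] t[of n] by simp
          also have "\<dots> \<le> L * (2 * norm (x - y))"
            using t[of n] L0 by (intro mult_left_mono mult_right_mono) auto
          finally show "\<bar>f (S n (x + z)) - f (S n (y + z))\<bar> \<le> 2 * L * norm (x - y)" by simp
        qed
        finally show ?thesis .
      qed
      show "(\<lambda>n. \<psi> n x) \<longlonglongrightarrow> f x" for x
      proof -
        have b: "\<bar>\<psi> n x - f x\<bar> \<le> L * ((t n - 1) * norm (x - x0) + 2 * e n)" for n
        proof -
          have "\<psi> n x - f x = (LINT z|lebesgue. (f (S n (x + z)) - f x) * \<eta> n z)"
            unfolding \<psi>_def using int i\<eta> \<eta>(4) by (simp add: left_diff_distrib)
          also have "\<bar>\<dots>\<bar> \<le> L * ((t n - 1) * norm (x - x0) + 2 * e n)"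
          proof (rule avg)
            show "integrable lebesgue (\<lambda>z. (f (S n (x + z)) - f x) * \<eta> n z)"
              using int[of n x] i\<eta>[of n] by (simp add: left_diff_distrib)
            fix z :: 'a assume z: "norm z < e n"
            have "S n (x + z) - x = (t n - 1) *\<^sub>R (x - x0) + t n *\<^sub>R z" by (simp add: S_def algebra_simps)
            also have "norm \<dots> \<le> (t n - 1) * norm (x - x0) + t n * norm z"
              using t[of n] by (intro order_trans[OF norm_triangle_ineq]) simp
            also have "\<dots> \<le> (t n - 1) * norm (x - x0) + 2 * e n"
              using t[of n] z by (intro add_left_mono mult_mono) auto
            finally show "\<bar>f (S n (x + z)) - f x\<bar> \<le> L * ((t n - 1) * norm (x - x0) + 2 * e n)"
              using lip[of "S n (x + z)" x] mult_left_mono[OF _ L0] by (meson order_trans)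
          qed
          finally show ?thesis .
        qed
        have "(\<lambda>n. L * ((t n - 1) * norm (x - x0) + 2 * e n)) \<longlonglongrightarrow> L * ((1 - 1) * norm (x - x0) + 2 * 0)"
          by (intro tendsto_intros tl el)
        then have "(\<lambda>n. L * ((t n - 1) * norm (x - x0) + 2 * e n)) \<longlonglongrightarrow> 0" by simp
        then have "(\<lambda>n. \<psi> n x - f x) \<longlonglongrightarrow> 0"
          by (rule Lim_null_comparison[rotated]) (use b in \<open>auto intro: always_eventually\<close>)
        then show ?thesis by (simp add: LIM_zero_iff)
      qed
      fix x p :: 'a and c \<delta> :: real and h assume d: "\<delta> > 0" and a: "\<And>y. y \<in> ball x \<delta> \<Longrightarrow> f y = p \<bullet> y + c"
      have "(\<lambda>n. (t n - 1) * norm (x - x0) + 2 * e n) \<longlonglongrightarrow> (1 - 1) * norm (x - x0) + 2 * 0"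
        by (intro tendsto_intros tl el)
      then have "(\<lambda>n. (t n - 1) * norm (x - x0) + 2 * e n) \<longlonglongrightarrow> 0" by simp
      then have "\<forall>\<^sub>F n in sequentially. (t n - 1) * norm (x - x0) + 2 * e n < \<delta> / 2"
        using d by (intro order_tendstoD(2)) auto
      then have ev: "\<forall>\<^sub>F n in sequentially. t n * (p \<bullet> h) = frechet_derivative (\<psi> n) (at x) h"
      proof eventually_elim
        case (elim n)
        define C where "C = (LINT z|lebesgue. (p \<bullet> (x0 + t n *\<^sub>R (z - x0)) + c) * \<eta> n z)"
        \<comment> \<open>Eventually all values averaged into \<open>\<psi> n y\<close> come from
          the ball on which f is affine, so \<psi> n is itself affine near x with gradient t n p.
          The radius \<delta>/4 doubles under dilation to \<delta>/2; the other half of \<delta>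
          absorbs the shift caused by dilation and mollification.\<close>
        have loc: "(t n *\<^sub>R p) \<bullet> y + C = \<psi> n y" if y: "y \<in> ball x (\<delta> / 4)" for y
        proof -
          have "\<psi> n y = (LINT z|lebesgue. (t n * (p \<bullet> y) + (p \<bullet> (x0 + t n *\<^sub>R (z - x0)) + c)) * \<eta> n z)"
            unfolding \<psi>_def
          proof (intro Bochner_Integration.integral_cong refl)
            fix z
            show "f (S n (y + z)) * \<eta> n z = (t n * (p \<bullet> y) + (p \<bullet> (x0 + t n *\<^sub>R (z - x0)) + c)) * \<eta> n z"
            proof (cases "e n \<le> norm z")
              case False
              have "S n (y + z) - x = (t n - 1) *\<^sub>R (x - x0) + t n *\<^sub>R z + t n *\<^sub>R (y - x)" by (simp add: S_def algebra_simps)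
              also have "norm \<dots> \<le> (t n - 1) * norm (x - x0) + t n * norm z + t n * norm (y - x)"
                using t[of n] norm_triangle_ineq[of "(t n - 1) *\<^sub>R (x - x0) + t n *\<^sub>R z" "t n *\<^sub>R (y - x)"]
                  norm_triangle_ineq[of "(t n - 1) *\<^sub>R (x - x0)" "t n *\<^sub>R z"] by simp
              also have "\<dots> \<le> (t n - 1) * norm (x - x0) + 2 * e n + 2 * norm (y - x)"
                using t[of n] False by (intro add_mono add_left_mono mult_mono) auto
              also have "\<dots> < \<delta>" using elim y by (simp add: dist_norm norm_minus_commute)
              finally have "S n (y + z) \<in> ball x \<delta>" by (simp add: dist_norm norm_minus_commute)
              then have "f (S n (y + z)) = p \<bullet> S n (y + z) + c" by (rule a)
              also have "\<dots> = t n * (p \<bullet> y) + (p \<bullet> (x0 + t n *\<^sub>R (z - x0)) + c)"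
                by (simp add: S_def inner_add_right inner_diff_right algebra_simps)
              finally show ?thesis by simp
            qed (use \<eta>(3) in simp)
          qed
          also have "\<dots> = (LINT z|lebesgue. t n * (p \<bullet> y) * \<eta> n z + (p \<bullet> (x0 + t n *\<^sub>R (z - x0)) + c) * \<eta> n z)"
            by (intro Bochner_Integration.integral_cong refl) (simp add: distrib_right)
          also have "\<dots> = t n * (p \<bullet> y) + C"
          proof -
            have "integrable lebesgue (\<lambda>z. (p \<bullet> (x0 + t n *\<^sub>R (z - x0)) + c) * \<eta> n z)"
            proof (rule integrable_lebesgue_compact_support[where K="cball 0 (e n)"])
              show "continuous_on UNIV (\<lambda>z. (p \<bullet> (x0 + t n *\<^sub>R (z - x0)) + c) * \<eta> n z)"
                by (intro continuous_intros test_function_continuous[OF \<eta>(1)])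
            qed (use \<eta>(3) in auto)
            then show ?thesis unfolding C_def using i\<eta>[of n] \<eta>(4)[of n] by simp
          qed
          finally show ?thesis by simp
        qed
        have "((\<lambda>y. (t n *\<^sub>R p) \<bullet> y + C) has_derivative (\<lambda>h. (t n *\<^sub>R p) \<bullet> h)) (at x)"
          by (auto intro!: derivative_eq_intros)
        then have "(\<psi> n has_derivative (\<lambda>h. (t n *\<^sub>R p) \<bullet> h)) (at x)"
          by (rule has_derivative_transform_within_open[where s="ball x (\<delta> / 4)"]) (use d loc in auto)
        from frechet_derivative_at[OF this] have "(\<lambda>h. (t n *\<^sub>R p) \<bullet> h) = frechet_derivative (\<psi> n) (at x)" .
        from fun_cong[OF this, of h] show ?case by simp
      qed
      have "(\<lambda>n. t n * (p \<bullet> h)) \<longlonglongrightarrow> 1 * (p \<bullet> h)" by (intro tendsto_intros tl)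
      then show "(\<lambda>n. frechet_derivative (\<psi> n) (at x) h) \<longlonglongrightarrow> p \<bullet> h"
        using Lim_transform_eventually[OF _ ev] by simp
    qed
  qed
qed

section \<open>Convergence of the approximants in the Sobolev norm\<close>

lemma bounded_convergence_set:
  fixes F :: "nat \<Rightarrow> 'a::euclidean_space \<Rightarrow> real"
  assumes \<Omega>: "bounded \<Omega>" "\<Omega> \<in> sets lebesgue"
    and m: "\<And>n. F n \<in> borel_measurable lebesgue" "f \<in> borel_measurable lebesgue"
    and b: "\<And>n x. x \<in> \<Omega> \<Longrightarrow> \<bar>F n x\<bar> \<le> B"
    and l: "AE x in lebesgue. x \<in> \<Omega> \<longrightarrow> (\<lambda>n. F n x) \<longlonglongrightarrow> f x"
  shows "(\<lambda>n. LINT x:\<Omega>|lebesgue. F n x) \<longlonglongrightarrow> (LINT x:\<Omega>|lebesgue. f x)"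
  unfolding set_lebesgue_integral_def
proof (rule integral_dominated_convergence[where w="\<lambda>x. B * indicat_real \<Omega> x"])
  have "\<Omega> \<in> lmeasurable" using \<Omega> bounded_set_imp_lmeasurable by blast
  then show "integrable lebesgue (\<lambda>x. B * indicat_real \<Omega> x)"
    by (intro integrable_mult_right integrable_real_indicator) (auto simp: fmeasurable_def)
  show "AE x in lebesgue. (\<lambda>n. indicat_real \<Omega> x *\<^sub>R F n x) \<longlonglongrightarrow> indicat_real \<Omega> x *\<^sub>R f x"
    using l by eventually_elim (auto simp: indicator_def)
  show "AE x in lebesgue. norm (indicat_real \<Omega> x *\<^sub>R F n x) \<le> B * indicat_real \<Omega> x" for n
    using b by (intro AE_I2) (auto simp: indicator_def)
qed (intro borel_measurable_scaleR borel_measurable_indicator m \<Omega>)+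

text \<open>Difference quotients bound every directional derivative by L times the length of the
  direction; the direction of the gradient itself gives the claim.\<close>

lemma lipschitz_grad_bound:
  assumes sm: "smooth \<psi>" and lip: "\<And>x y. \<bar>\<psi> x - \<psi> y\<bar> \<le> L * norm (x - y)"
  shows "norm (grad \<psi> x) \<le> L"
proof -
  have b: "\<bar>frechet_derivative \<psi> (at x) h\<bar> \<le> L * norm h" for h
  proof -
    have "((\<lambda>s. (\<psi> (x + s *\<^sub>R h) - \<psi> x) / s) \<longlongrightarrow> frechet_derivative \<psi> (at x) h) (at 0)"
      using smooth_line_deriv[OF sm, of x h 0] by (simp add: DERIV_def)
    moreover have "\<forall>\<^sub>F s in at 0. norm ((\<psi> (x + s *\<^sub>R h) - \<psi> x) / s) \<le> L * norm h"
    proof -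
      have "norm ((\<psi> (x + s *\<^sub>R h) - \<psi> x) / s) \<le> L * norm h" if "s \<noteq> 0" for s
        using lip[of "x + s *\<^sub>R h" x] that by (simp add: divide_le_eq mult_ac)
      then show ?thesis by (simp add: eventually_at_filter)
    qed
    ultimately have "norm (frechet_derivative \<psi> (at x) h) \<le> L * norm h"
      by (intro Lim_norm_ubound) auto
    then show ?thesis by simp
  qed
  show ?thesis
  proof (cases "grad \<psi> x = 0")
    case True
    obtain i :: 'a where "i \<in> Basis" using nonempty_Basis by blast
    then have "0 \<le> L" using lip[of i 0] by simp
    then show ?thesis using True by simp
  next
    case False
    have "norm (grad \<psi> x) * norm (grad \<psi> x) = grad \<psi> x \<bullet> grad \<psi> x"
      by (simp add: power2_norm_eq_inner[symmetric] power2_eq_square)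
    also have "\<dots> \<le> L * norm (grad \<psi> x)"
      using b[of "grad \<psi> x"] grad_inner[OF sm, of x "grad \<psi> x"] by simp
    finally show ?thesis using False by simp
  qed
qed

text \<open>The approximants and their gradients are uniformly bounded and converge off the
  skeleton. Bounded convergence then serves twice: it identifies the piecewise constant P as the
  weak gradient, and it gives convergence in the H1 norm.\<close>

lemma lipschitz_piecewise_affine_H10:
  fixes f :: "'a::euclidean_space \<Rightarrow> real"
  assumes \<Omega>: "bounded \<Omega>" "open \<Omega>" "convex \<Omega>"
    and lip: "\<And>x y. \<bar>f x - f y\<bar> \<le> L * norm (x - y)" and f0: "\<And>x. x \<notin> \<Omega> \<Longrightarrow> f x = 0"
    and T: "finite T" "\<And>\<tau>. \<tau> \<in> T \<Longrightarrow> open \<tau>" "pairwise disjnt T"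
    and null: "\<Omega> - \<Union>T \<in> null_sets lebesgue"
    and aff: "\<And>\<tau> x. \<tau> \<in> T \<Longrightarrow> x \<in> \<tau> \<Longrightarrow> f x = p \<tau> \<bullet> x + c \<tau>"
  shows "f \<in> H10 \<Omega>"
proof -
  have sl: "\<Omega> \<in> sets lebesgue" using \<Omega> by auto
  have L0: "L \<ge> 0"
  proof -
    obtain b :: 'a where "b \<in> Basis" using nonempty_Basis by blast
    then show ?thesis using lip[of b 0] by simp
  qed
  obtain \<psi> :: "nat \<Rightarrow> 'a \<Rightarrow> real" where \<psi>: "\<And>n. \<psi> n \<in> test_functions \<Omega>"
    "\<And>x. (\<lambda>n. \<psi> n x) \<longlonglongrightarrow> f x"
    "\<And>n x y. \<bar>\<psi> n x - \<psi> n y\<bar> \<le> 2 * L * norm (x - y)"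
    and \<psi>4: "\<And>x p c \<delta> h. \<delta> > 0 \<Longrightarrow> (\<And>y. y \<in> ball x \<delta> \<Longrightarrow> f y = p \<bullet> y + c) \<Longrightarrow>
        (\<lambda>n. frechet_derivative (\<psi> n) (at x) h) \<longlonglongrightarrow> p \<bullet> h"
    using lipschitz_test_function_approximation[OF \<Omega> lip f0] by blast
  have sm: "smooth (\<psi> n)" for n using \<psi>(1)[of n] by (rule test_functionsE)
  define P where "P = (\<lambda>x. \<Sum>\<tau>\<in>T. indicat_real \<tau> x *\<^sub>R p \<tau>)"
  have Pm: "P \<in> borel_measurable lebesgue" unfolding P_def
    by (intro borel_measurable_sum borel_measurable_scaleR borel_measurable_indicator borel_measurable_const)
       (use T(2) in auto)
  have P: "P x = p \<tau>" if "\<tau> \<in> T" "x \<in> \<tau>" for x \<tau>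
  proof -
    have "P x = (\<Sum>\<tau>'\<in>T. if \<tau>' = \<tau> then p \<tau> else 0)" unfolding P_def
    proof (intro sum.cong refl)
      fix \<tau>' assume "\<tau>' \<in> T"
      then show "indicat_real \<tau>' x *\<^sub>R p \<tau>' = (if \<tau>' = \<tau> then p \<tau> else 0)"
        using T(3) that by (auto simp: pairwise_def disjnt_def indicator_def)
    qed
    then show ?thesis using that T(1) by simp
  qed
  define LP where "LP = (\<Sum>\<tau>\<in>T. norm (p \<tau>))"
  have Pb: "norm (P x) \<le> LP" for x unfolding P_def LP_def
    by (rule sum_norm_le) (auto simp: indicator_def)
  obtain R where R: "\<And>x. x \<in> \<Omega> \<Longrightarrow> norm x \<le> R" using \<Omega>(1) bounded_iff by metis
  obtain C where C: "\<And>x. x \<in> \<Omega> \<Longrightarrow> \<bar>f x\<bar> \<le> C"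
  proof
    fix x assume "x \<in> \<Omega>"
    then show "\<bar>f x\<bar> \<le> \<bar>f 0\<bar> + L * R"
      using lip[of x 0] mult_left_mono[OF R L0] by fastforce
  qed
  have fc: "continuous_on UNIV f"
  proof -
    have "L-lipschitz_on UNIV f" using lip L0 by (intro lipschitz_onI) (auto simp: dist_norm)
    then show ?thesis by (rule lipschitz_on_continuous_on)
  qed
  have fm: "f \<in> borel_measurable lebesgue" by (rule continuous_lebesgue_measurable[OF fc])
  have \<psi>m: "\<psi> n \<in> borel_measurable lebesgue" for n by (rule test_function_measurable[OF \<psi>(1)])
  have dm: "(\<lambda>x. frechet_derivative (\<psi> n) (at x) b) \<in> borel_measurable lebesgue" for n b
    by (rule test_function_measurable[OF test_function_partial[OF \<psi>(1)]])
  have gm: "grad (\<psi> n) \<in> borel_measurable lebesgue" for n unfolding grad_def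
    by (intro borel_measurable_sum borel_measurable_scaleR borel_measurable_const dm)
  have gb: "norm (grad (\<psi> n) x) \<le> 2 * L" for n x by (rule lipschitz_grad_bound[OF sm \<psi>(3)])
  have \<psi>b: "\<bar>\<psi> n x\<bar> \<le> 2 * L * (R + \<bar>R\<bar> + 1)" if x: "x \<in> \<Omega>" for n x
  proof -
    obtain i :: 'a where i: "i \<in> Basis" using nonempty_Basis by blast
    \<comment> \<open>A point outside \<Omega>, where every approximant is zero; the common
      Lipschitz constant then bounds the approximants on \<Omega>.\<close>
    define z where "z = (\<bar>R\<bar> + 1) *\<^sub>R i"
    have nz: "norm z = \<bar>R\<bar> + 1" using i by (simp add: z_def)
    then have "z \<notin> \<Omega>" using R[of z] by linarith
    then have "\<psi> n z = 0" using \<psi>(1)[of n] by (elim test_functionsE) blast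
    then have "\<bar>\<psi> n x\<bar> \<le> 2 * L * norm (x - z)" using \<psi>(3)[of n x z] by simp
    also have "norm (x - z) \<le> R + \<bar>R\<bar> + 1" using norm_triangle_ineq4[of x z] R[OF x] nz by linarith
    finally show ?thesis using L0 by (simp add: mult_left_mono)
  qed
  have gl: "AE x in lebesgue. x \<in> \<Omega> \<longrightarrow> (\<forall>h. (\<lambda>n. frechet_derivative (\<psi> n) (at x) h) \<longlonglongrightarrow> P x \<bullet> h)"
    using AE_not_in[OF null]
  proof (rule eventually_mono, intro impI allI)
    fix x h assume "x \<notin> \<Omega> - \<Union>T" "x \<in> \<Omega>"
    then obtain \<tau> where \<tau>: "\<tau> \<in> T" "x \<in> \<tau>" by blast
    then obtain \<delta> where \<delta>: "\<delta> > 0" "ball x \<delta> \<subseteq> \<tau>" using T(2) open_contains_ball by metis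
    show "(\<lambda>n. frechet_derivative (\<psi> n) (at x) h) \<longlonglongrightarrow> P x \<bullet> h"
      unfolding P[OF \<tau>] by (rule \<psi>4[OF \<delta>(1), of _ _ "c \<tau>"]) (use \<delta>(2) aff[OF \<tau>(1)] in blast)
  qed
  have fL: "f \<in> L2 \<Omega>" by (rule bounded_measurable_L2[OF \<Omega>(1) sl fm, of C]) (use C in auto)
  have PL: "P \<in> L2 \<Omega>" by (rule bounded_measurable_L2[OF \<Omega>(1) sl Pm, of LP]) (use Pb in auto)
  have wg: "has_weak_gradient \<Omega> f P"
    unfolding has_weak_gradient_def
  proof (intro ballI)
    fix \<xi> b assume \<xi>: "\<xi> \<in> test_functions \<Omega>" and b: "(b::'a) \<in> Basis"
    let ?d = "\<lambda>x. frechet_derivative \<xi> (at x) b"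
    obtain D where D: "D > 0" "\<And>x. \<bar>?d x\<bar> \<le> D" using test_function_bounded[OF test_function_partial[OF \<xi>]] by metis
    obtain E where E: "E > 0" "\<And>x. \<bar>\<xi> x\<bar> \<le> E" using test_function_bounded[OF \<xi>] by metis
    have "(\<lambda>n. LINT x:\<Omega>|lebesgue. \<psi> n x * ?d x) \<longlonglongrightarrow> (LINT x:\<Omega>|lebesgue. f x * ?d x)"
    proof (rule bounded_convergence_set[OF \<Omega>(1) sl])
      show "\<bar>\<psi> n x * ?d x\<bar> \<le> (2 * L * (R + \<bar>R\<bar> + 1)) * D" if "x \<in> \<Omega>" for n x
        unfolding abs_mult using \<psi>b[OF that, of n] D(2)[of x] by (intro mult_mono) auto
      show "AE x in lebesgue. x \<in> \<Omega> \<longrightarrow> (\<lambda>n. \<psi> n x * ?d x) \<longlonglongrightarrow> f x * ?d x"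
        by (intro AE_I2 impI tendsto_mult_right \<psi>(2))
    qed (intro borel_measurable_times \<psi>m fm test_function_measurable[OF test_function_partial[OF \<xi>]])+
    moreover have "(\<lambda>n. LINT x:\<Omega>|lebesgue. (grad (\<psi> n) x \<bullet> b) * \<xi> x) \<longlonglongrightarrow> (LINT x:\<Omega>|lebesgue. (P x \<bullet> b) * \<xi> x)"
    proof (rule bounded_convergence_set[OF \<Omega>(1) sl])
      show "\<bar>(grad (\<psi> n) x \<bullet> b) * \<xi> x\<bar> \<le> (2 * L) * E" if "x \<in> \<Omega>" for n x
      proof -
        have "\<bar>grad (\<psi> n) x \<bullet> b\<bar> \<le> 2 * L"
          using Cauchy_Schwarz_ineq2[of "grad (\<psi> n) x" b] gb[of n x] b by simp
        then show ?thesis unfolding abs_mult using E(2)[of x] by (intro mult_mono) auto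
      qed
      show "AE x in lebesgue. x \<in> \<Omega> \<longrightarrow> (\<lambda>n. (grad (\<psi> n) x \<bullet> b) * \<xi> x) \<longlonglongrightarrow> (P x \<bullet> b) * \<xi> x"
        using gl by (rule eventually_mono) (use b in \<open>auto simp: grad_inner_Basis intro: tendsto_mult_right\<close>)
    qed (intro borel_measurable_times borel_measurable_inner borel_measurable_const gm Pm test_function_measurable[OF \<xi>])+
    moreover have "(LINT x:\<Omega>|lebesgue. \<psi> n x * ?d x) = - (LINT x:\<Omega>|lebesgue. (grad (\<psi> n) x \<bullet> b) * \<xi> x)" for n
      using test_function_weak_gradient(1)[OF \<Omega>(1,2) \<psi>(1)[of n]] \<xi> b unfolding has_weak_gradient_def by blast
    ultimately show "(LINT x:\<Omega>|lebesgue. f x * ?d x) = - (LINT x:\<Omega>|lebesgue. (P x \<bullet> b) * \<xi> x)"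
      using LIMSEQ_unique tendsto_minus by (metis (no_types, lifting) ext)
  qed
  have f1: "f \<in> H1 \<Omega>" by (rule H1_I[OF fL PL wg])
  define s where "s = (\<lambda>n. (LINT x:\<Omega>|lebesgue. (f x - \<psi> n x)\<^sup>2) + (LINT x:\<Omega>|lebesgue. (norm (P x - grad (\<psi> n) x))\<^sup>2))"
  have H: "H1_norm \<Omega> (\<lambda>x. f x - \<psi> n x) = sqrt (s n)" for n
  proof -
    note W = test_function_weak_gradient[OF \<Omega>(1,2) \<psi>(1)[of n]]
    have \<psi>L: "\<psi> n \<in> L2 \<Omega>" using W(3) H1_D(1) by blast
    have "dirichlet_form \<Omega> (\<lambda>x. f x + (-1) *\<^sub>R \<psi> n x) (\<lambda>x. f x + (-1) *\<^sub>R \<psi> n x) =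
      l2v \<Omega> (\<lambda>x. P x + (-1) *\<^sub>R grad (\<psi> n) x) (\<lambda>x. P x + (-1) *\<^sub>R grad (\<psi> n) x)"
      by (rule dirichlet_form_eq[OF \<Omega>(1,2) L2_add_scale[OF fL \<psi>L] L2_add_scale[OF PL W(2)]
            weak_gradient_add_scale[OF \<Omega>(1) sl fL PL wg \<psi>L W(2) W(1)]])
    then show ?thesis
      unfolding H1_norm_def s_def l2_inner_def l2v_def power2_norm_eq_inner by (simp add: power2_eq_square)
  qed
  have "s \<longlonglongrightarrow> (LINT x:\<Omega>|lebesgue. 0) + (LINT x:\<Omega>|lebesgue. 0)"
    unfolding s_def
  proof (rule tendsto_add; rule bounded_convergence_set[OF \<Omega>(1) sl])
    show "\<bar>(f x - \<psi> n x)\<^sup>2\<bar> \<le> (C + 2 * L * (R + \<bar>R\<bar> + 1))\<^sup>2" if "x \<in> \<Omega>" for n x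
    proof -
      have "\<bar>f x - \<psi> n x\<bar> \<le> C + 2 * L * (R + \<bar>R\<bar> + 1)" using C[OF that] \<psi>b[OF that, of n] by linarith
      then show ?thesis using power_mono[of "\<bar>f x - \<psi> n x\<bar>" _ 2] by simp
    qed
    show "\<bar>(norm (P x - grad (\<psi> n) x))\<^sup>2\<bar> \<le> (LP + 2 * L)\<^sup>2" for n x
    proof -
      have "norm (P x - grad (\<psi> n) x) \<le> LP + 2 * L" using norm_triangle_ineq4[of "P x" "grad (\<psi> n) x"] Pb[of x] gb[of n x] by linarith
      then show ?thesis using power_mono[of "norm (P x - grad (\<psi> n) x)" _ 2] by simp
    qed
    show "AE x in lebesgue. x \<in> \<Omega> \<longrightarrow> (\<lambda>n. (f x - \<psi> n x)\<^sup>2) \<longlonglongrightarrow> 0"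
    proof (intro AE_I2 impI)
      fix x
      have "(\<lambda>n. (f x - \<psi> n x)\<^sup>2) \<longlonglongrightarrow> (f x - f x)\<^sup>2" by (intro tendsto_intros \<psi>(2))
      then show "(\<lambda>n. (f x - \<psi> n x)\<^sup>2) \<longlonglongrightarrow> 0" by simp
    qed
    show "AE x in lebesgue. x \<in> \<Omega> \<longrightarrow> (\<lambda>n. (norm (P x - grad (\<psi> n) x))\<^sup>2) \<longlonglongrightarrow> 0"
      using gl
    proof (rule eventually_mono, intro impI)
      fix x assume *: "x \<in> \<Omega> \<longrightarrow> (\<forall>h. (\<lambda>n. frechet_derivative (\<psi> n) (at x) h) \<longlonglongrightarrow> P x \<bullet> h)" "x \<in> \<Omega>"
      have "(\<lambda>n. grad (\<psi> n) x) \<longlonglongrightarrow> (\<Sum>b\<in>Basis. (P x \<bullet> b) *\<^sub>R b)"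
        unfolding grad_def by (intro tendsto_intros) (use * in auto)
      then have g: "(\<lambda>n. grad (\<psi> n) x) \<longlonglongrightarrow> P x" by (simp add: euclidean_representation)
      have "(\<lambda>n. (norm (P x - grad (\<psi> n) x))\<^sup>2) \<longlonglongrightarrow> (norm (P x - P x))\<^sup>2" by (intro tendsto_intros g)
      then show "(\<lambda>n. (norm (P x - grad (\<psi> n) x))\<^sup>2) \<longlonglongrightarrow> 0" by simp
    qed
    show "(\<lambda>x. (norm (P x - grad (\<psi> n) x))\<^sup>2) \<in> borel_measurable lebesgue" for n
      by (intro borel_measurable_power measurable_compose[OF _ borel_measurable_norm] borel_measurable_diff Pm gm)
  qed (intro borel_measurable_power borel_measurable_diff fm \<psi>m borel_measurable_const)+
  then have "s \<longlonglongrightarrow> 0" by (simp add: set_lebesgue_integral_def)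
  then have "(\<lambda>n. sqrt (s n)) \<longlonglongrightarrow> sqrt 0" by (intro tendsto_real_sqrt)
  then have lim: "(\<lambda>n. H1_norm \<Omega> (\<lambda>x. f x - \<psi> n x)) \<longlonglongrightarrow> 0" by (simp add: H)
  show ?thesis unfolding H10_def
  proof (intro CollectI conjI f1 allI impI)
    fix \<epsilon> :: real assume "\<epsilon> > 0"
    then have "\<forall>\<^sub>F n in sequentially. H1_norm \<Omega> (\<lambda>x. f x - \<psi> n x) < \<epsilon>" by (rule order_tendstoD(2)[OF lim])
    then obtain n where "H1_norm \<Omega> (\<lambda>x. f x - \<psi> n x) < \<epsilon>" by (auto simp: eventually_sequentially)
    then show "\<exists>\<psi>\<in>test_functions \<Omega>. H1_norm \<Omega> (\<lambda>x. f x - \<psi> x) < \<epsilon>" using \<psi>(1) by blast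
  qed
qed

section \<open>The mass matrix of a simplex\<close>

text \<open>Integrate \<open>g x * h (x + y)\<close> over the product measure in both orders, with \<open>g\<close> the indicator of the unit ball.\<close>

lemma lborel_translation_invariant_unique:
  fixes \<nu> :: "'a::euclidean_space measure"
  assumes sets: "sets \<nu> = sets borel" and sf: "sigma_finite_measure \<nu>"
    and inv: "\<And>a. distr \<nu> borel ((+) a) = \<nu>"
    and h: "h \<in> borel_measurable borel"
  shows "(\<integral>\<^sup>+x. h x \<partial>\<nu>) * emeasure lborel (ball (0::'a) 1) = emeasure \<nu> (ball 0 1) * (\<integral>\<^sup>+x. h x \<partial>lborel)"
proof -
  interpret N: sigma_finite_measure \<nu> by (rule sf)
  interpret P: pair_sigma_finite lborel \<nu> ..
  have sp: "space \<nu> = UNIV" using sets_eq_imp_space_eq[OF sets] by simp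
  note [measurable_cong] = sets
  define g :: "'a \<Rightarrow> ennreal" where "g = indicator (ball 0 1)"
  have g[measurable]: "g \<in> borel_measurable borel" unfolding g_def by (intro borel_measurable_indicator) simp
  note h[measurable]
  have shift: "(\<integral>\<^sup>+y. f y \<partial>\<nu>) = (\<integral>\<^sup>+y. f (a + y) \<partial>\<nu>)" if [measurable]: "f \<in> borel_measurable borel" for f :: "'a \<Rightarrow> ennreal" and a
  proof -
    have "(\<integral>\<^sup>+y. f y \<partial>\<nu>) = (\<integral>\<^sup>+y. f y \<partial>distr \<nu> borel ((+) a))" by (simp only: inv)
    also have "\<dots> = (\<integral>\<^sup>+y. f (a + y) \<partial>\<nu>)" by (intro nn_integral_distr) auto
    finally show ?thesis .
  qed
  have shiftl: "(\<integral>\<^sup>+y. f y \<partial>lborel) = (\<integral>\<^sup>+y. f (a + y) \<partial>lborel)" if [measurable]: "f \<in> borel_measurable borel" for f :: "'a \<Rightarrow> ennreal" and a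
  proof -
    have "(\<integral>\<^sup>+y. f y \<partial>lborel) = (\<integral>\<^sup>+y. f y \<partial>distr lborel borel ((+) a))" by (simp only: lborel_distr_plus)
    also have "\<dots> = (\<integral>\<^sup>+y. f (a + y) \<partial>lborel)" by (intro nn_integral_distr) auto
    finally show ?thesis .
  qed
  have "(\<integral>\<^sup>+x. h x \<partial>\<nu>) * emeasure lborel (ball (0::'a) 1) = (\<integral>\<^sup>+x. g x * (\<integral>\<^sup>+y. h y \<partial>\<nu>) \<partial>lborel)"
    unfolding g_def by (subst nn_integral_multc) (auto simp: mult.commute intro!: borel_measurable_indicator)
  also have "\<dots> = (\<integral>\<^sup>+x. (\<integral>\<^sup>+y. g x * h (x + y) \<partial>\<nu>) \<partial>lborel)"
  proof (rule nn_integral_cong)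
    fix x :: 'a
    have "g x * (\<integral>\<^sup>+y. h y \<partial>\<nu>) = g x * (\<integral>\<^sup>+y. h (x + y) \<partial>\<nu>)" by (simp only: shift[OF h, of x])
    also have "\<dots> = (\<integral>\<^sup>+y. g x * h (x + y) \<partial>\<nu>)" by (intro nn_integral_cmult[symmetric]) measurable
    finally show "g x * (\<integral>\<^sup>+y. h y \<partial>\<nu>) = (\<integral>\<^sup>+y. g x * h (x + y) \<partial>\<nu>)" .
  qed
  also have "\<dots> = (\<integral>\<^sup>+y. (\<integral>\<^sup>+x. g x * h (x + y) \<partial>lborel) \<partial>\<nu>)"
    by (rule P.Fubini'[symmetric]) measurable
  also have "\<dots> = (\<integral>\<^sup>+y. (\<integral>\<^sup>+x. g (x - y) * h x \<partial>lborel) \<partial>\<nu>)"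
  proof (rule nn_integral_cong)
    fix y :: 'a
    have "(\<integral>\<^sup>+x. g (x - y) * h x \<partial>lborel) = (\<integral>\<^sup>+x. g ((y + x) - y) * h (y + x) \<partial>lborel)"
      by (rule shiftl) measurable
    then show "(\<integral>\<^sup>+x. g x * h (x + y) \<partial>lborel) = (\<integral>\<^sup>+x. g (x - y) * h x \<partial>lborel)"
      by (simp add: add.commute)
  qed
  also have "\<dots> = (\<integral>\<^sup>+x. (\<integral>\<^sup>+y. g (x - y) * h x \<partial>\<nu>) \<partial>lborel)"
    by (rule P.Fubini') measurable
  also have "\<dots> = (\<integral>\<^sup>+x. emeasure \<nu> (ball 0 1) * h x \<partial>lborel)"
  proof (rule nn_integral_cong)
    fix x :: 'a
    have "(\<integral>\<^sup>+y. g (x - y) * h x \<partial>\<nu>) = (\<integral>\<^sup>+y. g (x - y) \<partial>\<nu>) * h x"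
      by (intro nn_integral_multc) measurable
    also have "(\<integral>\<^sup>+y. g (x - y) \<partial>\<nu>) = (\<integral>\<^sup>+y. g (x - (x + y)) \<partial>\<nu>)"
      by (rule shift) measurable
    also have "\<dots> = (\<integral>\<^sup>+y. indicator (ball 0 1) y \<partial>\<nu>)"
      by (intro nn_integral_cong) (simp add: g_def indicator_def)
    also have "\<dots> = emeasure \<nu> (ball 0 1)"
      by (intro nn_integral_indicator) (simp add: sets)
    finally show "(\<integral>\<^sup>+y. g (x - y) * h x \<partial>\<nu>) = emeasure \<nu> (ball 0 1) * h x" .
  qed
  also have "\<dots> = emeasure \<nu> (ball 0 1) * (\<integral>\<^sup>+x. h x \<partial>lborel)"
    by (rule nn_integral_cmult) measurable
  finally show ?thesis .
qed

text \<open>Only the existence of the Jacobian factor \<open>k\<close> is needed; invariant maps determine its value below.\<close>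

lemma transvection_integral:
  fixes p e :: "'a::euclidean_space" and c :: real
  assumes ne: "1 + p \<bullet> e \<noteq> 0"
  shows "\<exists>k::real. 0 \<le> k \<and> (\<forall>h::'a \<Rightarrow> real. h \<in> borel_measurable borel \<longrightarrow>
    (LINT x|lborel. h (x + (p \<bullet> x + c) *\<^sub>R e)) = k * (LINT x|lborel. h x))"
proof -
  define f where "f = (\<lambda>x. x + (p \<bullet> x + c) *\<^sub>R e)"
  \<comment> \<open>The inverse of f: since p . f(x) + c = (p . x + c)(1 + p . e), the coefficient
    of e can be recovered from f(x).\<close>
  define f' where "f' = (\<lambda>y. y - ((p \<bullet> y + c) / (1 + p \<bullet> e)) *\<^sub>R e)"
  have f'f: "f' (f x) = x" for x
  proof -
    have "p \<bullet> f x + c = (p \<bullet> x + c) * (1 + p \<bullet> e)"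
      by (simp add: f_def inner_add_right algebra_simps)
    then show ?thesis using ne by (simp add: f'_def f_def)
  qed
  have fm[measurable]: "f \<in> borel_measurable borel" "f' \<in> borel_measurable borel"
    unfolding f_def f'_def by measurable
  define \<nu> where "\<nu> = distr lborel borel f"
  have sets: "sets \<nu> = sets borel" by (simp add: \<nu>_def)
  \<comment> \<open>The preimage of a ball is contained in the image of a compact ball under the
    continuous map f', hence bounded.\<close>
  have fin: "emeasure \<nu> (ball 0 r) < \<infinity>" for r
  proof -
    have "f -` ball 0 r \<subseteq> f' ` cball 0 r"
      using f'f by (intro subsetI) (force intro: image_eqI[of _ _ "f _"])
    moreover have "bounded (f' ` cball 0 r)"
      unfolding f'_def by (intro compact_imp_bounded compact_continuous_image continuous_intros) (use ne in auto)
    ultimately have "bounded (f -` ball 0 r)" using bounded_subset by blast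
    then have "emeasure lborel (f -` ball 0 r) < \<infinity>" by (rule emeasure_bounded_finite)
    then show ?thesis by (simp add: \<nu>_def emeasure_distr)
  qed
  have sf: "sigma_finite_measure \<nu>"
  proof
    show "\<exists>A. countable A \<and> A \<subseteq> sets \<nu> \<and> \<Union> A = space \<nu> \<and> (\<forall>a\<in>A. emeasure \<nu> a \<noteq> \<infinity>)"
    proof (intro exI[of _ "range (\<lambda>n. ball 0 (real n))"] conjI ballI)
      show "(\<Union>n. ball 0 (real n)) = space \<nu>"
        by (auto simp: \<nu>_def intro: reals_Archimedean2)
      show "emeasure \<nu> a \<noteq> \<infinity>" if "a \<in> range (\<lambda>n. ball 0 (real n))" for a
        using that fin by (auto simp: less_top)
    qed (auto simp: sets)
  qed
  have inv: "distr \<nu> borel ((+) a) = \<nu>" for a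
  proof -
    \<comment> \<open>f is affine, so translating by a after f is the same as translating by b
      before f. Thus the image measure inherits translation invariance.\<close>
    define b where "b = f' (f 0 + a)"
    have "f (f' y) = y" for y
    proof -
      have "p \<bullet> f' y + c = (p \<bullet> y + c) / (1 + p \<bullet> e)"
        using ne by (simp add: f'_def inner_diff_right field_simps)
      then show ?thesis by (simp add: f_def) (simp add: f'_def)
    qed
    then have "f b = f 0 + a" by (simp add: b_def)
    then have "a + f x = f (b + x)" for x
      by (simp add: f_def inner_add_right algebra_simps)
    then have eq: "(+) a \<circ> f = f \<circ> (+) b" by (simp add: fun_eq_iff)
    have "distr \<nu> borel ((+) a) = distr lborel borel ((+) a \<circ> f)"
      unfolding \<nu>_def by (intro distr_distr) auto
    also have "\<dots> = distr (distr lborel borel ((+) b)) borel f"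
      unfolding eq by (intro distr_distr[symmetric]) auto
    finally show ?thesis by (simp add: lborel_distr_plus \<nu>_def)
  qed
  have b1: "emeasure lborel (ball (0::'a) 1) \<noteq> 0" "emeasure lborel (ball (0::'a) 1) < \<infinity>"
    using content_ball_pos[of 1 "0::'a"] emeasure_bounded_finite[of "ball (0::'a) 1"]
    by (auto simp: measure_def)
  define K where "K = emeasure \<nu> (ball 0 1) / emeasure lborel (ball (0::'a) 1)"
  have K: "K < \<infinity>" using fin[of 1] b1 by (auto simp: K_def ennreal_divide_eq_top_iff less_top[symmetric])
  define k where "k = enn2real K"
  have k: "0 \<le> k" "ennreal k = K" using K by (auto simp: k_def)
  have "emeasure \<nu> A = K * emeasure lborel A" if A: "A \<in> sets borel" for A
  proof -
    have "emeasure \<nu> A * emeasure lborel (ball (0::'a) 1) = emeasure \<nu> (ball 0 1) * emeasure lborel A"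
      using lborel_translation_invariant_unique[OF sets sf inv, of "indicator A"] A sets by simp
    then have "(emeasure \<nu> A * emeasure lborel (ball (0::'a) 1)) / emeasure lborel (ball (0::'a) 1) = K * emeasure lborel A"
      by (simp add: K_def ennreal_times_divide mult.commute)
    then show ?thesis using b1 by (simp add: ennreal_mult_divide_eq)
  qed
  then have \<nu>: "\<nu> = density lborel (\<lambda>_. ennreal k)"
    by (intro measure_eqI) (auto simp: sets k emeasure_density nn_integral_cmult)
  have "(LINT x|lborel. h (f x)) = k * (LINT x|lborel. h x)" if [measurable]: "h \<in> borel_measurable borel" for h :: "'a \<Rightarrow> real"
  proof -
    have "(LINT x|lborel. h (f x)) = (LINT x|\<nu>. h x)"
      unfolding \<nu>_def by (intro integral_distr[symmetric]) auto
    also have "\<dots> = (LINT x|lborel. k *\<^sub>R h x)"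
      unfolding \<nu> using k by (intro integral_density) auto
    finally show ?thesis by simp
  qed
  then show ?thesis using k unfolding f_def by blast
qed

section \<open>Barycentric coordinates\<close>

definition affine_fun :: "('a::euclidean_space \<Rightarrow> real) \<Rightarrow> bool" where
  "affine_fun l \<longleftrightarrow> (\<exists>p c. \<forall>x. l x = p \<bullet> x + c)"

text \<open>The coordinate is an affine function on the whole space, so it can be composed with
  affine maps, and lying in the simplex becomes a sign condition.\<close>

definition bary :: "'a::euclidean_space set \<Rightarrow> 'a \<Rightarrow> 'a \<Rightarrow> real" where
  "bary C a = (SOME l. affine_fun l \<and> l a = 1 \<and> (\<forall>b\<in>C - {a}. l b = 0))"

lemma ex_affine_coordinate:
  fixes C :: "'a::euclidean_space set"
  assumes C: "\<not> affine_dependent C" and a: "a \<in> C"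
  shows "\<exists>l. affine_fun l \<and> l a = 1 \<and> (\<forall>b\<in>C - {a}. l b = 0)"
proof (cases "C = {a}")
  case True
  then show ?thesis by (intro exI[of _ "\<lambda>x. 1"]) (auto simp: affine_fun_def intro: exI[of _ 0])
next
  case False
  then obtain b where b: "b \<in> C" "b \<noteq> a" using a by blast
  \<comment> \<open>Moving another vertex b to the origin turns affine into linear independence. The
    functional to be extended is 1 on a - b and 0 on the other differences.\<close>
  define B where "B = (\<lambda>x. - b + x) ` (C - {b})"
  have "\<not> affine_dependent (insert b (C - {b}))" using C b by (simp add: insert_absorb)
  then have "independent B" unfolding B_def by (subst (asm) affine_dependent_iff_dependent) auto
  then obtain f where f: "linear f" "\<And>v. v \<in> B \<Longrightarrow> f v = (if v = - b + a then 1 else 0::real)"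
    using linear_independent_extend[of B "\<lambda>v. if v = - b + a then 1 else 0::real"] by auto
  define p where "p = (\<Sum>i\<in>Basis. f i *\<^sub>R i)"
  have fp: "f x = p \<bullet> x" for x
  proof -
    have "f x = f (\<Sum>i\<in>Basis. (x \<bullet> i) *\<^sub>R i)" by (simp add: euclidean_representation)
    also have "\<dots> = (\<Sum>i\<in>Basis. (x \<bullet> i) * f i)"
      using f(1) by (simp add: linear_sum linear_scale)
    also have "\<dots> = p \<bullet> x" by (simp add: p_def inner_sum_left inner_commute[of x] mult.commute)
    finally show ?thesis .
  qed
  have val: "p \<bullet> x - p \<bullet> b = (if x = a then 1 else 0)" if "x \<in> C" for x
  proof (cases "x = b")
    case False
    then have "- b + x \<in> B" using that by (auto simp: B_def)
    from f(2)[OF this] show ?thesis by (simp add: fp inner_diff_right)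
  qed (use b in auto)
  show ?thesis
  proof (intro exI[of _ "\<lambda>x. p \<bullet> x + (- (p \<bullet> b))"] conjI ballI)
    show "affine_fun (\<lambda>x. p \<bullet> x + - (p \<bullet> b))" unfolding affine_fun_def by blast
  qed (use val a in auto)
qed

lemma bary_props:
  fixes C :: "'a::euclidean_space set"
  assumes "\<not> affine_dependent C" "a \<in> C"
  shows "affine_fun (bary C a)" "bary C a a = 1" "b \<in> C \<Longrightarrow> b \<noteq> a \<Longrightarrow> bary C a b = 0"
  using someI_ex[OF ex_affine_coordinate[OF assms]] unfolding bary_def[symmetric] by auto

lemma affine_fun_continuous: "affine_fun l \<Longrightarrow> continuous_on S l"
proof -
  assume "affine_fun l"
  then obtain p c where "l = (\<lambda>x. p \<bullet> x + c)" by (auto simp: affine_fun_def)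
  then show "continuous_on S l" by (simp add: continuous_intros)
qed

lemma affine_fun_cmul_sum: "(\<And>i. i \<in> I \<Longrightarrow> affine_fun (f i)) \<Longrightarrow> affine_fun (\<lambda>x. \<Sum>i\<in>I. c i * f i x)"
proof (induction I rule: infinite_finite_induct)
  case (insert i I)
  then obtain p r q s where "\<And>x. f i x = p \<bullet> x + r" "\<And>x. (\<Sum>i\<in>I. c i * f i x) = q \<bullet> x + s"
    unfolding affine_fun_def by (metis insert_iff)
  then show ?case using insert.hyps unfolding affine_fun_def
    by (intro exI[of _ "c i *\<^sub>R p + q"] exI[of _ "c i * r + s"]) (auto simp: inner_add_left algebra_simps)
qed (auto simp: affine_fun_def intro: exI[of _ 0])

text \<open>The set on which two affine functions agree is affine, so it contains the affine hull of
  any of its subsets.\<close>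

lemma affine_fun_eq_hull:
  assumes "affine_fun l" "affine_fun l'" "\<And>x. x \<in> C \<Longrightarrow> l x = l' x" "x \<in> affine hull C"
  shows "l x = l' x"
proof -
  obtain p r q s where l: "\<And>x. l x = p \<bullet> x + r" "\<And>x. l' x = q \<bullet> x + s"
    using assms unfolding affine_fun_def by metis
  have "{x. l x = l' x} = {x. (p - q) \<bullet> x = s - r}"
    by (auto simp: l inner_diff_left)
  then have "affine {x. l x = l' x}" by (simp only: affine_hyperplane)
  then have "affine hull C \<subseteq> {x. l x = l' x}" using assms(3) by (intro hull_minimal) auto
  then show ?thesis using assms(4) by auto
qed

lemma bary_expand:
  fixes C :: "'a::euclidean_space set"
  assumes C: "\<not> affine_dependent C" and l: "affine_fun l" and x: "x \<in> affine hull C"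
  shows "l x = (\<Sum>a\<in>C. l a * bary C a x)"
proof (rule affine_fun_eq_hull[OF l _ _ x])
  show "affine_fun (\<lambda>x. \<Sum>a\<in>C. l a * bary C a x)"
    by (rule affine_fun_cmul_sum) (rule bary_props[OF C])
  fix b assume b: "b \<in> C"
  have fin: "finite C" using C aff_independent_finite by blast
  have "(\<Sum>a\<in>C. l a * bary C a b) = (\<Sum>a\<in>C. if a = b then l b else 0)"
    by (intro sum.cong) (use bary_props[OF C] b in auto)
  then show "l b = (\<Sum>a\<in>C. l a * bary C a b)" using b fin by simp
qed

text \<open>Both equations are instances of \<open>bary_expand\<close>, for the constant 1 and for
  the linear coordinate functions.\<close>

lemma bary_sum:
  fixes C :: "'a::euclidean_space set"
  assumes C: "\<not> affine_dependent C" and x: "x \<in> affine hull C"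
  shows "(\<Sum>a\<in>C. bary C a x) = 1" "(\<Sum>a\<in>C. bary C a x *\<^sub>R a) = x"
proof -
  have "affine_fun (\<lambda>x. 1)" by (auto simp: affine_fun_def intro: exI[of _ 0])
  from bary_expand[OF C this x] show "(\<Sum>a\<in>C. bary C a x) = 1" by simp
  show "(\<Sum>a\<in>C. bary C a x *\<^sub>R a) = x"
  proof (rule euclidean_eqI)
    fix b :: 'a
    have "affine_fun (\<lambda>x. b \<bullet> x)" by (auto simp: affine_fun_def intro: exI[of _ b])
    from bary_expand[OF C this x] have "x \<bullet> b = (\<Sum>a\<in>C. b \<bullet> a * bary C a x)" by (simp only: inner_commute[of x])
    also have "\<dots> = (\<Sum>a\<in>C. bary C a x *\<^sub>R a) \<bullet> b"
      unfolding inner_sum_left inner_scaleR_left by (intro sum.cong refl) (simp only: inner_commute mult.commute)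
    finally show "(\<Sum>a\<in>C. bary C a x *\<^sub>R a) \<bullet> b = x \<bullet> b" by (rule sym)
  qed
qed

lemma convex_hull_bary:
  fixes C :: "'a::euclidean_space set"
  assumes C: "\<not> affine_dependent C"
  shows "convex hull C = {x \<in> affine hull C. \<forall>a\<in>C. 0 \<le> bary C a x}"
proof
  have fin: "finite C" using C aff_independent_finite by blast
  show "convex hull C \<subseteq> {x \<in> affine hull C. \<forall>a\<in>C. 0 \<le> bary C a x}"
  proof
    fix x assume x: "x \<in> convex hull C"
    have "0 \<le> bary C a x" if a: "a \<in> C" for a
    proof -
      obtain p c where pc: "\<And>x. bary C a x = p \<bullet> x + c"
        using bary_props(1)[OF C a] by (auto simp: affine_fun_def)
      have "convex {x. p \<bullet> x \<ge> - c}" by (rule convex_halfspace_ge)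
      moreover have "C \<subseteq> {x. p \<bullet> x \<ge> - c}"
      proof
        fix b assume "b \<in> C"
        then have "0 \<le> bary C a b" using bary_props(2,3)[OF C a] by (cases "b = a") auto
        then show "b \<in> {x. p \<bullet> x \<ge> - c}" by (simp add: pc)
      qed
      ultimately have "convex hull C \<subseteq> {x. p \<bullet> x \<ge> - c}" by (intro hull_minimal)
      then show ?thesis using x pc by fastforce
    qed
    then show "x \<in> {x \<in> affine hull C. \<forall>a\<in>C. 0 \<le> bary C a x}"
      using x convex_hull_subset_affine_hull by blast
  qed
  show "{x \<in> affine hull C. \<forall>a\<in>C. 0 \<le> bary C a x} \<subseteq> convex hull C"
  proof
    fix x assume "x \<in> {x \<in> affine hull C. \<forall>a\<in>C. 0 \<le> bary C a x}"
    then have x: "x \<in> affine hull C" "\<And>a. a \<in> C \<Longrightarrow> 0 \<le> bary C a x" by auto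
    have "(\<Sum>a\<in>C. bary C a x *\<^sub>R a) \<in> convex hull C"
      using bary_sum(1)[OF C x(1)] x(2) fin by (intro convex_sum) (auto intro: hull_inc)
    then show "x \<in> convex hull C" using bary_sum(2)[OF C x(1)] by simp
  qed
qed

text \<open>Only the ratio between off-diagonal and diagonal entries matters later, so the common
  diagonal value stays implicit.\<close>

lemma simplex_mass_matrix:
  fixes C :: "'a::euclidean_space set"
  assumes C: "\<not> affine_dependent C" and card: "card C = Suc DIM('a)"
  defines "S \<equiv> convex hull C"
  shows "\<exists>\<alpha>\<ge>0. \<forall>a\<in>C. \<forall>b\<in>C. (LINT x|lborel. indicat_real S x * (bary C a x * bary C b x)) = (if a = b then \<alpha> else \<alpha> / 2)"
proof -
  let ?l = "bary C"
  have fin: "finite C" using C aff_independent_finite by blast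
  have hull: "affine hull C = UNIV" using affine_independent_span_eq[OF C card] .
  have S: "S = {x. \<forall>a\<in>C. 0 \<le> ?l a x}" unfolding S_def convex_hull_bary[OF C] hull by simp
  have cS: "compact S" unfolding S_def using fin by (rule finite_imp_compact_convex_hull)
  define I where "I = (\<lambda>F. LINT x|lborel. indicat_real S x * F x)"
  have iS: "integrable lborel (\<lambda>x. indicat_real K x * F x)" if "continuous_on UNIV F" "compact K" for F :: "'a \<Rightarrow> real" and K
    using borel_integrable_compact[OF that(2) continuous_on_subset[OF that(1)]] by simp
  have cl: "continuous_on UNIV (?l a)" if "a \<in> C" for a
    using affine_fun_continuous[OF bary_props(1)[OF C that]] .
  have cll: "continuous_on UNIV (\<lambda>x. ?l a x * ?l b x)" if "a \<in> C" "b \<in> C" for a b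
    by (intro continuous_intros cl that)
  have pos: "I (\<lambda>x. 1) > 0"
  proof -
    have "interior S \<noteq> {}" unfolding S_def using interior_convex_hull_eq_empty[OF card] C by simp
    then obtain z r where zr: "r > 0" "ball z r \<subseteq> S"
      by (metis all_not_in_conv interior_subset open_contains_ball open_interior order_trans)
    have "0 < measure lborel (ball z r)" using content_ball_pos[OF zr(1)] .
    also have "\<dots> \<le> measure lborel S"
      using zr cS by (intro measure_mono_fmeasurable) (auto simp: fmeasurable_compact)
    finally show ?thesis by (simp add: I_def)
  qed
  define swaps where "swaps = (\<lambda>a b T. (\<forall>F K. F \<in> borel_measurable borel \<longrightarrow> K \<in> sets borel \<longrightarrow>
        (LINT x|lborel. indicat_real K (T x) * F (T x)) = (LINT x|lborel. indicat_real K x * (F x :: real))) \<and>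
      (\<forall>x. ?l a (T x) = ?l b x \<and> ?l b (T x) = ?l a x \<and> (\<forall>c\<in>C. c \<noteq> a \<longrightarrow> c \<noteq> b \<longrightarrow> ?l c (T x) = ?l c x)))"
  have swap: "\<exists>T. swaps a b T"
    if ab: "a \<in> C" "b \<in> C" "a \<noteq> b" for a b
  proof -
    obtain p c where pc: "\<And>d x. d \<in> C \<Longrightarrow> ?l d x = p d \<bullet> x + c d"
      using bary_props(1)[OF C] unfolding affine_fun_def by metis
    \<comment> \<open>The displacement is (\<lambda>_a - \<lambda>_b)(b - a): T exchanges the
      vertices a and b and fixes all the others.\<close>
    define T where "T = (\<lambda>x. x + ((p a - p b) \<bullet> x + (c a - c b)) *\<^sub>R (b - a))"
    have inc: "p d \<bullet> (b - a) = ?l d b - ?l d a" if "d \<in> C" for d using pc that by (simp add: inner_diff_right)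
    have lT: "?l d (T x) = ?l d x + (?l a x - ?l b x) * (?l d b - ?l d a)" if "d \<in> C" for d x
      using inc[OF that] pc[OF that] pc[OF ab(1)] pc[OF ab(2)]
      by (simp add: T_def inner_add_right inner_diff_left algebra_simps)
    have vals: "?l a a = 1" "?l b b = 1" "?l a b = 0" "?l b a = 0" "d \<in> C \<Longrightarrow> d \<noteq> a \<Longrightarrow> ?l d a = 0" "d \<in> C \<Longrightarrow> d \<noteq> b \<Longrightarrow> ?l d b = 0" for d
      using bary_props[OF C] ab by auto
    have lT': "?l a (T x) = ?l b x" "?l b (T x) = ?l a x" "d \<in> C \<Longrightarrow> d \<noteq> a \<Longrightarrow> d \<noteq> b \<Longrightarrow> ?l d (T x) = ?l d x" for x d
      using lT[of a x] lT[of b x] lT[of d x] ab vals by auto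
    have "1 + (p a - p b) \<bullet> (b - a) \<noteq> 0" using inc[OF ab(1)] inc[OF ab(2)] vals by (simp add: inner_diff_left)
    from transvection_integral[OF this, of "c a - c b"]
    obtain k where k: "\<And>h::'a \<Rightarrow> real. h \<in> borel_measurable borel \<Longrightarrow> (LINT x|lborel. h (T x)) = k * (LINT x|lborel. h x)"
      unfolding T_def by blast
    have TS: "T x \<in> S \<longleftrightarrow> x \<in> S" for x
    proof -
      have "(\<forall>d\<in>C. 0 \<le> ?l d (T x)) \<longleftrightarrow> (\<forall>d\<in>C. 0 \<le> ?l d x)"
        using lT' ab by metis
      then show ?thesis by (simp add: S)
    qed
    \<comment> \<open>T maps S onto itself, and the volume of S is positive, so the unknown Jacobian
      factor is 1.\<close>
    have "I (\<lambda>x. 1) = k * I (\<lambda>x. 1)"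
      using k[of "indicat_real S", OF borel_measurable_indicator] cS TS by (simp add: I_def indicator_def borel_compact)
    then have "k = 1" using pos by simp
    have "(LINT x|lborel. indicat_real K (T x) * F (T x)) = (LINT x|lborel. indicat_real K x * F x)"
      if "F \<in> borel_measurable borel" "K \<in> sets borel" for F K
      using k[of "\<lambda>x. indicat_real K x * F x"] \<open>k = 1\<close> borel_measurable_times[OF borel_measurable_indicator that(1)] that(2)
      by simp
    then show ?thesis using lT' unfolding swaps_def by (intro exI[of _ T]) auto
  qed
  have half: "I (\<lambda>x. ?l a x * ?l b x) = I (\<lambda>x. ?l b x * ?l b x) / 2" if ab: "a \<in> C" "b \<in> C" "a \<noteq> b" for a b
  proof -
    obtain p c where pc: "\<And>d x. d \<in> C \<Longrightarrow> ?l d x = p d \<bullet> x + c d"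
      using bary_props(1)[OF C] unfolding affine_fun_def by metis
    \<comment> \<open>\<open>T\<close> moves \<open>b\<close> to the midpoint of \<open>a\<close> and \<open>b\<close>, so it maps \<open>S\<close> onto its half \<open>H\<close>.\<close>
    define T where "T = (\<lambda>x. x + (((1/2) *\<^sub>R p b) \<bullet> x + c b / 2) *\<^sub>R (a - b))"
    have inc: "p d \<bullet> (a - b) = ?l d a - ?l d b" if "d \<in> C" for d using pc that by (simp add: inner_diff_right)
    have lT: "?l d (T x) = ?l d x + ?l b x / 2 * (?l d a - ?l d b)" if "d \<in> C" for d x
      using inc[OF that] pc[OF that] pc[OF ab(2)]
      by (simp add: T_def inner_add_right inner_diff_left algebra_simps add_divide_distrib)
    have vals: "?l a a = 1" "?l b b = 1" "?l a b = 0" "?l b a = 0" "d \<in> C \<Longrightarrow> d \<noteq> a \<Longrightarrow> ?l d a = 0" "d \<in> C \<Longrightarrow> d \<noteq> b \<Longrightarrow> ?l d b = 0" for d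
      using bary_props[OF C] ab by auto
    have lT': "?l a (T x) = ?l a x + ?l b x / 2" "?l b (T x) = ?l b x / 2" "d \<in> C \<Longrightarrow> d \<noteq> a \<Longrightarrow> d \<noteq> b \<Longrightarrow> ?l d (T x) = ?l d x" for x d
      using lT[of a x] lT[of b x] lT[of d x] ab vals by auto
    have "1 + ((1/2) *\<^sub>R p b) \<bullet> (a - b) \<noteq> 0" using inc[OF ab(2)] vals by simp
    from transvection_integral[OF this, of "c b / 2"]
    obtain k where k: "\<And>h::'a \<Rightarrow> real. h \<in> borel_measurable borel \<Longrightarrow> (LINT x|lborel. h (T x)) = k * (LINT x|lborel. h x)"
      unfolding T_def by blast
    define H where "H = S \<inter> {x. ?l b x \<le> ?l a x}"
    define H' where "H' = S \<inter> {x. ?l a x \<le> ?l b x}"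
    have cH: "compact H" "compact H'" unfolding H_def H'_def
      by (intro compact_Int_closed cS closed_Collect_le cl ab)+
    have TH: "T x \<in> H \<longleftrightarrow> x \<in> S" for x
    proof -
      have "(\<forall>d\<in>C. 0 \<le> ?l d (T x)) \<and> ?l b (T x) \<le> ?l a (T x) \<longleftrightarrow> (\<forall>d\<in>C. 0 \<le> ?l d x)" (is "?L \<longleftrightarrow> ?R")
      proof
        assume L: ?L
        show ?R
        proof
          fix d assume "d \<in> C"
          then show "0 \<le> ?l d x" using L lT'(3)[of d x] lT'(1)[of x] lT'(2)[of x] ab
            by (cases "d = a"; cases "d = b") auto
        qed
      next
        assume R: ?R
        have "0 \<le> ?l d (T x)" if "d \<in> C" for d
          using R lT'(3)[of d x] lT'(1)[of x] lT'(2)[of x] ab that by (cases "d = a"; cases "d = b") auto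
        then show ?L using R lT'(1,2)[of x] ab by auto
      qed
      then show ?thesis by (simp add: S H_def)
    qed
    define IH :: "'a set \<Rightarrow> ('a \<Rightarrow> real) \<Rightarrow> real" where "IH = (\<lambda>K F. LINT x|lborel. indicat_real K x * F x)"
    have kH: "I (\<lambda>x. F (T x)) = k * IH H F" if F: "continuous_on UNIV F" for F
    proof -
      have "(\<lambda>x. indicat_real H x * F x) \<in> borel_measurable borel"
        using cH borel_measurable_continuous_onI[OF F]
        by (intro borel_measurable_times borel_measurable_indicator) (auto simp: borel_compact)
      from k[OF this] show ?thesis by (simp add: I_def IH_def TH indicator_def)
    qed
    obtain U where "swaps a b U" using swap[OF ab] by blast
    then have U: "(LINT x|lborel. indicat_real K (U x) * F (U x)) = IH K F" if "F \<in> borel_measurable borel" "K \<in> sets borel" for F K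
      using that unfolding swaps_def IH_def by blast
    have U': "?l a (U x) = ?l b x" "?l b (U x) = ?l a x" "d \<in> C \<Longrightarrow> d \<noteq> a \<Longrightarrow> d \<noteq> b \<Longrightarrow> ?l d (U x) = ?l d x" for x d
      using \<open>swaps a b U\<close> unfolding swaps_def by blast+
    have US: "U x \<in> H' \<longleftrightarrow> x \<in> H" for x
    proof -
      have "(\<forall>d\<in>C. 0 \<le> ?l d (U x)) \<longleftrightarrow> (\<forall>d\<in>C. 0 \<le> ?l d x)"
        using U' ab by metis
      then show ?thesis by (simp add: S H_def H'_def U')
    qed
    \<comment> \<open>The exchange of a and b carries one half of S onto the other, and the halves
      overlap only in the hyperplane \<lambda>_a = \<lambda>_b, a null set. Hence the halves
      contribute equally for symmetric F.\<close>
    have split: "I F = 2 * IH H F" if F: "continuous_on UNIV F" and sym: "\<And>x. F (U x) = F x" for F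
    proof -
      have "(\<lambda>x. indicat_real H' (U x) * F (U x)) = (\<lambda>x. indicat_real H x * F x)"
        by (simp add: fun_eq_iff sym US indicator_def)
      then have e: "IH H' F = IH H F"
        using U[of F H'] cH borel_measurable_continuous_onI[OF F] by (simp add: borel_compact IH_def)
      have "p a - p b \<noteq> 0"
      proof
        assume "p a - p b = 0"
        then have "?l a a - ?l b a = ?l a b - ?l b b" using pc ab by simp
        then show False using vals by simp
      qed
      then have "negligible {x. (p a - p b) \<bullet> x = c b - c a}" by (intro negligible_hyperplane) auto
      then have N: "{x. (p a - p b) \<bullet> x = c b - c a} \<in> null_sets lborel"
        using closed_hyperplane[of "p a - p b" "c b - c a"]
        by (simp add: negligible_iff_null_sets null_sets_completion_iff borel_closed)
      have "I F = (LINT x|lborel. indicat_real H x * F x + indicat_real H' x * F x)"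
        unfolding I_def
      proof (rule integral_cong_AE)
        have "AE x in lborel. x \<notin> {x. (p a - p b) \<bullet> x = c b - c a}" by (rule AE_not_in[OF N])
        then show "AE x in lborel. indicat_real S x * F x = indicat_real H x * F x + indicat_real H' x * F x"
        proof (rule eventually_mono)
          fix x assume "x \<notin> {x. (p a - p b) \<bullet> x = c b - c a}"
          then have "?l a x \<noteq> ?l b x" using pc ab by (simp add: inner_diff_left)
          then show "indicat_real S x * F x = indicat_real H x * F x + indicat_real H' x * F x"
            by (auto simp: H_def H'_def indicator_def)
        qed
      qed (use iS[OF F cS] iS[OF F cH(1)] iS[OF F cH(2)] in auto)
      also have "\<dots> = IH H F + IH H' F" unfolding IH_def
        by (intro Bochner_Integration.integral_add iS F cH)
      finally show ?thesis using e by simp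
    qed
    have "I (\<lambda>x. 1) = k * IH H (\<lambda>x. 1)" using kH[of "\<lambda>x. 1"] by simp
    moreover have "I (\<lambda>x. 1) = 2 * IH H (\<lambda>x. 1)" by (rule split) auto
    ultimately have k2: "k = 2" using pos by (metis mult_cancel_right mult_zero_right order_less_irrefl)
    \<comment> \<open>Transporting the symmetric product \<lambda>_a \<lambda>_b by T gives
      (\<lambda>_a + \<lambda>_b/2)(\<lambda>_b/2), whose integral equals that of \<lambda>_a
      \<lambda>_b. So I(\<lambda>_a \<lambda>_b) = I(\<lambda>_a \<lambda>_b)/2 +
      I(\<lambda>_b^2)/4, which is a linear equation for the entry.\<close>
    have "I (\<lambda>x. ?l a (T x) * ?l b (T x)) = 2 * IH H (\<lambda>x. ?l a x * ?l b x)"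
      using kH[OF cll[OF ab(1,2)]] k2 by simp
    also have "\<dots> = I (\<lambda>x. ?l a x * ?l b x)"
      by (rule split[symmetric]) (use cll[OF ab(1,2)] U'(1,2) in \<open>auto simp: mult.commute\<close>)
    also have "I (\<lambda>x. ?l a (T x) * ?l b (T x)) = I (\<lambda>x. 1/2 * (?l a x * ?l b x) + 1/4 * (?l b x * ?l b x))"
      by (simp add: lT' field_simps)
    also have "\<dots> = (LINT x|lborel. 1/2 * (indicat_real S x * (?l a x * ?l b x)) + 1/4 * (indicat_real S x * (?l b x * ?l b x)))"
      unfolding I_def by (intro Bochner_Integration.integral_cong) (auto simp: algebra_simps)
    also have "\<dots> = 1/2 * I (\<lambda>x. ?l a x * ?l b x) + 1/4 * I (\<lambda>x. ?l b x * ?l b x)"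
      unfolding I_def using iS[OF cll[OF ab(1,2)] cS] iS[OF cll[OF ab(2,2)] cS] by simp
    finally show ?thesis by simp
  qed
  have eq: "I (\<lambda>x. ?l a x * ?l a x) = I (\<lambda>x. ?l b x * ?l b x)" if ab: "a \<in> C" "b \<in> C" for a b
  proof (cases "a = b")
    case False
    have "I (\<lambda>x. ?l a x * ?l b x) = I (\<lambda>x. ?l b x * ?l a x)" by (simp add: mult.commute)
    then show ?thesis using half[OF ab False] half[OF ab(2,1)] False by simp
  qed simp
  have "C \<noteq> {}" using card by auto
  then obtain a0 where a0: "a0 \<in> C" by blast
  have "0 \<le> I (\<lambda>x. ?l a0 x * ?l a0 x)" unfolding I_def by (intro Bochner_Integration.integral_nonneg) auto
  moreover have "I (\<lambda>x. ?l a x * ?l b x) = (if a = b then I (\<lambda>x. ?l a0 x * ?l a0 x) else I (\<lambda>x. ?l a0 x * ?l a0 x) / 2)"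
    if "a \<in> C" "b \<in> C" for a b
    using half[OF that] eq[OF that(2) a0] by auto
  ultimately show ?thesis unfolding I_def by blast
qed

text \<open>The quadratic form is \<alpha>/2 times the sum of (\<Sum> u)^2 and \<Sum> u^2. Dropping
  the square gives the lower bound; Cauchy-Schwarz over d+1 vertices bounds it by (d+1) \<Sum> u^2,
  and together with the second term this makes d+2.\<close>

lemma simplex_mass_bounds:
  fixes C :: "'a::euclidean_space set"
  assumes C: "\<not> affine_dependent C" and card: "card C = Suc DIM('a)"
  defines "M \<equiv> \<lambda>F. LINT x|lborel. indicat_real (convex hull C) x * (F x :: real)"
  shows "1/2 * (\<Sum>a\<in>C. (u a)\<^sup>2 * M (\<lambda>x. (bary C a x)\<^sup>2)) \<le> M (\<lambda>x. (\<Sum>a\<in>C. u a * bary C a x)\<^sup>2)"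
    and "M (\<lambda>x. (\<Sum>a\<in>C. u a * bary C a x)\<^sup>2) \<le> (real DIM('a) + 2) / 2 * (\<Sum>a\<in>C. (u a)\<^sup>2 * M (\<lambda>x. (bary C a x)\<^sup>2))"
proof -
  have fin: "finite C" using C aff_independent_finite by blast
  have cS: "compact (convex hull C)" using fin by (rule finite_imp_compact_convex_hull)
  obtain \<alpha> where \<alpha>: "\<alpha> \<ge> 0" "\<And>a b. a \<in> C \<Longrightarrow> b \<in> C \<Longrightarrow> M (\<lambda>x. bary C a x * bary C b x) = (if a = b then \<alpha> else \<alpha> / 2)"
    using simplex_mass_matrix[OF C card] unfolding M_def by metis
  have iS: "integrable lborel (\<lambda>x. indicat_real (convex hull C) x * (bary C a x * bary C b x))" if "a \<in> C" "b \<in> C" for a b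
    using borel_integrable_compact[OF cS, of "\<lambda>x. bary C a x * bary C b x"]
      affine_fun_continuous[OF bary_props(1)[OF C]] that by (simp add: continuous_intros)
  have "M (\<lambda>x. (\<Sum>a\<in>C. u a * bary C a x)\<^sup>2) =
      (LINT x|lborel. (\<Sum>a\<in>C. \<Sum>b\<in>C. u a * u b * (indicat_real (convex hull C) x * (bary C a x * bary C b x))))"
    unfolding M_def
    by (intro Bochner_Integration.integral_cong) (auto simp: power2_eq_square sum_product sum_distrib_left mult_ac)
  also have "\<dots> = (\<Sum>a\<in>C. \<Sum>b\<in>C. u a * u b * M (\<lambda>x. bary C a x * bary C b x))"
    unfolding M_def using iS by (subst Bochner_Integration.integral_sum; (simp add: Bochner_Integration.integral_sum)?)
  also have "\<dots> = (\<Sum>a\<in>C. \<Sum>b\<in>C. \<alpha>/2 * (u a * u b) + (if a = b then \<alpha>/2 * (u a)\<^sup>2 else 0))"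
    using \<alpha>(2) by (intro sum.cong) (auto simp: power2_eq_square field_simps)
  also have "\<dots> = \<alpha>/2 * (\<Sum>a\<in>C. u a)\<^sup>2 + \<alpha>/2 * (\<Sum>a\<in>C. (u a)\<^sup>2)"
  proof -
    have sq: "(\<Sum>a\<in>C. u a)\<^sup>2 = (\<Sum>a\<in>C. \<Sum>b\<in>C. u a * u b)"
      by (simp add: power2_eq_square sum_product)
    show ?thesis unfolding sq using fin by (simp add: sum.distrib sum_distrib_left)
  qed
  finally have e: "M (\<lambda>x. (\<Sum>a\<in>C. u a * bary C a x)\<^sup>2) = \<alpha>/2 * (\<Sum>a\<in>C. u a)\<^sup>2 + \<alpha>/2 * (\<Sum>a\<in>C. (u a)\<^sup>2)" .
  have d: "(\<Sum>a\<in>C. (u a)\<^sup>2 * M (\<lambda>x. (bary C a x)\<^sup>2)) = \<alpha> * (\<Sum>a\<in>C. (u a)\<^sup>2)"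
    using \<alpha>(2) by (simp add: power2_eq_square sum_distrib_left mult_ac)
  have cs: "(\<Sum>a\<in>C. u a)\<^sup>2 \<le> (real DIM('a) + 1) * (\<Sum>a\<in>C. (u a)\<^sup>2)"
    using Cauchy_Schwarz_ineq_sum[of u "\<lambda>_. 1" C] card by (simp add: mult.commute add.commute)
  show "1/2 * (\<Sum>a\<in>C. (u a)\<^sup>2 * M (\<lambda>x. (bary C a x)\<^sup>2)) \<le> M (\<lambda>x. (\<Sum>a\<in>C. u a * bary C a x)\<^sup>2)"
    unfolding d e using \<alpha>(1) by simp
  show "M (\<lambda>x. (\<Sum>a\<in>C. u a * bary C a x)\<^sup>2) \<le> (real DIM('a) + 2) / 2 * (\<Sum>a\<in>C. (u a)\<^sup>2 * M (\<lambda>x. (bary C a x)\<^sup>2))"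
    unfolding d e using mult_left_mono[OF cs, of "\<alpha>/2"] \<alpha>(1) by (simp add: field_simps)
qed

section \<open>Hat functions and nodal representation\<close>

lemma integral_cong_lebesgue_ae:
  fixes f g :: "'a::euclidean_space \<Rightarrow> real"
  assumes "AE x in lebesgue. f x = g x"
  shows "(LINT x|lebesgue. f x) = (LINT x|lebesgue. g x)"
  using set_integral_cong_ae(1)[of UNIV f g] assms by (simp add: set_lebesgue_integral_def)

lemma affine_fun_unique_on_vertices:
  fixes C :: "'a::euclidean_space set"
  assumes "\<not> affine_dependent C" "card C = Suc DIM('a)" "affine_fun l"
  shows "l x = (\<Sum>a\<in>C. l a * bary C a x)"
  using bary_expand[OF assms(1,3), of x] affine_independent_span_eq[OF assms(1,2)] by simp

text \<open>A full-dimensional closed simplex is the closure of its interior, and its vertices are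
  its extreme points, so an open simplex determines both.\<close>

lemma open_simplex_structure:
  fixes \<tau> :: "'a::euclidean_space set"
  assumes "open_simplex \<tau>"
  shows "\<not> affine_dependent (simplex_vertices \<tau>)" "card (simplex_vertices \<tau>) = Suc DIM('a)"
    "closure \<tau> = convex hull (simplex_vertices \<tau>)" "open \<tau>" "convex \<tau>"
proof -
  obtain S where S: "int DIM('a) simplex S" "\<tau> = interior S" using assms by (auto simp: open_simplex_def)
  then obtain C where C: "\<not> affine_dependent C" "card C = Suc DIM('a)" "S = convex hull C"
    unfolding simplex_def by auto
  have fin: "finite C" using C(1) aff_independent_finite by blast
  have "interior S \<noteq> {}" using interior_convex_hull_eq_empty[OF C(2)] C by simp
  then have "closure \<tau> = closure S" unfolding S(2) C(3) by (intro convex_closure_interior convex_convex_hull)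
  also have "\<dots> = S" unfolding C(3) using finite_imp_compact_convex_hull[OF fin] by (simp add: compact_imp_closed)
  finally have cl: "closure \<tau> = convex hull C" using C(3) by simp
  have sv: "simplex_vertices \<tau> = C"
    unfolding simplex_vertices_def cl using extreme_point_of_convex_hull_affine_independent[OF C(1)] by simp
  show "\<not> affine_dependent (simplex_vertices \<tau>)" "card (simplex_vertices \<tau>) = Suc DIM('a)"
    "closure \<tau> = convex hull (simplex_vertices \<tau>)" using C cl by (auto simp: sv)
  show "open \<tau>" "convex \<tau>" using S(2) C(3) convex_interior[OF convex_convex_hull] by auto
qed

section \<open>Hat functions on a triangulated convex domain\<close>

locale mesh =
  fixes \<Omega> :: "'a::euclidean_space set" and T :: "'a set set"
  assumes bounded_dom: "bounded \<Omega>" and open_dom: "open \<Omega>" and convex_dom: "convex \<Omega>"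
    and triangulation: "triangulation_of \<Omega> T"
begin

abbreviation verts :: "'a set \<Rightarrow> 'a set" where "verts \<equiv> simplex_vertices"

text \<open>The value 0 for points that are not vertices of \<tau> lets sums over all nodes be
  restricted to the vertices of one simplex.\<close>

definition coord :: "'a set \<Rightarrow> 'a \<Rightarrow> 'a \<Rightarrow> real" where
  "coord \<tau> a x = (if a \<in> verts \<tau> then bary (verts \<tau>) a x else 0)"

text \<open>The choice of the simplex is immaterial by \<open>coord_consistent\<close>; the
  extension by zero is what the Lipschitz criterion for \<open>H10\<close> asks for.\<close>

definition hat :: "'a \<Rightarrow> 'a \<Rightarrow> real" where
  "hat a x = (if x \<in> closure \<Omega> then coord (SOME \<tau>. \<tau> \<in> T \<and> x \<in> closure \<tau>) a x else 0)"

abbreviation nodal :: "'a \<Rightarrow> 'a \<Rightarrow> real" where "nodal \<equiv> nodal_basis_fun \<Omega> T"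

abbreviation nodes :: "'a set" where "nodes \<equiv> interior_vertices \<Omega> T"

lemma finite_T: "finite T" and disjoint_T: "pairwise disjnt T" and cover: "\<Union>(closure ` T) = closure \<Omega>"
  and simplex_T: "\<tau> \<in> T \<Longrightarrow> open_simplex \<tau>"
  using triangulation by (auto simp: triangulation_of_def)

lemmas simplex_facts = open_simplex_structure[OF simplex_T]

lemma finite_verts: "\<tau> \<in> T \<Longrightarrow> finite (verts \<tau>)"
  using simplex_facts(1) aff_independent_finite by blast

lemma finite_nodes: "finite nodes"
  unfolding interior_vertices_def mesh_vertices_def using finite_T finite_verts by auto

lemma closure_subset_dom: "\<tau> \<in> T \<Longrightarrow> closure \<tau> \<subseteq> closure \<Omega>"
  using cover by blast

lemma interior_closure_dom: "interior (closure \<Omega>) = \<Omega>"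
  using convex_interior_closure[OF convex_dom] open_dom by (simp add: interior_open)

lemma subset_dom: "\<tau> \<in> T \<Longrightarrow> \<tau> \<subseteq> \<Omega>"
  using interior_maximal[of \<tau> "closure \<Omega>"] closure_subset_dom closure_subset simplex_facts(4) interior_closure_dom by blast

lemma vert_in_closure: "\<tau> \<in> T \<Longrightarrow> a \<in> verts \<tau> \<Longrightarrow> a \<in> closure \<tau>"
  using simplex_facts(3) hull_inc by metis

lemma skeleton_null: "AE x in lebesgue. \<forall>\<tau>\<in>T. x \<notin> frontier \<tau>"
proof -
  have "AE x in lebesgue. x \<notin> frontier \<tau>" if "\<tau> \<in> T" for \<tau>
    using AE_not_in[of "frontier \<tau>" lebesgue] negligible_convex_frontier[OF simplex_facts(5)[OF that]]
    by (simp add: negligible_iff_null_sets)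
  then have "\<forall>\<tau>\<in>T. AE x in lebesgue. x \<notin> frontier \<tau>" ..
  then show ?thesis unfolding AE_ball_countable[OF countable_finite[OF finite_T]] .
qed

lemma in_simplex: "\<tau> \<in> T \<Longrightarrow> x \<in> closure \<tau> \<Longrightarrow> x \<notin> frontier \<tau> \<Longrightarrow> x \<in> \<tau>"
  using simplex_facts(4) by (auto simp: frontier_def interior_open)

lemma uncovered_null: "\<Omega> - \<Union>T \<in> null_sets lebesgue"
proof -
  have "\<Omega> - \<Union>T \<subseteq> (\<Union>\<tau>\<in>T. frontier \<tau>)"
    using cover closure_subset[of \<Omega>] in_simplex by blast
  moreover have "negligible (\<Union>\<tau>\<in>T. frontier \<tau>)"
    using finite_T negligible_convex_frontier[OF simplex_facts(5)] by (intro negligible_Union) auto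
  ultimately show ?thesis using negligible_subset negligible_iff_null_sets by blast
qed

lemma affine_coord: "\<tau> \<in> T \<Longrightarrow> affine_fun (coord \<tau> a)"
proof (cases "a \<in> verts \<tau>")
  case True
  assume "\<tau> \<in> T"
  then show ?thesis using bary_props(1)[OF simplex_facts(1) True] True by (simp add: coord_def[abs_def])
next
  case False
  then show ?thesis by (auto simp: coord_def[abs_def] affine_fun_def intro: exI[of _ 0])
qed

lemma coord_gradients:
  obtains p c where "\<And>\<tau> x. \<tau> \<in> T \<Longrightarrow> coord \<tau> a x = p \<tau> \<bullet> x + c \<tau>"
proof -
  have "\<forall>\<tau>\<in>T. \<exists>q. \<forall>x. coord \<tau> a x = fst q \<bullet> x + snd q"
    using affine_coord[of _ a] unfolding affine_fun_def by (metis fst_conv snd_conv)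
  from bchoice[OF this] obtain q where "\<And>\<tau> x. \<tau> \<in> T \<Longrightarrow> coord \<tau> a x = fst (q \<tau>) \<bullet> x + snd (q \<tau>)"
    by blast
  then show ?thesis by (rule that)
qed

lemma coord_vertex: "\<tau> \<in> T \<Longrightarrow> b \<in> verts \<tau> \<Longrightarrow> coord \<tau> a b = (if a = b then 1 else 0)"
  using bary_props(2,3)[OF simplex_facts(1)] by (auto simp: coord_def)

lemma affine_expand:
  assumes "\<tau> \<in> T" "affine_fun l"
  shows "l x = (\<Sum>a\<in>verts \<tau>. l a * coord \<tau> a x)"
  using affine_fun_unique_on_vertices[OF simplex_facts(1,2)[OF assms(1)] assms(2), of x] by (simp add: coord_def)

text \<open>By conformity two closed simplices meet in the hull of their common vertices.\<close>

lemma coord_consistent: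
  assumes \<tau>: "\<tau> \<in> T" "x \<in> closure \<tau>" and \<tau>': "\<tau>' \<in> T" "x \<in> closure \<tau>'"
  shows "coord \<tau> a x = coord \<tau>' a x"
proof -
  let ?F = "closure \<tau> \<inter> closure \<tau>'"
  have tri: "triangulation (closure ` T)" using triangulation by (simp add: triangulation_of_def)
  have "?F face_of closure \<tau>" "?F face_of closure \<tau>'"
    using tri \<tau>(1) \<tau>'(1) unfolding triangulation_def by (blast, metis Int_commute image_eqI)
  then obtain c c' where c: "c \<subseteq> verts \<tau>" "?F = convex hull c" and c': "c' \<subseteq> verts \<tau>'" "?F = convex hull c'"
    using face_of_convex_hull_affine_independent simplex_facts(1,3) \<tau>(1) \<tau>'(1) by metis
  have "\<not> affine_dependent c" "\<not> affine_dependent c'"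
    using simplex_facts(1) \<tau>(1) \<tau>'(1) c(1) c'(1) affine_dependent_subset by blast+
  then have "c = c'"
    using extreme_point_of_convex_hull_affine_independent c(2) c'(2) by (metis subsetI subset_antisym)
  show ?thesis
  proof (rule affine_fun_eq_hull[OF affine_coord[OF \<tau>(1)] affine_coord[OF \<tau>'(1)]])
    show "coord \<tau> a b = coord \<tau>' a b" if "b \<in> c" for b
      using coord_vertex[OF \<tau>(1), of b a] coord_vertex[OF \<tau>'(1), of b a] c(1) c'(1) that
      unfolding \<open>c = c'\<close> by (simp add: subset_iff)
    have "x \<in> convex hull c" using \<tau>(2) \<tau>'(2) c(2) by blast
    then show "x \<in> affine hull c" using convex_hull_subset_affine_hull by blast
  qed
qed

lemma hat_eq:
  assumes "\<tau> \<in> T" "x \<in> closure \<tau>"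
  shows "hat a x = coord \<tau> a x"
proof -
  have "\<exists>\<tau>. \<tau> \<in> T \<and> x \<in> closure \<tau>" using assms by blast
  from someI_ex[OF this] have "coord (SOME \<tau>. \<tau> \<in> T \<and> x \<in> closure \<tau>) a x = coord \<tau> a x"
    using coord_consistent assms by blast
  then show ?thesis using assms closure_subset_dom by (auto simp: hat_def)
qed

text \<open>If the coordinate of the interior vertex a were positive at x, the segment from a to x
  could be prolonged within the closed simplex, and convexity would make x an interior
  point.\<close>

lemma hat_outside:
  assumes a: "a \<in> \<Omega>" and x: "x \<notin> \<Omega>"
  shows "hat a x = 0"
proof (cases "x \<in> closure \<Omega>")
  case True
  then obtain \<tau> where \<tau>: "\<tau> \<in> T" "x \<in> closure \<tau>" using cover by blast
  have "coord \<tau> a x = 0"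
  proof (rule ccontr)
    assume nz: "coord \<tau> a x \<noteq> 0"
    define C where "C = verts \<tau>"
    have C: "\<not> affine_dependent C" "affine hull C = UNIV" "closure \<tau> = convex hull C"
      using simplex_facts(1,3)[OF \<tau>(1)] affine_independent_span_eq[OF simplex_facts(1,2)[OF \<tau>(1)]] by (auto simp: C_def)
    have hull: "z \<in> closure \<tau> \<longleftrightarrow> (\<forall>b\<in>C. 0 \<le> bary C b z)" for z
      using convex_hull_bary[OF C(1)] C by simp
    from nz have aC: "a \<in> C" "bary C a x \<noteq> 0" by (auto simp: coord_def C_def split: if_splits)
    define t where "t = bary C a x"
    have t: "t > 0" using aC hull[of x] \<tau>(2) by (force simp: t_def)
    have fin: "finite C" using C(1) aff_independent_finite by blast
    have t1: "t \<le> 1"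
      using member_le_sum[of a C "\<lambda>b. bary C b x"] aC fin hull[of x] \<tau>(2) bary_sum(1)[OF C(1), of x] C(2) by (simp add: t_def)
    \<comment> \<open>With t the a-coordinate of x, the point y has a-coordinate t^2, and its other
      coordinates are those of x times 1 + t; hence it stays in the closed simplex.\<close>
    define y where "y = x + t *\<^sub>R (x - a)"
    have "0 \<le> bary C b y" if b: "b \<in> C" for b
    proof -
      obtain p r where pr: "\<And>z. bary C b z = p \<bullet> z + r" using bary_props(1)[OF C(1) b] by (auto simp: affine_fun_def)
      have e: "bary C b y = bary C b x + t * (bary C b x - bary C b a)"
        by (simp add: pr y_def inner_add_right inner_diff_right)
      have nn: "0 \<le> bary C b x" using hull \<tau>(2) b by blast
      show ?thesis
      proof (cases "b = a")
        case True
        then have "bary C b y = t * (1 + t - 1)" using e bary_props(2)[OF C(1) aC(1)] by (simp add: t_def algebra_simps)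
        then show ?thesis using t by simp
      next
        case False
        then show ?thesis using e bary_props(3)[OF C(1) b aC(1)] nn t by simp
      qed
    qed
    then have "y \<in> closure \<Omega>" using hull closure_subset_dom[OF \<tau>(1)] by blast
    \<comment> \<open>This point is x, seen as a proper convex combination of the interior point a
      and the point y of the closure.\<close>
    then have "y - (t / (1 + t)) *\<^sub>R (y - a) \<in> interior \<Omega>"
      using a open_dom t by (intro mem_interior_closure_convex_shrink[OF convex_dom]) (auto simp: interior_open)
    moreover have "y - a = (1 + t) *\<^sub>R (x - a)" by (simp add: y_def algebra_simps)
    then have "(t / (1 + t)) *\<^sub>R (y - a) = t *\<^sub>R (x - a)" using t by simp
    then have "y - (t / (1 + t)) *\<^sub>R (y - a) = x" by (simp add: y_def)
    ultimately show False using x interior_subset by auto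
  qed
  then show ?thesis using hat_eq[OF \<tau>] by simp
qed (simp add: hat_def)

text \<open>A segment is covered by finitely many closed pieces, the closed simplices and the
  complement of \<Omega>, with the same constant on each. Lipschitz bounds on closed pieces of an
  interval glue, so the function is pulled back to the segment.\<close>

lemma hat_lipschitz:
  assumes a: "a \<in> \<Omega>"
  shows "\<exists>L. \<forall>x y. \<bar>hat a x - hat a y\<bar> \<le> L * norm (x - y)"
proof -
  obtain p c where pc: "\<And>\<tau> x. \<tau> \<in> T \<Longrightarrow> coord \<tau> a x = p \<tau> \<bullet> x + c \<tau>"
    by (rule coord_gradients[of a]) blast
  define L where "L = (\<Sum>\<tau>\<in>T. norm (p \<tau>))"
  have L0: "L \<ge> 0" by (simp add: L_def sum_nonneg)
  have piece: "\<bar>hat a x - hat a y\<bar> \<le> L * norm (x - y)" if "\<tau> \<in> T" "x \<in> closure \<tau>" "y \<in> closure \<tau>" for \<tau> x y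
  proof -
    have "hat a x - hat a y = p \<tau> \<bullet> (x - y)" using that by (simp add: hat_eq pc inner_diff_right)
    also have "\<bar>\<dots>\<bar> \<le> norm (p \<tau>) * norm (x - y)" by (rule Cauchy_Schwarz_ineq2)
    also have "\<dots> \<le> L * norm (x - y)" unfolding L_def
      using that finite_T by (intro mult_right_mono member_le_sum) auto
    finally show ?thesis .
  qed
  have "\<bar>hat a x - hat a y\<bar> \<le> L * norm (x - y)" for x y
  proof -
    define l where "l = (\<lambda>s::real. x + s *\<^sub>R (y - x))"
    have lc: "continuous_on UNIV l" unfolding l_def by (intro continuous_intros)
    define I where "I = insert (- \<Omega>) (closure ` T)"
    have diff: "norm (l s - l r) = \<bar>s - r\<bar> * norm (x - y)" for s r
    proof -
      have "l s - l r = (s - r) *\<^sub>R (y - x)" by (simp add: l_def algebra_simps)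
      then show ?thesis by (simp add: norm_minus_commute)
    qed
    have "(L * norm (x - y))-lipschitz_on {0..1} (\<lambda>s. hat a (l s))"
    proof (rule lipschitz_on_closed_Union[where I=I and U="\<lambda>K. l -` K"])
      show "finite I" using finite_T by (simp add: I_def)
      show "0 \<le> L * norm (x - y)" using L0 by simp
      show "closed (l -` K)" if "K \<in> I" for K
        using that open_dom lc by (intro closed_vimage) (auto simp: I_def)
      have "closure \<Omega> \<union> - \<Omega> = UNIV" using closure_subset by blast
      then have "\<Union>I = UNIV" using cover by (auto simp: I_def)
      then show "{0..1} \<subseteq> (\<Union>K\<in>I. l -` K)" by blast
      fix K assume K: "K \<in> I"
      show "(L * norm (x - y))-lipschitz_on (l -` K) (\<lambda>s. hat a (l s))"
      proof (rule lipschitz_onI)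
        fix s r assume sr: "s \<in> l -` K" "r \<in> l -` K"
        have "\<bar>hat a (l s) - hat a (l r)\<bar> \<le> L * norm (l s - l r)"
        proof (cases "K = - \<Omega>")
          case True
          then show ?thesis using sr hat_outside[OF a] L0 by simp
        next
          case False
          then obtain \<tau> where "\<tau> \<in> T" "K = closure \<tau>" using K by (auto simp: I_def)
          then show ?thesis using piece sr by auto
        qed
        then show "dist (hat a (l s)) (hat a (l r)) \<le> L * norm (x - y) * dist s r"
          by (simp add: diff dist_real_def mult_ac)
      qed (use L0 in simp)
    qed
    from lipschitz_onD[OF this, of 0 1] show ?thesis by (simp add: l_def dist_real_def)
  qed
  then show ?thesis by blast
qed

lemma hat_fe:
  assumes a: "a \<in> \<Omega>"
  shows "hat a \<in> fe_space \<Omega> T" "continuous_on UNIV (hat a)"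
proof -
  obtain L where L: "\<And>x y. \<bar>hat a x - hat a y\<bar> \<le> L * norm (x - y)" using hat_lipschitz[OF a] by blast
  obtain p c where pc: "\<And>\<tau> x. \<tau> \<in> T \<Longrightarrow> coord \<tau> a x = p \<tau> \<bullet> x + c \<tau>"
    by (rule coord_gradients[of a]) blast
  have aff: "hat a x = p \<tau> \<bullet> x + c \<tau>" if "\<tau> \<in> T" "x \<in> \<tau>" for \<tau> x
    using hat_eq[OF that(1), of x a] closure_subset[of \<tau>] that pc by auto
  have "hat a \<in> H10 \<Omega>"
    by (rule lipschitz_piecewise_affine_H10[OF bounded_dom open_dom convex_dom L hat_outside[OF a] finite_T
          simplex_facts(4) disjoint_T uncovered_null aff])
  then show "hat a \<in> fe_space \<Omega> T" unfolding fe_space_def using aff by blast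
  have "\<bar>L\<bar>-lipschitz_on UNIV (hat a)"
  proof (rule lipschitz_onI)
    fix x y show "dist (hat a x) (hat a y) \<le> \<bar>L\<bar> * dist x y"
      using L[of x y] mult_right_mono[OF abs_ge_self[of L], of "norm (x - y)"] by (simp add: dist_norm)
  qed simp
  then show "continuous_on UNIV (hat a)" by (rule lipschitz_on_continuous_on)
qed

section \<open>Nodal basis functions and nodal coefficients\<close>

lemma nodal_spec:
  assumes a: "a \<in> nodes"
  shows "nodal a \<in> fe_space \<Omega> T" "continuous_on (closure \<Omega>) (nodal a)" "nodal a a = 1"
    "b \<in> mesh_vertices T - {a} \<Longrightarrow> nodal a b = 0"
proof -
  have a\<Omega>: "a \<in> \<Omega>" and "a \<in> mesh_vertices T" using a by (auto simp: interior_vertices_def)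
  have val: "hat a b = (if b = a then 1 else 0)" if b: "b \<in> mesh_vertices T" for b
  proof -
    obtain \<tau> where "\<tau> \<in> T" "b \<in> verts \<tau>" using b by (auto simp: mesh_vertices_def)
    then show ?thesis using hat_eq vert_in_closure coord_vertex by auto
  qed
  have "\<exists>\<phi>. \<phi> \<in> fe_space \<Omega> T \<and> continuous_on (closure \<Omega>) \<phi> \<and> \<phi> a = 1 \<and> (\<forall>b\<in>mesh_vertices T - {a}. \<phi> b = 0)"
    using hat_fe[OF a\<Omega>] continuous_on_subset val \<open>a \<in> mesh_vertices T\<close> by (intro exI[of _ "hat a"]) auto
  from someI_ex[OF this] show "nodal a \<in> fe_space \<Omega> T" "continuous_on (closure \<Omega>) (nodal a)" "nodal a a = 1"
    "b \<in> mesh_vertices T - {a} \<Longrightarrow> nodal a b = 0"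
    unfolding nodal_basis_fun_def[symmetric] by auto
qed

text \<open>The function chosen by \<open>nodal_basis_fun\<close> is continuous on the closed
  domain, so its affine formula persists up to the vertices, whose values determine it on the
  simplex.\<close>

lemma nodal_on_simplex:
  assumes a: "a \<in> nodes" and \<tau>: "\<tau> \<in> T" and x: "x \<in> \<tau>"
  shows "nodal a x = coord \<tau> a x"
proof -
  obtain p c where pc: "\<And>x. x \<in> \<tau> \<Longrightarrow> nodal a x = p \<bullet> x + c"
    using nodal_spec(1)[OF a] \<tau> unfolding fe_space_def by blast
  have "nodal a b = p \<bullet> b + c" if b: "b \<in> closure \<tau>" for b
  proof -
    have "continuous_on (closure \<tau>) (\<lambda>x. nodal a x - (p \<bullet> x + c))"
      by (intro continuous_intros continuous_on_subset[OF nodal_spec(2)[OF a] closure_subset_dom[OF \<tau>]])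
    from continuous_constant_on_closure[OF this, of 0 b] show ?thesis using pc b by simp
  qed
  then have vals: "p \<bullet> b + c = (if b = a then 1 else 0)" if "b \<in> verts \<tau>" for b
    using that nodal_spec(3)[OF a] nodal_spec(4)[OF a, of b] vert_in_closure[OF \<tau> that] \<tau>
    by (force simp: mesh_vertices_def)
  have "affine_fun (\<lambda>x. p \<bullet> x + c)" by (auto simp: affine_fun_def)
  from affine_expand[OF \<tau> this, of x]
  have "p \<bullet> x + c = (\<Sum>b\<in>verts \<tau>. if b = a then coord \<tau> a x else 0)"
    using vals by (simp add: if_distrib cong: sum.cong if_cong) (auto intro!: sum.cong)
  also have "\<dots> = coord \<tau> a x" using finite_verts[OF \<tau>] by (simp add: coord_def)
  finally show ?thesis using pc[OF x] by simp
qed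

text \<open>A node that is not a vertex of \<tau> has coordinate 0 there, and a vertex of \<tau>
  that is not a node lies on the boundary and gets coefficient 0.\<close>

lemma fe_on_simplex:
  assumes \<tau>: "\<tau> \<in> T" and x: "x \<in> \<tau>"
  shows "(\<Sum>a\<in>nodes. u a * nodal a x) = (\<Sum>a\<in>verts \<tau>. (if a \<in> \<Omega> then u a else 0) * coord \<tau> a x)"
proof -
  have "(\<Sum>a\<in>nodes. u a * nodal a x) = (\<Sum>a\<in>nodes. (if a \<in> \<Omega> then u a else 0) * coord \<tau> a x)"
    using nodal_on_simplex[OF _ \<tau> x] by (intro sum.cong) (auto simp: interior_vertices_def)
  also have "\<dots> = (\<Sum>a\<in>verts \<tau>. (if a \<in> \<Omega> then u a else 0) * coord \<tau> a x)"
    using \<tau> by (intro sum.mono_neutral_cong finite_nodes finite_verts)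
               (auto simp: coord_def interior_vertices_def mesh_vertices_def)
  finally show ?thesis .
qed

text \<open>The coefficients are vertex values of the affine pieces \<open>A \<tau>\<close>, not of
  v, whose values on the skeleton are arbitrary. Sequences from the open simplices carry the
  Lipschitz bounds to the vertices.\<close>

lemma fe_representation:
  assumes v: "v \<in> fe_space \<Omega> T"
  shows "\<exists>u. \<forall>\<tau>\<in>T. \<forall>x\<in>\<tau>. v x = (\<Sum>a\<in>nodes. u a * nodal a x)"
proof -
  have vH: "v \<in> H10 \<Omega>" and "\<forall>\<tau>\<in>T. \<exists>p c. \<forall>x\<in>\<tau>. v x = p \<bullet> x + c" using v by (auto simp: fe_space_def)
  then obtain p c where pc: "\<And>\<tau> x. \<tau> \<in> T \<Longrightarrow> x \<in> \<tau> \<Longrightarrow> v x = p \<tau> \<bullet> x + c \<tau>" by metis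
  define A where "A = (\<lambda>\<tau> x. p \<tau> \<bullet> x + c \<tau>)"
  have "\<exists>L\<ge>0. (\<forall>x\<in>\<Union>T. \<forall>y\<in>\<Union>T. \<bar>v x - v y\<bar> \<le> L * norm (x - y)) \<and>
                (\<forall>x\<in>\<Union>T. \<forall>y. y \<notin> closure \<Omega> \<longrightarrow> \<bar>v x\<bar> \<le> L * norm (x - y))"
    by (rule H10_piecewise_affine_lipschitz[OF bounded_dom open_dom vH finite_T _ uncovered_null])
       (use simplex_facts(4) subset_dom pc in auto)
  then obtain L where L: "\<And>x y. x \<in> \<Union>T \<Longrightarrow> y \<in> \<Union>T \<Longrightarrow> \<bar>v x - v y\<bar> \<le> L * norm (x - y)"
    "\<And>x y. x \<in> \<Union>T \<Longrightarrow> y \<notin> closure \<Omega> \<Longrightarrow> \<bar>v x\<bar> \<le> L * norm (x - y)"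
    by blast
  have Alim: "(\<lambda>n. A \<tau> (X n)) \<longlonglongrightarrow> A \<tau> a" if "X \<longlonglongrightarrow> a" for \<tau> X a
    unfolding A_def by (intro tendsto_intros that)
  have consistent: "A \<tau> a = A \<tau>' a" if \<tau>: "\<tau> \<in> T" "a \<in> closure \<tau>" and \<tau>': "\<tau>' \<in> T" "a \<in> closure \<tau>'" for a \<tau> \<tau>'
  proof -
    obtain X Y where X: "\<And>n. X n \<in> \<tau>" "X \<longlonglongrightarrow> a" and Y: "\<And>n. Y n \<in> \<tau>'" "Y \<longlonglongrightarrow> a"
      using \<tau>(2) \<tau>'(2) unfolding closure_sequential by metis
    have "\<bar>A \<tau> (X n) - A \<tau>' (Y n)\<bar> \<le> L * norm (X n - Y n)" for n
      using L(1)[of "X n" "Y n"] X(1)[of n] Y(1)[of n] \<tau>(1) \<tau>'(1) pc unfolding A_def by auto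
    moreover have "(\<lambda>n. \<bar>A \<tau> (X n) - A \<tau>' (Y n)\<bar>) \<longlonglongrightarrow> \<bar>A \<tau> a - A \<tau>' a\<bar>"
      by (intro tendsto_intros Alim X Y)
    moreover have "(\<lambda>n. L * norm (X n - Y n)) \<longlonglongrightarrow> L * norm (a - a)"
      by (intro tendsto_intros X Y)
    ultimately have "\<bar>A \<tau> a - A \<tau>' a\<bar> \<le> L * norm (a - a)" by (intro LIMSEQ_le) auto
    then show ?thesis by simp
  qed
  have boundary: "A \<tau> a = 0" if \<tau>: "\<tau> \<in> T" "a \<in> closure \<tau>" and a: "a \<notin> \<Omega>" for a \<tau>
  proof -
    \<comment> \<open>A convex open set is the interior of its closure, so a boundary point is a
      limit of points outside the closed domain, where the extension of v is zero.\<close>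
    have "a \<in> closure (- closure \<Omega>)"
      using a interior_closure_dom by (metis ComplI double_complement interior_closure)
    then obtain X Y where X: "\<And>n. X n \<in> \<tau>" "X \<longlonglongrightarrow> a" and Y: "\<And>n. Y n \<in> - closure \<Omega>" "Y \<longlonglongrightarrow> a"
      using \<tau>(2) unfolding closure_sequential by metis
    have "\<bar>A \<tau> (X n)\<bar> \<le> L * norm (X n - Y n)" for n
      using L(2)[of "X n" "Y n"] X(1)[of n] Y(1)[of n] \<tau>(1) pc unfolding A_def by auto
    moreover have "(\<lambda>n. \<bar>A \<tau> (X n)\<bar>) \<longlonglongrightarrow> \<bar>A \<tau> a\<bar>"
      by (intro tendsto_intros Alim X)
    moreover have "(\<lambda>n. L * norm (X n - Y n)) \<longlonglongrightarrow> L * norm (a - a)"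
      by (intro tendsto_intros X Y)
    ultimately have "\<bar>A \<tau> a\<bar> \<le> L * norm (a - a)" by (intro LIMSEQ_le) auto
    then show ?thesis by simp
  qed
  define u where "u = (\<lambda>a. A (SOME \<tau>. \<tau> \<in> T \<and> a \<in> verts \<tau>) a)"
  have u: "u a = A \<tau> a" if "\<tau> \<in> T" "a \<in> verts \<tau>" for a \<tau>
  proof -
    have "\<exists>\<tau>. \<tau> \<in> T \<and> a \<in> verts \<tau>" using that by blast
    from someI_ex[OF this] show ?thesis unfolding u_def
      using consistent vert_in_closure that by blast
  qed
  have "v x = (\<Sum>a\<in>nodes. u a * nodal a x)" if "\<tau> \<in> T" "x \<in> \<tau>" for \<tau> x
  proof -
    have "affine_fun (A \<tau>)" by (auto simp: affine_fun_def A_def)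
    have "v x = A \<tau> x" using pc[OF that] by (simp add: A_def)
    also have "\<dots> = (\<Sum>a\<in>verts \<tau>. A \<tau> a * coord \<tau> a x)" by (rule affine_expand[OF that(1) \<open>affine_fun (A \<tau>)\<close>])
    also have "\<dots> = (\<Sum>a\<in>verts \<tau>. (if a \<in> \<Omega> then u a else 0) * coord \<tau> a x)"
      using u[OF that(1)] boundary[OF that(1) vert_in_closure[OF that(1)]] by (intro sum.cong) auto
    finally show ?thesis using fe_on_simplex[OF that] by simp
  qed
  then show ?thesis by blast
qed

section \<open>Assembly of the element bounds\<close>

lemma integral_over_simplices:
  fixes F :: "'a \<Rightarrow> real"
  assumes eq: "\<And>\<tau> x. \<tau> \<in> T \<Longrightarrow> x \<in> \<tau> \<Longrightarrow> F x = F' \<tau> x" and cont: "\<And>\<tau>. \<tau> \<in> T \<Longrightarrow> continuous_on UNIV (F' \<tau>)"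
  shows "(LINT x:\<Omega>|lebesgue. F x) = (\<Sum>\<tau>\<in>T. LINT x|lborel. indicat_real (convex hull (verts \<tau>)) x * F' \<tau> x)"
proof -
  have comp: "compact (convex hull (verts \<tau>))" if "\<tau> \<in> T" for \<tau>
    using finite_imp_compact_convex_hull[OF finite_verts[OF that]] .
  have i: "integrable lborel (\<lambda>x. indicat_real (convex hull (verts \<tau>)) x * F' \<tau> x)" if "\<tau> \<in> T" for \<tau>
    using borel_integrable_compact[OF comp[OF that] continuous_on_subset[OF cont[OF that]]] by simp
  have "(LINT x:\<Omega>|lebesgue. F x) = (LINT x|lebesgue. (\<Sum>\<tau>\<in>T. indicat_real (convex hull (verts \<tau>)) x * F' \<tau> x))"
    unfolding set_lebesgue_integral_def real_scaleR_def
  proof (rule integral_cong_lebesgue_ae)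
    show "AE x in lebesgue. indicat_real \<Omega> x * F x = (\<Sum>\<tau>\<in>T. indicat_real (convex hull (verts \<tau>)) x * F' \<tau> x)"
      using skeleton_null AE_not_in[OF uncovered_null]
    proof eventually_elim
      case (elim x)
      have "indicat_real (convex hull (verts \<tau>)) x = indicat_real \<tau> x" if "\<tau> \<in> T" for \<tau>
        using in_simplex[OF that, of x] elim(1) that closure_subset[of \<tau>] simplex_facts(3)[OF that]
        by (auto simp: indicator_def)
      then have r: "(\<Sum>\<tau>\<in>T. indicat_real (convex hull (verts \<tau>)) x * F' \<tau> x) = (\<Sum>\<tau>\<in>T. indicat_real \<tau> x * F' \<tau> x)"
        by (intro sum.cong) auto
      show ?case
      proof (cases "x \<in> \<Omega>")
        case True
        then obtain \<tau> where \<tau>: "\<tau> \<in> T" "x \<in> \<tau>" using elim by blast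
        have "(\<Sum>\<tau>'\<in>T. indicat_real \<tau>' x * F' \<tau>' x) = (\<Sum>\<tau>'\<in>T. if \<tau>' = \<tau> then F' \<tau> x else 0)"
        proof (intro sum.cong refl)
          fix \<tau>' assume "\<tau>' \<in> T"
          then show "indicat_real \<tau>' x * F' \<tau>' x = (if \<tau>' = \<tau> then F' \<tau> x else 0)"
            using disjoint_T \<tau> by (auto simp: pairwise_def disjnt_def indicator_def)
        qed
        then show ?thesis using r \<tau> finite_T True eq[OF \<tau>] by simp
      next
        case False
        then have "indicat_real \<tau> x = 0" if "\<tau> \<in> T" for \<tau> using subset_dom[OF that] by (auto simp: indicator_def)
        then show ?thesis using r False by simp
      qed
    qed
  qed
  also have "\<dots> = (LINT x|lborel. (\<Sum>\<tau>\<in>T. indicat_real (convex hull (verts \<tau>)) x * F' \<tau> x))"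
    using i by (intro integral_completion) (auto intro!: borel_measurable_sum)
  also have "\<dots> = (\<Sum>\<tau>\<in>T. LINT x|lborel. indicat_real (convex hull (verts \<tau>)) x * F' \<tau> x)"
    using i by (rule Bochner_Integration.integral_sum)
  finally show ?thesis .
qed

text \<open>With the coefficients set to zero off \<Omega>, both the mass form and its diagonal are
  sums over simplices of full element expressions, boundary vertices included. So the element
  inequalities simply add up.\<close>

lemma mass_bounds:
  fixes u :: "'a \<Rightarrow> real"
  defines "f \<equiv> (\<lambda>x. \<Sum>a\<in>nodes. u a * nodal a x)"
  shows "1/2 * (\<Sum>a\<in>nodes. (u a)\<^sup>2 * l2_inner \<Omega> (nodal a) (nodal a)) \<le> l2_inner \<Omega> f f"
    and "l2_inner \<Omega> f f \<le> (real DIM('a) + 2) / 2 * (\<Sum>a\<in>nodes. (u a)\<^sup>2 * l2_inner \<Omega> (nodal a) (nodal a))"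
proof -
  define M where "M = (\<lambda>\<tau> F. LINT x|lborel. indicat_real (convex hull (verts \<tau>)) x * (F x :: real))"
  define u' where "u' = (\<lambda>a. if a \<in> \<Omega> then u a else 0)"
  have cc: "continuous_on UNIV (coord \<tau> a)" if "\<tau> \<in> T" for \<tau> a
    using affine_fun_continuous[OF affine_coord[OF that]] .
  have bb: "continuous_on UNIV (bary (verts \<tau>) a)" if "\<tau> \<in> T" "a \<in> verts \<tau>" for \<tau> a
    using cc[OF that(1), of a] that by (simp add: coord_def[abs_def])
  have ff: "l2_inner \<Omega> f f = (\<Sum>\<tau>\<in>T. M \<tau> (\<lambda>x. (\<Sum>a\<in>verts \<tau>. u' a * bary (verts \<tau>) a x)\<^sup>2))"
    unfolding l2_inner_def M_def
  proof (rule integral_over_simplices)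
    fix \<tau> x assume \<tau>: "\<tau> \<in> T" "x \<in> \<tau>"
    have "f x = (\<Sum>a\<in>verts \<tau>. u' a * bary (verts \<tau>) a x)"
      unfolding f_def fe_on_simplex[OF \<tau>] u'_def by (intro sum.cong) (auto simp: coord_def)
    then show "f x * f x = (\<Sum>a\<in>verts \<tau>. u' a * bary (verts \<tau>) a x)\<^sup>2" by (simp add: power2_eq_square)
  qed (intro continuous_intros bb)
  have aa: "l2_inner \<Omega> (nodal a) (nodal a) = (\<Sum>\<tau>\<in>T. M \<tau> (\<lambda>x. (coord \<tau> a x)\<^sup>2))" if a: "a \<in> nodes" for a
    unfolding l2_inner_def M_def
  proof (rule integral_over_simplices)
    show "nodal a x * nodal a x = (coord \<tau> a x)\<^sup>2" if "\<tau> \<in> T" "x \<in> \<tau>" for \<tau> x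
      using nodal_on_simplex[OF a that] by (simp add: power2_eq_square)
  qed (intro continuous_intros cc)
  have "(\<Sum>a\<in>nodes. (u a)\<^sup>2 * l2_inner \<Omega> (nodal a) (nodal a)) = (\<Sum>\<tau>\<in>T. \<Sum>a\<in>nodes. (u a)\<^sup>2 * M \<tau> (\<lambda>x. (coord \<tau> a x)\<^sup>2))"
    by (subst sum.swap) (simp add: aa sum_distrib_left)
  also have "\<dots> = (\<Sum>\<tau>\<in>T. \<Sum>a\<in>verts \<tau>. (u' a)\<^sup>2 * M \<tau> (\<lambda>x. (bary (verts \<tau>) a x)\<^sup>2))"
  proof (rule sum.cong[OF refl])
    fix \<tau> assume \<tau>: "\<tau> \<in> T"
    show "(\<Sum>a\<in>nodes. (u a)\<^sup>2 * M \<tau> (\<lambda>x. (coord \<tau> a x)\<^sup>2)) = (\<Sum>a\<in>verts \<tau>. (u' a)\<^sup>2 * M \<tau> (\<lambda>x. (bary (verts \<tau>) a x)\<^sup>2))"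
    proof (rule sum.mono_neutral_cong)
      show "(u a)\<^sup>2 * M \<tau> (\<lambda>x. (coord \<tau> a x)\<^sup>2) = 0" if "a \<in> nodes - verts \<tau>" for a
        using that by (simp add: coord_def M_def)
      show "(u' a)\<^sup>2 * M \<tau> (\<lambda>x. (bary (verts \<tau>) a x)\<^sup>2) = 0" if "a \<in> verts \<tau> - nodes" for a
        using that \<tau> by (auto simp: u'_def interior_vertices_def mesh_vertices_def)
      show "(u a)\<^sup>2 * M \<tau> (\<lambda>x. (coord \<tau> a x)\<^sup>2) = (u' a)\<^sup>2 * M \<tau> (\<lambda>x. (bary (verts \<tau>) a x)\<^sup>2)" if "a \<in> nodes \<inter> verts \<tau>" for a
        using that by (simp add: u'_def interior_vertices_def coord_def)
    qed (use finite_nodes finite_verts[OF \<tau>] in auto)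
  qed
  finally have dd: "(\<Sum>a\<in>nodes. (u a)\<^sup>2 * l2_inner \<Omega> (nodal a) (nodal a)) = (\<Sum>\<tau>\<in>T. \<Sum>a\<in>verts \<tau>. (u' a)\<^sup>2 * M \<tau> (\<lambda>x. (bary (verts \<tau>) a x)\<^sup>2))" .
  have lower: "1/2 * (\<Sum>a\<in>verts \<tau>. (u' a)\<^sup>2 * M \<tau> (\<lambda>x. (bary (verts \<tau>) a x)\<^sup>2)) \<le> M \<tau> (\<lambda>x. (\<Sum>a\<in>verts \<tau>. u' a * bary (verts \<tau>) a x)\<^sup>2)"
    and upper: "M \<tau> (\<lambda>x. (\<Sum>a\<in>verts \<tau>. u' a * bary (verts \<tau>) a x)\<^sup>2) \<le> (real DIM('a) + 2) / 2 * (\<Sum>a\<in>verts \<tau>. (u' a)\<^sup>2 * M \<tau> (\<lambda>x. (bary (verts \<tau>) a x)\<^sup>2))"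
    if "\<tau> \<in> T" for \<tau>
    unfolding M_def using simplex_mass_bounds[OF simplex_facts(1,2)[OF that], of u'] by blast+
  have d: "r * (\<Sum>\<tau>\<in>T. X \<tau>) = (\<Sum>\<tau>\<in>T. r * X \<tau>)" for r :: real and X by (rule sum_distrib_left)
  show "1/2 * (\<Sum>a\<in>nodes. (u a)\<^sup>2 * l2_inner \<Omega> (nodal a) (nodal a)) \<le> l2_inner \<Omega> f f"
    unfolding dd ff d by (rule sum_mono) (rule lower)
  show "l2_inner \<Omega> f f \<le> (real DIM('a) + 2) / 2 * (\<Sum>a\<in>nodes. (u a)\<^sup>2 * l2_inner \<Omega> (nodal a) (nodal a))"
    unfolding dd ff d by (rule sum_mono) (rule upper)
qed

end

section \<open>Projections and the two preconditioners\<close>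

lemma psd_form_sum:
  assumes "\<And>i. i \<in> I \<Longrightarrow> psd_form V (m i)" "\<And>i. i \<in> I \<Longrightarrow> 0 \<le> c i"
  shows "psd_form V (\<lambda>u v. \<Sum>i\<in>I. c i * m i u v)"
  unfolding psd_form_def
proof (intro conjI ballI allI)
  show "(\<Sum>i\<in>I. c i * m i u w) = (\<Sum>i\<in>I. c i * m i w u)" if "u \<in> V" "w \<in> V" for u w
    using psd_formD(1)[OF assms(1)] that by (intro sum.cong) auto
  show "0 \<le> (\<Sum>i\<in>I. c i * m i u u)" if "u \<in> V" for u
    using psd_formD(2)[OF assms(1)] assms(2) that by (intro sum_nonneg mult_nonneg_nonneg) auto
  show "(\<Sum>i\<in>I. c i * m i (\<lambda>x. u x + r *\<^sub>R v x) w) = (\<Sum>i\<in>I. c i * m i u w) + r * (\<Sum>i\<in>I. c i * m i v w)"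
    if "u \<in> V" "v \<in> V" "w \<in> V" for u v w r
  proof -
    have "(\<Sum>i\<in>I. c i * m i (\<lambda>x. u x + r *\<^sub>R v x) w) = (\<Sum>i\<in>I. c i * m i u w + r * (c i * m i v w))"
      using psd_formD(3)[OF assms(1) that] by (intro sum.cong) (auto simp: algebra_simps)
    then show ?thesis by (simp add: sum.distrib sum_distrib_left)
  qed
qed

lemma l2_inner_diff:
  assumes "u \<in> L2 \<Omega>" "w \<in> L2 \<Omega>" "z \<in> L2 \<Omega>"
  shows "l2_inner \<Omega> (\<lambda>x. u x - w x) z = l2_inner \<Omega> u z - l2_inner \<Omega> w z"
  using psd_formD(3)[OF psd_form_l2_inner assms, of "-1"] by simp

lemma l2_inner_commute: "l2_inner \<Omega> u v = l2_inner \<Omega> v u"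
  by (simp add: l2_inner_def mult.commute)

lemma l2_inner_cong_ae: "ae_eq \<Omega> u u' \<Longrightarrow> l2_inner \<Omega> u v = l2_inner \<Omega> u' v"
  unfolding l2_inner_eq_l2v ae_eq_def by (rule l2v_cong_ae) auto

text \<open>P is a choice of representatives, so it is not known to be linear as a map.
  Orthogonality gives (P u, v) = (P u, P v), hence symmetry, and moving P to the other argument
  makes the form linear. The upper bound is positivity of the squared norm of v - P v.\<close>

lemma projection_psd_form:
  fixes P :: "('a::euclidean_space \<Rightarrow> real) \<Rightarrow> 'a \<Rightarrow> real"
  assumes W: "W \<subseteq> L2 \<Omega>" and P: "\<And>v. v \<in> L2 \<Omega> \<Longrightarrow> P v \<in> W"
    and orth: "\<And>v z. v \<in> L2 \<Omega> \<Longrightarrow> z \<in> W \<Longrightarrow> l2_inner \<Omega> (\<lambda>x. v x - P v x) z = 0"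
  shows "psd_form (L2 \<Omega>) (\<lambda>u v. l2_inner \<Omega> (P u) v)"
    and "v \<in> L2 \<Omega> \<Longrightarrow> l2_inner \<Omega> (P v) v \<le> l2_inner \<Omega> v v"
proof -
  have PL: "P v \<in> L2 \<Omega>" if "v \<in> L2 \<Omega>" for v using W P that by blast
  have e: "l2_inner \<Omega> (P u) v = l2_inner \<Omega> (P u) (P v)" if u: "u \<in> L2 \<Omega>" and v: "v \<in> L2 \<Omega>" for u v
    using orth[OF v P[OF u]] l2_inner_diff[OF v PL[OF v] PL[OF u]] by (simp add: l2_inner_commute)
  have sym: "l2_inner \<Omega> (P u) v = l2_inner \<Omega> (P v) u" if "u \<in> L2 \<Omega>" "v \<in> L2 \<Omega>" for u v
    using e[OF that] e[OF that(2,1)] by (simp add: l2_inner_commute)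
  show "psd_form (L2 \<Omega>) (\<lambda>u v. l2_inner \<Omega> (P u) v)"
    unfolding psd_form_def
  proof (intro conjI ballI allI)
    show "0 \<le> l2_inner \<Omega> (P u) u" if "u \<in> L2 \<Omega>" for u
      using e[OF that that] psd_formD(2)[OF psd_form_l2_inner PL[OF that]] by simp
    fix u v w :: "'a \<Rightarrow> real" and c :: real assume u: "u \<in> L2 \<Omega>" and v: "v \<in> L2 \<Omega>" and w: "w \<in> L2 \<Omega>"
    have "l2_inner \<Omega> (P (\<lambda>x. u x + c *\<^sub>R v x)) w = l2_inner \<Omega> (\<lambda>x. u x + c *\<^sub>R v x) (P w)"
      using sym[OF L2_add_scale[OF u v] w] by (simp add: l2_inner_commute)
    also have "\<dots> = l2_inner \<Omega> u (P w) + c * l2_inner \<Omega> v (P w)"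
      by (rule psd_formD(3)[OF psd_form_l2_inner u v PL[OF w]])
    finally show "l2_inner \<Omega> (P (\<lambda>x. u x + c *\<^sub>R v x)) w = l2_inner \<Omega> (P u) w + c * l2_inner \<Omega> (P v) w"
      using sym[OF u w] sym[OF v w] by (simp add: l2_inner_commute)
  qed (rule sym)
  show "l2_inner \<Omega> (P v) v \<le> l2_inner \<Omega> v v" if v: "v \<in> L2 \<Omega>"
  proof -
    have "(\<lambda>x. v x - P v x) \<in> L2 \<Omega>" using L2_add_scale[OF v PL[OF v], of "-1"] by simp
    then have "0 \<le> l2_inner \<Omega> (\<lambda>x. v x - P v x) (\<lambda>x. v x - P v x)" using psd_formD(2)[OF psd_form_l2_inner] by blast
    also have "\<dots> = l2_inner \<Omega> v (\<lambda>x. v x - P v x) - l2_inner \<Omega> (P v) (\<lambda>x. v x - P v x)"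
      by (rule l2_inner_diff[OF v PL[OF v] \<open>(\<lambda>x. v x - P v x) \<in> L2 \<Omega>\<close>])
    also have "l2_inner \<Omega> (P v) (\<lambda>x. v x - P v x) = 0" using orth[OF v P[OF v]] by (simp add: l2_inner_commute)
    also have "l2_inner \<Omega> v (\<lambda>x. v x - P v x) = l2_inner \<Omega> v v - l2_inner \<Omega> (P v) v"
      using l2_inner_diff[OF v PL[OF v] v] by (simp add: l2_inner_commute)
    finally show ?thesis by simp
  qed
qed

section \<open>Riesz representation and projections on the finite element space\<close>

context mesh
begin

abbreviation V :: "('a \<Rightarrow> real) set" where "V \<equiv> fe_space \<Omega> T"

lemma fe_subset_H1: "V \<subseteq> H1 \<Omega>"
  by (auto simp: fe_space_def H10_def)

lemma fe_subset_L2: "V \<subseteq> L2 \<Omega>"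
  using fe_subset_H1 H1_subset_L2 by blast

lemma fsubspace_fe: "fsubspace V"
  unfolding fsubspace_def
proof (intro conjI ballI allI)
  note H = fsubspace_H10[OF bounded_dom open_dom]
  have "\<exists>p c. \<forall>x\<in>\<tau>. (0::real) = p \<bullet> x + c" for \<tau> :: "'a set" by (intro exI[of _ 0]) simp
  then show "(\<lambda>x. 0) \<in> V" using fsubspaceD(1)[OF H] by (simp add: fe_space_def)
  fix u w c assume u: "u \<in> V" and w: "w \<in> V"
  have "\<exists>p s. \<forall>x\<in>\<tau>. u x + c *\<^sub>R w x = p \<bullet> x + s" if \<tau>: "\<tau> \<in> T" for \<tau>
  proof -
    have "\<exists>p c. \<forall>x\<in>\<tau>. u x = p \<bullet> x + c" "\<exists>p c. \<forall>x\<in>\<tau>. w x = p \<bullet> x + c"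
      using u w \<tau> by (auto simp: fe_space_def)
    then obtain p1 s1 p2 s2 where "\<forall>x\<in>\<tau>. u x = p1 \<bullet> x + s1" "\<forall>x\<in>\<tau>. w x = p2 \<bullet> x + s2"
      by (elim exE)
    then show ?thesis
      by (intro exI[of _ "p1 + c *\<^sub>R p2"] exI[of _ "s1 + c * s2"]) (simp add: inner_add_left algebra_simps)
  qed
  then show "(\<lambda>x. u x + c *\<^sub>R w x) \<in> V"
    using u w fsubspaceD(2)[OF H] by (simp add: fe_space_def)
qed

lemma nodal_fe: "nodal ` nodes \<subseteq> V"
  using nodal_spec(1) by blast

lemma fe_ae_representation:
  assumes "v \<in> V"
  shows "\<exists>u. ae_eq \<Omega> v (\<lambda>x. \<Sum>a\<in>nodes. u a * nodal a x)"
proof -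
  obtain u where u: "\<And>\<tau> x. \<tau> \<in> T \<Longrightarrow> x \<in> \<tau> \<Longrightarrow> v x = (\<Sum>a\<in>nodes. u a * nodal a x)"
    using fe_representation[OF assms] by blast
  have "AE x in lebesgue. x \<in> \<Omega> \<longrightarrow> v x = (\<Sum>a\<in>nodes. u a * nodal a x)"
    using AE_not_in[OF uncovered_null] by (rule eventually_mono) (use u in blast)
  then show ?thesis unfolding ae_eq_def by blast
qed

lemma nodal_sum_fspan: "(\<lambda>x. \<Sum>a\<in>nodes. u a * nodal a x) \<in> fspan (nodal ` nodes)"
proof -
  have "nodal a \<in> fspan (nodal ` nodes)" if "a \<in> nodes" for a
    using that fspan_superset[of "nodal ` nodes"] by auto
  from fsubspace_sum[OF fsubspace_fspan this, where c=u] show ?thesis by simp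
qed

lemma nodal_sum_fe: "(\<lambda>x. \<Sum>a\<in>nodes. u a * nodal a x) \<in> V"
  using nodal_sum_fspan fspan_minimal[OF fsubspace_fe nodal_fe] by blast

text \<open>V is spanned by the nodal functions only up to null sets. The difference between an
  element and its nodal sum vanishes almost everywhere, hence is invisible to both \<open>m\<close>
  and the functional. This yields the projection, the operator A and the inverse operators.\<close>

lemma fe_riesz:
  assumes m: "psd_form V m"
    and lin: "\<And>u v c. u \<in> V \<Longrightarrow> v \<in> V \<Longrightarrow> \<l> (\<lambda>x. u x + c *\<^sub>R v x) = \<l> u + c * \<l> v"
    and null: "\<And>u. u \<in> V \<Longrightarrow> m u u = 0 \<Longrightarrow> \<l> u = 0"
    and ae: "\<And>u. u \<in> V \<Longrightarrow> ae_eq \<Omega> u (\<lambda>x. 0) \<Longrightarrow> m u u = 0"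
  shows "\<exists>w\<in>V. \<forall>z\<in>V. m w z = \<l> z"
proof -
  have sub: "fspan (nodal ` nodes) \<subseteq> V" by (rule fspan_minimal[OF fsubspace_fe nodal_fe])
  have "\<exists>w\<in>fspan (nodal ` nodes). \<forall>z\<in>fspan (nodal ` nodes). m w z = \<l> z"
    by (rule psd_form_riesz[OF fsubspace_fe m finite_imageI[OF finite_nodes] nodal_fe, of \<l>]) (fact lin, fact null)
  then obtain w where w: "w \<in> fspan (nodal ` nodes)" "\<And>z. z \<in> fspan (nodal ` nodes) \<Longrightarrow> m w z = \<l> z"
    by blast
  have wV: "w \<in> V" using w sub by blast
  have "m w z = \<l> z" if z: "z \<in> V" for z
  proof -
    obtain u where u: "ae_eq \<Omega> z (\<lambda>x. \<Sum>a\<in>nodes. u a * nodal a x)" using fe_ae_representation[OF z] by blast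
    define z' where "z' = (\<lambda>x. \<Sum>a\<in>nodes. u a * nodal a x)"
    have z': "z' \<in> fspan (nodal ` nodes)" "z' \<in> V" unfolding z'_def by (rule nodal_sum_fspan nodal_sum_fe)+
    define e where "e = (\<lambda>x. z x + (-1) *\<^sub>R z' x)"
    have e: "e \<in> V" unfolding e_def by (rule fsubspaceD(2)[OF fsubspace_fe z z'(2)])
    have "ae_eq \<Omega> e (\<lambda>x. 0)"
      using u unfolding ae_eq_def e_def z'_def by (rule eventually_mono) simp
    from ae[OF e this] have me: "m e e = 0" .
    then have "m w e = 0" using psd_form_cauchy[OF m fsubspace_fe wV e] by simp
    moreover have "m w e = m w z - m w z'" unfolding e_def using psd_form_right[OF m fsubspace_fe z z'(2) wV, of "-1"] by simp
    moreover have "\<l> e = \<l> z - \<l> z'" unfolding e_def using lin[OF z z'(2), of "-1"] by simp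
    moreover have "\<l> e = 0" by (rule null[OF e me])
    ultimately show ?thesis using w(2)[OF z'(1)] by simp
  qed
  then show ?thesis using wV by blast
qed

lemma psd_l2_fe: "psd_form V (l2_inner \<Omega>)"
  by (rule psd_form_subset[OF psd_form_l2_inner fe_subset_L2])

lemma l2_ae_zero: "ae_eq \<Omega> u (\<lambda>x. 0) \<Longrightarrow> l2_inner \<Omega> u u = 0"
  using l2_inner_cong_ae[of \<Omega> u "\<lambda>x. 0" u] by (simp add: l2_inner_def set_lebesgue_integral_def)

lemma l2_zero_ae: "u \<in> L2 \<Omega> \<Longrightarrow> l2_inner \<Omega> u u = 0 \<Longrightarrow> ae_eq \<Omega> u (\<lambda>x. 0)"
  using l2v_eq_0_imp_ae[of u \<Omega>] by (simp add: l2_inner_eq_l2v ae_eq_def)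

abbreviation proj :: "('a \<Rightarrow> real) \<Rightarrow> 'a \<Rightarrow> real" where "proj \<equiv> l2_proj \<Omega> V"

abbreviation nproj :: "'a \<Rightarrow> ('a \<Rightarrow> real) \<Rightarrow> 'a \<Rightarrow> real" where
  "nproj a \<equiv> l2_proj \<Omega> (fun_span (nodal a))"

lemma proj_spec:
  assumes v: "v \<in> L2 \<Omega>"
  shows "proj v \<in> V" "z \<in> V \<Longrightarrow> l2_inner \<Omega> (\<lambda>x. v x - proj v x) z = 0"
proof -
  have "\<exists>w\<in>V. \<forall>z\<in>V. l2_inner \<Omega> w z = l2_inner \<Omega> v z"
  proof (rule fe_riesz[OF psd_l2_fe])
    show "l2_inner \<Omega> v (\<lambda>x. u x + c *\<^sub>R w x) = l2_inner \<Omega> v u + c * l2_inner \<Omega> v w" if "u \<in> V" "w \<in> V" for u w c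
      using psd_form_right[OF psd_form_l2_inner fsubspace_L2 _ _ v] that fe_subset_L2 by blast
    show "l2_inner \<Omega> v u = 0" if "u \<in> V" "l2_inner \<Omega> u u = 0" for u
      using psd_form_cauchy[OF psd_form_l2_inner fsubspace_L2 v, of u] that fe_subset_L2 by auto
  qed (rule l2_ae_zero)
  then obtain w where w: "w \<in> V" "\<And>z. z \<in> V \<Longrightarrow> l2_inner \<Omega> w z = l2_inner \<Omega> v z" by blast
  have "l2_inner \<Omega> (\<lambda>x. v x - w x) z = 0" if "z \<in> V" for z
    using w that fe_subset_L2 by (subst l2_inner_diff[OF v]) auto
  then have "\<exists>w. w \<in> V \<and> (\<forall>z\<in>V. l2_inner \<Omega> (\<lambda>x. v x - w x) z = 0)" using w(1) by blast
  from someI_ex[OF this] show "proj v \<in> V" "z \<in> V \<Longrightarrow> l2_inner \<Omega> (\<lambda>x. v x - proj v x) z = 0"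
    unfolding l2_proj_def by blast+
qed

lemma nodal_L2: "a \<in> nodes \<Longrightarrow> nodal a \<in> L2 \<Omega>"
  using nodal_spec(1) fe_subset_L2 by blast

lemma scaled_L2: "w \<in> L2 \<Omega> \<Longrightarrow> (\<lambda>x. c * w x) \<in> L2 \<Omega>" for w :: "'a \<Rightarrow> real"
  using fsubspace_scale[OF fsubspace_L2, of w \<Omega> c] by simp

lemma l2_inner_scale: "l2_inner \<Omega> (\<lambda>x. c * u x) v = c * l2_inner \<Omega> u v"
  by (simp add: l2_inner_def set_lebesgue_integral_def mult.assoc mult.left_commute[of _ c])

lemma nproj_spec:
  assumes a: "a \<in> nodes" and v: "v \<in> L2 \<Omega>"
  shows "nproj a v \<in> fun_span (nodal a)" "z \<in> fun_span (nodal a) \<Longrightarrow> l2_inner \<Omega> (\<lambda>x. v x - nproj a v x) z = 0"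
proof -
  \<comment> \<open>Should the denominator be zero, the numerator is zero as well by Cauchy-Schwarz,
    so the defining equation of the projection holds in all cases.\<close>
  define t where "t = l2_inner \<Omega> v (nodal a) / l2_inner \<Omega> (nodal a) (nodal a)"
  have t: "t * l2_inner \<Omega> (nodal a) (nodal a) = l2_inner \<Omega> v (nodal a)"
    using psd_form_cauchy[OF psd_form_l2_inner fsubspace_L2 v nodal_L2[OF a]]
    by (cases "l2_inner \<Omega> (nodal a) (nodal a) = 0") (auto simp: t_def)
  have "l2_inner \<Omega> (\<lambda>x. v x - t * nodal a x) z = 0" if z: "z \<in> fun_span (nodal a)" for z
  proof -
    obtain c where c: "z = (\<lambda>x. c * nodal a x)" using z by (auto simp: fun_span_def)
    have "l2_inner \<Omega> (\<lambda>x. v x - t * nodal a x) z = c * l2_inner \<Omega> (\<lambda>x. v x - t * nodal a x) (nodal a)"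
      unfolding c by (simp add: l2_inner_commute[of \<Omega> "\<lambda>x. v x - t * nodal a x"] l2_inner_scale)
    also have "l2_inner \<Omega> (\<lambda>x. v x - t * nodal a x) (nodal a) = 0"
      using l2_inner_diff[OF v scaled_L2[OF nodal_L2[OF a]] nodal_L2[OF a], of t] t by (simp add: l2_inner_scale)
    finally show ?thesis by simp
  qed
  then have "\<exists>w. w \<in> fun_span (nodal a) \<and> (\<forall>z\<in>fun_span (nodal a). l2_inner \<Omega> (\<lambda>x. v x - w x) z = 0)"
    by (intro exI[of _ "\<lambda>x. t * nodal a x"]) (auto simp: fun_span_def)
  from someI_ex[OF this] show "nproj a v \<in> fun_span (nodal a)" "z \<in> fun_span (nodal a) \<Longrightarrow> l2_inner \<Omega> (\<lambda>x. v x - nproj a v x) z = 0"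
    unfolding l2_proj_def by blast+
qed

lemma fun_span_fe: "a \<in> nodes \<Longrightarrow> fun_span (nodal a) \<subseteq> V"
  using fsubspace_scale[OF fsubspace_fe nodal_spec(1)] by (auto simp: fun_span_def)

lemma proj_form: "psd_form (L2 \<Omega>) (\<lambda>u v. l2_inner \<Omega> (proj u) v)"
  and proj_le: "v \<in> L2 \<Omega> \<Longrightarrow> l2_inner \<Omega> (proj v) v \<le> l2_inner \<Omega> v v"
  using projection_psd_form[OF fe_subset_L2, of proj] proj_spec by blast+

lemma nproj_form: "a \<in> nodes \<Longrightarrow> psd_form (L2 \<Omega>) (\<lambda>u v. l2_inner \<Omega> (nproj a u) v)"
  by (rule projection_psd_form(1)[of "fun_span (nodal a)"]) (use fun_span_fe fe_subset_L2 nproj_spec in blast)+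

text \<open>Two duality arguments in the weights \<open>d\<close>: the coefficients c of w satisfy
  \<Sum> c^2 d \<le> 2 (w, w), and the Jacobi coefficients t satisfy |\<Sum> t \<phi>|^2 \<le>
  (d+2)/2 \<Sum> t^2 d, where the right-hand sum is the Jacobi form itself.\<close>

lemma level_equivalence:
  assumes v: "v \<in> L2 \<Omega>"
  shows "1/2 * l2_inner \<Omega> (proj v) v \<le> (\<Sum>a\<in>nodes. l2_inner \<Omega> (nproj a v) v)"
    and "(\<Sum>a\<in>nodes. l2_inner \<Omega> (nproj a v) v) \<le> (real DIM('a) + 2) / 2 * l2_inner \<Omega> (proj v) v"
proof -
  let ?in = "l2_inner \<Omega>"
  define w where "w = proj v"
  have wV: "w \<in> V" and wL: "w \<in> L2 \<Omega>" using proj_spec(1)[OF v] fe_subset_L2 by (auto simp: w_def)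
  have wz: "?in w z = ?in v z" if "z \<in> V" for z
  proof -
    have "z \<in> L2 \<Omega>" using that fe_subset_L2 by blast
    from l2_inner_diff[OF v wL this] show ?thesis using proj_spec(2)[OF v that] by (simp add: w_def)
  qed
  have qv: "?in w v = ?in w w" using wz[OF wV] by (simp add: l2_inner_commute)
  obtain c where c: "ae_eq \<Omega> w (\<lambda>x. \<Sum>a\<in>nodes. c a * nodal a x)" using fe_ae_representation[OF wV] by blast
  define d where "d = (\<lambda>a. ?in (nodal a) (nodal a))"
  define r where "r = (\<lambda>a. ?in w (nodal a))"
  \<comment> \<open>Stated as a product, the equation for the coefficient avoids any division by the
    norm of the nodal function.\<close>
  have "\<exists>t. nproj a v = (\<lambda>x. t * nodal a x) \<and> t * d a = r a" if a: "a \<in> nodes" for a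
  proof -
    obtain t where t: "nproj a v = (\<lambda>x. t * nodal a x)" using nproj_spec(1)[OF a v] by (auto simp: fun_span_def)
    have "nodal a \<in> fun_span (nodal a)" by (auto simp: fun_span_def intro: exI[of _ 1])
    from nproj_spec(2)[OF a v this]
    have "?in v (nodal a) - t * d a = 0"
      unfolding t using l2_inner_diff[OF v scaled_L2[OF nodal_L2[OF a]] nodal_L2[OF a], of t] by (simp add: l2_inner_scale d_def)
    then show ?thesis using t wz[OF nodal_spec(1)[OF a]] by (auto simp: r_def)
  qed
  then obtain t where t: "\<And>a. a \<in> nodes \<Longrightarrow> nproj a v = (\<lambda>x. t a * nodal a x)" "\<And>a. a \<in> nodes \<Longrightarrow> t a * d a = r a" by metis
  define j where "j = (\<Sum>a\<in>nodes. ?in (nproj a v) v)"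
  have j1: "j = (\<Sum>a\<in>nodes. t a * r a)"
    unfolding j_def using t(1) wz[OF nodal_spec(1)]
    by (intro sum.cong) (auto simp: l2_inner_scale r_def l2_inner_commute[of \<Omega> v])
  have j2: "j = (\<Sum>a\<in>nodes. (t a)\<^sup>2 * d a)"
    unfolding j1 by (intro sum.cong) (auto simp: t(2)[symmetric] power2_eq_square)
  have d0: "0 \<le> d a" if "a \<in> nodes" for a
    unfolding d_def using psd_formD(2)[OF psd_form_l2_inner nodal_L2[OF that]] .
  have j0: "0 \<le> j" unfolding j2 using d0 by (intro sum_nonneg) auto
  have w0: "0 \<le> ?in w w" using psd_formD(2)[OF psd_form_l2_inner wL] .
  have sumL: "?in (\<lambda>x. \<Sum>a\<in>nodes. s a * nodal a x) z = (\<Sum>a\<in>nodes. s a * ?in (nodal a) z)" if "z \<in> L2 \<Omega>" for s z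
    using psd_form_sum_left[OF psd_form_l2_inner fsubspace_L2 nodal_L2 that, where c=s] by simp
  let ?f = "\<lambda>x. \<Sum>a\<in>nodes. c a * nodal a x"
  have ww: "?in w w = (\<Sum>a\<in>nodes. c a * r a)"
    using l2_inner_cong_ae[OF c, of w] sumL[OF wL, of c] by (simp add: r_def l2_inner_commute)
  have ff: "?in ?f ?f = ?in w w"
    using l2_inner_cong_ae[OF c, of w] l2_inner_cong_ae[OF c, of ?f] by (simp add: l2_inner_commute)
  have half: "(\<Sum>a\<in>nodes. (c a)\<^sup>2 * d a) \<le> 2 * ?in w w"
    using mass_bounds(1)[of c] ff by (simp add: d_def)
  \<comment> \<open>(w, w) = \<Sum> c t d by definition of t; weighted Cauchy-Schwarz bounds its
    square by (\<Sum> c^2 d) j, and one factor (w, w) cancels.\<close>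
  have lower: "?in w w \<le> 2 * j"
  proof -
    have "(?in w w)\<^sup>2 = (\<Sum>a\<in>nodes. (c a * sqrt (d a)) * (t a * sqrt (d a)))\<^sup>2"
    proof -
      have "(\<Sum>a\<in>nodes. (c a * sqrt (d a)) * (t a * sqrt (d a))) = (\<Sum>a\<in>nodes. c a * r a)"
      proof (rule sum.cong[OF refl])
        fix a assume a: "a \<in> nodes"
        have "(c a * sqrt (d a)) * (t a * sqrt (d a)) = c a * t a * (sqrt (d a) * sqrt (d a))" by (simp only: mult_ac)
        also have "\<dots> = c a * r a" using d0[OF a] t(2)[OF a] by simp
        finally show "(c a * sqrt (d a)) * (t a * sqrt (d a)) = c a * r a" .
      qed
      then show ?thesis by (simp add: ww)
    qed
    also have "\<dots> \<le> (\<Sum>a\<in>nodes. (c a * sqrt (d a))\<^sup>2) * (\<Sum>a\<in>nodes. (t a * sqrt (d a))\<^sup>2)"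
      by (rule Cauchy_Schwarz_ineq_sum)
    also have "\<dots> = (\<Sum>a\<in>nodes. (c a)\<^sup>2 * d a) * j"
      unfolding j2 using d0 by (simp add: power_mult_distrib)
    also have "\<dots> \<le> (2 * ?in w w) * j" by (rule mult_right_mono[OF half j0])
    finally have "?in w w * ?in w w \<le> ?in w w * (2 * j)" by (simp add: power2_eq_square mult_ac)
    then show ?thesis using w0 j0 by (cases "?in w w = 0") (auto simp: mult_le_cancel_left)
  qed
  then show "1/2 * l2_inner \<Omega> (proj v) v \<le> (\<Sum>a\<in>nodes. l2_inner \<Omega> (nproj a v) v)"
    using qv by (simp add: w_def j_def)
  \<comment> \<open>The sum of all local projections, tested against w: (g, w) = j, so
    Cauchy-Schwarz and the upper mass bound for g leave one factor j to cancel.\<close>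
  let ?g = "\<lambda>x. \<Sum>a\<in>nodes. t a * nodal a x"
  have gL: "?g \<in> L2 \<Omega>" using nodal_sum_fe fe_subset_L2 by blast
  have upper: "j \<le> (real DIM('a) + 2) / 2 * ?in w w"
  proof -
    have "?in ?g w = j" using sumL[OF wL, of t] by (simp add: j1 r_def l2_inner_commute)
    then have "j\<^sup>2 \<le> ?in ?g ?g * ?in w w"
      using psd_form_cauchy[OF psd_form_l2_inner fsubspace_L2 gL wL] by simp
    also have "\<dots> \<le> ((real DIM('a) + 2) / 2 * j) * ?in w w"
      using mass_bounds(2)[of t] w0 by (intro mult_right_mono) (simp_all add: d_def j2)
    finally have "j * j \<le> j * ((real DIM('a) + 2) / 2 * ?in w w)" by (simp add: power2_eq_square mult_ac)
    then show ?thesis using w0 j0 by (cases "j = 0") (auto simp: mult_le_cancel_left)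
  qed
  then show "(\<Sum>a\<in>nodes. l2_inner \<Omega> (nproj a v) v) \<le> (real DIM('a) + 2) / 2 * l2_inner \<Omega> (proj v) v"
    using qv by (simp add: w_def j_def)
qed

section \<open>The operator A and inverse operators\<close>

lemma proj_on_fe: "v \<in> V \<Longrightarrow> l2_inner \<Omega> (proj v) v = l2_inner \<Omega> v v"
  using proj_spec(1)[of v] proj_spec(2)[of v v] l2_inner_diff[of v \<Omega> "proj v" v] fe_subset_L2 by (auto simp: subset_iff)

lemma psd_dirichlet_fe: "psd_form V (dirichlet_form \<Omega>)"
  by (rule psd_form_subset[OF psd_form_dirichlet[OF bounded_dom open_dom] fe_subset_H1])

lemma dirichlet_ae_zero:
  assumes u: "u \<in> V" and z: "ae_eq \<Omega> u (\<lambda>x. 0)"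
  shows "dirichlet_form \<Omega> u u = 0"
proof -
  have "has_weak_gradient \<Omega> (\<lambda>x. 0) (\<lambda>x. 0)" by (auto simp: has_weak_gradient_def)
  then have "has_weak_gradient \<Omega> u (\<lambda>x. 0)"
    by (rule has_weak_gradient_ae[rotated 2]) (use z in \<open>auto simp: ae_eq_def elim: eventually_mono\<close>)
  then have "dirichlet_form \<Omega> u u = l2v \<Omega> (\<lambda>x. 0 :: 'a) (\<lambda>x. 0)"
    using dirichlet_form_eq[OF bounded_dom open_dom _ L2_zero] u fe_subset_L2 by blast
  then show ?thesis by (simp add: l2v_def set_lebesgue_integral_def)
qed

lemma A_op_spec:
  assumes v: "v \<in> V"
  shows "l2_inner \<Omega> (A_op \<Omega> V v) v = dirichlet_form \<Omega> v v"
proof -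
  have "\<exists>u\<in>V. \<forall>w\<in>V. l2_inner \<Omega> u w = dirichlet_form \<Omega> v w"
  proof (rule fe_riesz[OF psd_l2_fe])
    show "dirichlet_form \<Omega> v (\<lambda>x. u x + c *\<^sub>R w x) = dirichlet_form \<Omega> v u + c * dirichlet_form \<Omega> v w" if "u \<in> V" "w \<in> V" for u w c
      by (rule psd_form_right[OF psd_dirichlet_fe fsubspace_fe that v])
    show "dirichlet_form \<Omega> v u = 0" if "u \<in> V" "l2_inner \<Omega> u u = 0" for u
    proof -
      have "ae_eq \<Omega> u (\<lambda>x. 0)" using l2_zero_ae that fe_subset_L2 by blast
      from dirichlet_ae_zero[OF that(1) this] show ?thesis
        using psd_form_cauchy[OF psd_dirichlet_fe fsubspace_fe v that(1)] by simp
    qed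
  qed (rule l2_ae_zero)
  then have "\<exists>u. u \<in> V \<and> (\<forall>w\<in>V. l2_inner \<Omega> u w = dirichlet_form \<Omega> v w)" by blast
  from someI_ex[OF this] show ?thesis using v unfolding A_op_def by blast
qed

text \<open>An inverse inequality from finite dimensionality. Its constant may depend on the mesh in
  any way, since it only serves to make suprema of Rayleigh quotients finite.\<close>

lemma dirichlet_bound: "\<exists>C>0. \<forall>v\<in>V. dirichlet_form \<Omega> v v \<le> C * l2_inner \<Omega> v v"
proof -
  let ?in = "l2_inner \<Omega>" and ?D = "dirichlet_form \<Omega>"
  \<comment> \<open>Dominates the Rayleigh quotient of every nodal function. A summand with zero
    denominator is 0, and then the Dirichlet form of that nodal function is zero too.\<close>
  define K where "K = (\<Sum>a\<in>nodes. ?D (nodal a) (nodal a) / ?in (nodal a) (nodal a))"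
  have Dn: "0 \<le> ?D (nodal a) (nodal a)" and dn: "0 \<le> ?in (nodal a) (nodal a)" if "a \<in> nodes" for a
    using psd_formD(2)[OF psd_dirichlet_fe] psd_formD(2)[OF psd_l2_fe] nodal_spec(1)[OF that] by auto
  have K0: "0 \<le> K" unfolding K_def using Dn dn by (intro sum_nonneg divide_nonneg_nonneg) auto
  have Kd: "?D (nodal a) (nodal a) \<le> K * ?in (nodal a) (nodal a)" if a: "a \<in> nodes" for a
  proof (cases "?in (nodal a) (nodal a) = 0")
    case True
    then have "ae_eq \<Omega> (nodal a) (\<lambda>x. 0)" using l2_zero_ae nodal_L2[OF a] by blast
    from dirichlet_ae_zero[OF nodal_spec(1)[OF a] this] True show ?thesis by simp
  next
    case False
    have "?D (nodal a) (nodal a) / ?in (nodal a) (nodal a) \<le> K"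
      unfolding K_def using a finite_nodes Dn dn by (intro member_le_sum) auto
    then show ?thesis using False dn[OF a] by (simp add: divide_le_eq split: if_splits)
  qed
  define n where "n = real (card nodes)"
  have "?D v v \<le> (2 * n * K + 1) * ?in v v" if v: "v \<in> V" for v
  proof -
    obtain c where c: "ae_eq \<Omega> v (\<lambda>x. \<Sum>a\<in>nodes. c a * nodal a x)" using fe_ae_representation[OF v] by blast
    define f where "f = (\<lambda>x. \<Sum>a\<in>nodes. c a * nodal a x)"
    have f: "f \<in> V" unfolding f_def by (rule nodal_sum_fe)
    have inf: "?in f f = ?in v v"
      using l2_inner_cong_ae[OF c, of v] l2_inner_cong_ae[OF c, of f] by (simp add: f_def l2_inner_commute)
    define e where "e = (\<lambda>x. v x + (-1) *\<^sub>R f x)"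
    have e: "e \<in> V" unfolding e_def by (rule fsubspaceD(2)[OF fsubspace_fe v f])
    have "ae_eq \<Omega> e (\<lambda>x. 0)"
      using c unfolding ae_eq_def e_def f_def by (rule eventually_mono) simp
    from dirichlet_ae_zero[OF e this] have De: "?D e e = 0" .
    have ez: "?D e z = 0" if "z \<in> V" for z
      using psd_form_cauchy[OF psd_dirichlet_fe fsubspace_fe e that] De by simp
    have sub: "?D v z = ?D f z" if "z \<in> V" for z
      using ez[OF that] psd_formD(3)[OF psd_dirichlet_fe v f that, of "-1"] unfolding e_def by simp
    have "?D v v = ?D f f"
      using sub[OF v] sub[OF f] psd_formD(1)[OF psd_dirichlet_fe v f] by simp
    also have "\<dots> \<le> n * (\<Sum>a\<in>nodes. (c a)\<^sup>2 * ?D (nodal a) (nodal a))"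
    proof -
      have expand: "?D f z = (\<Sum>a\<in>nodes. c a * ?D (nodal a) z)" if "z \<in> V" for z
        using psd_form_sum_left[OF psd_dirichlet_fe fsubspace_fe nodal_spec(1) that, where c=c] unfolding f_def by simp
      have "?D f f = (\<Sum>a\<in>nodes. c a * ?D (nodal a) f)" by (rule expand[OF f])
      also have "\<dots> \<le> (\<Sum>a\<in>nodes. \<bar>c a\<bar> * sqrt (?D (nodal a) (nodal a)) * sqrt (?D f f))"
      proof (rule sum_mono)
        fix a assume a: "a \<in> nodes"
        have "\<bar>?D (nodal a) f\<bar> \<le> sqrt (?D (nodal a) (nodal a)) * sqrt (?D f f)"
          using real_sqrt_le_mono[OF psd_form_cauchy[OF psd_dirichlet_fe fsubspace_fe nodal_spec(1)[OF a] f]]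
          by (simp add: real_sqrt_mult)
        then have "\<bar>c a * ?D (nodal a) f\<bar> \<le> \<bar>c a\<bar> * (sqrt (?D (nodal a) (nodal a)) * sqrt (?D f f))"
          unfolding abs_mult by (intro mult_left_mono) auto
        then show "c a * ?D (nodal a) f \<le> \<bar>c a\<bar> * sqrt (?D (nodal a) (nodal a)) * sqrt (?D f f)" by (simp add: mult.assoc)
      qed
      also have "\<dots> = (\<Sum>a\<in>nodes. 1 * (\<bar>c a\<bar> * sqrt (?D (nodal a) (nodal a)))) * sqrt (?D f f)"
        by (simp add: sum_distrib_right)
      finally have le: "?D f f \<le> S * sqrt (?D f f)" if "S = (\<Sum>a\<in>nodes. 1 * (\<bar>c a\<bar> * sqrt (?D (nodal a) (nodal a))))" for S
        using that by simp
      define S where "S = (\<Sum>a\<in>nodes. 1 * (\<bar>c a\<bar> * sqrt (?D (nodal a) (nodal a))))"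
      have S0: "0 \<le> S" unfolding S_def using Dn by (intro sum_nonneg) auto
      have Df: "0 \<le> ?D f f" using psd_formD(2)[OF psd_dirichlet_fe f] .
      have "sqrt (?D f f) * sqrt (?D f f) \<le> S * sqrt (?D f f)" using le[OF S_def] Df by simp
      then have "sqrt (?D f f) \<le> S"
        using Df S0 mult_right_le_imp_le[of "sqrt (?D f f)" "sqrt (?D f f)" S] by (cases "?D f f = 0") auto
      then have "(sqrt (?D f f))\<^sup>2 \<le> S\<^sup>2" using Df by (intro power_mono) auto
      then have "?D f f \<le> S\<^sup>2" using Df by simp
      also have "S\<^sup>2 \<le> (\<Sum>a\<in>nodes. 1\<^sup>2) * (\<Sum>a\<in>nodes. (\<bar>c a\<bar> * sqrt (?D (nodal a) (nodal a)))\<^sup>2)"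
        unfolding S_def by (rule Cauchy_Schwarz_ineq_sum)
      also have "\<dots> = n * (\<Sum>a\<in>nodes. (c a)\<^sup>2 * ?D (nodal a) (nodal a))"
        using Dn by (simp add: n_def power_mult_distrib)
      finally show ?thesis .
    qed
    also have "\<dots> \<le> n * (\<Sum>a\<in>nodes. (c a)\<^sup>2 * (K * ?in (nodal a) (nodal a)))"
      using Kd by (intro mult_left_mono sum_mono) (auto simp: n_def)
    also have "\<dots> = n * K * (\<Sum>a\<in>nodes. (c a)\<^sup>2 * ?in (nodal a) (nodal a))"
      by (simp add: sum_distrib_left mult_ac)
    also have "\<dots> \<le> n * K * (2 * ?in f f)"
      using mass_bounds(1)[of c] K0 unfolding f_def by (intro mult_left_mono) (auto simp: n_def)
    also have "\<dots> \<le> (2 * n * K + 1) * ?in v v"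
      using psd_formD(2)[OF psd_l2_fe v] by (simp add: inf algebra_simps)
    finally show ?thesis .
  qed
  moreover have "2 * n * K + 1 > 0" using K0 by (simp add: n_def add_nonneg_pos)
  ultimately show ?thesis by blast
qed

text \<open>Riesz representation for the form of M solves M w = v weakly on V. Since M w - v lies in
  V and is orthogonal to itself, the equation holds almost everywhere, as \<open>op_inverse\<close>
  demands.\<close>

lemma op_inverse_spec:
  assumes m: "psd_form V m" and MV: "\<And>u. u \<in> V \<Longrightarrow> M u \<in> V" and mM: "\<And>u z. u \<in> V \<Longrightarrow> z \<in> V \<Longrightarrow> l2_inner \<Omega> (M u) z = m u z"
    and def: "\<And>u. u \<in> V \<Longrightarrow> m u u = 0 \<Longrightarrow> l2_inner \<Omega> u u = 0" and v: "v \<in> V"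
  shows "op_inverse \<Omega> V M v \<in> V" "z \<in> V \<Longrightarrow> m (op_inverse \<Omega> V M v) z = l2_inner \<Omega> v z"
proof -
  have "\<exists>w\<in>V. \<forall>z\<in>V. m w z = l2_inner \<Omega> v z"
  proof (rule fe_riesz[OF m])
    show "l2_inner \<Omega> v (\<lambda>x. u x + c *\<^sub>R w x) = l2_inner \<Omega> v u + c * l2_inner \<Omega> v w" if "u \<in> V" "w \<in> V" for u w c
      by (rule psd_form_right[OF psd_l2_fe fsubspace_fe that v])
    show "l2_inner \<Omega> v u = 0" if "u \<in> V" "m u u = 0" for u
      using psd_form_cauchy[OF psd_l2_fe fsubspace_fe v that(1)] def[OF that] by simp
    show "m u u = 0" if "u \<in> V" "ae_eq \<Omega> u (\<lambda>x. 0)" for u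
      using mM[OF that(1,1)] l2_inner_cong_ae[OF that(2), of "M u"]
      by (simp add: l2_inner_commute[of _ "M u"]) (simp add: l2_inner_def set_lebesgue_integral_def)
  qed
  then obtain w where w: "w \<in> V" "\<And>z. z \<in> V \<Longrightarrow> m w z = l2_inner \<Omega> v z" by blast
  define e where "e = (\<lambda>x. M w x - v x)"
  have "e \<in> V" using fsubspaceD(2)[OF fsubspace_fe MV[OF w(1)] v, of "-1"] by (simp add: e_def)
  then have eL: "e \<in> L2 \<Omega>" using fe_subset_L2 by blast
  have "l2_inner \<Omega> e e = l2_inner \<Omega> (M w) e - l2_inner \<Omega> v e"
    unfolding e_def[THEN arg_cong[of _ _ "\<lambda>f. l2_inner \<Omega> f e"]]
    by (rule l2_inner_diff) (use MV[OF w(1)] v eL fe_subset_L2 in auto)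
  also have "\<dots> = 0" using mM[OF w(1) \<open>e \<in> V\<close>] w(2)[OF \<open>e \<in> V\<close>] by simp
  finally have "ae_eq \<Omega> e (\<lambda>x. 0)" by (rule l2_zero_ae[OF eL])
  then have "ae_eq \<Omega> (M w) v" unfolding ae_eq_def e_def by (rule eventually_mono) auto
  then have "\<exists>w. w \<in> V \<and> ae_eq \<Omega> (M w) v" using w(1) by blast
  from someI_ex[OF this] have s: "op_inverse \<Omega> V M v \<in> V" "ae_eq \<Omega> (M (op_inverse \<Omega> V M v)) v"
    unfolding op_inverse_def by auto
  show "op_inverse \<Omega> V M v \<in> V" by (rule s)
  show "m (op_inverse \<Omega> V M v) z = l2_inner \<Omega> v z" if "z \<in> V"
    using mM[OF s(1) that] l2_inner_cong_ae[OF s(2), of z] by simp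
qed

end

text \<open>Inversion reverses the order of forms: with w and w' the solutions for the same
  right-hand side v under m and m', one has m'(w', w) = (v, w) = m(w, w), and Cauchy-Schwarz for m'
  gives the claim.\<close>

lemma inverse_form_le:
  assumes V: "fsubspace V" "psd_form V m'" and w: "w \<in> V" "w' \<in> V"
    and eq: "m' w' w = m w w" and le: "m' w w \<le> K * m w w" and nn: "0 \<le> m w w" "0 \<le> K"
  shows "m w w \<le> K * m' w' w'"
proof -
  have n': "0 \<le> m' w' w'" using psd_formD(2)[OF V(2) w(2)] .
  have "(m w w)\<^sup>2 \<le> m' w' w' * m' w w" using psd_form_cauchy[OF V(2,1) w(2,1)] eq by simp
  also have "\<dots> \<le> m' w' w' * (K * m w w)" by (rule mult_left_mono[OF le n'])
  finally have "m w w * m w w \<le> m w w * (K * m' w' w')" by (simp add: power2_eq_square mult_ac)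
  then show ?thesis using nn n' by (cases "m w w = 0") (auto simp: mult_le_cancel_left)
qed

text \<open>The bound C makes the suprema genuine. The estimate s \<le> K r raises the supremum by
  at most K, and r \<le> 2 s lowers the infimum by at most half.\<close>

lemma sup_inf_ratio:
  fixes r s :: "'x \<Rightarrow> real"
  assumes ne: "S \<noteq> {}" and r: "\<And>x. x \<in> S \<Longrightarrow> 0 \<le> r x" "\<And>x. x \<in> S \<Longrightarrow> r x \<le> C"
    and s: "\<And>x. x \<in> S \<Longrightarrow> s x \<le> K * r x" "\<And>x. x \<in> S \<Longrightarrow> r x \<le> 2 * s x" and K: "0 \<le> K"
  shows "(SUP x\<in>S. s x) / (INF x\<in>S. s x) \<le> 2 * K * ((SUP x\<in>S. r x) / (INF x\<in>S. r x))"
proof -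
  have ba: "bdd_above (r ` S)" and bb: "bdd_below (r ` S)" using r by (auto intro!: bdd_aboveI2 bdd_belowI2)
  have s0: "0 \<le> s x" if "x \<in> S" for x using r(1)[OF that] s(2)[OF that] by linarith
  have bs: "bdd_below (s ` S)" using s0 by (auto intro!: bdd_belowI2)
  have up: "(SUP x\<in>S. s x) \<le> K * (SUP x\<in>S. r x)"
  proof (rule cSUP_least[OF ne])
    fix x assume x: "x \<in> S"
    have "s x \<le> K * r x" by (rule s(1)[OF x])
    also have "\<dots> \<le> K * (SUP x\<in>S. r x)" by (intro mult_left_mono cSUP_upper[OF x ba] K)
    finally show "s x \<le> K * (SUP x\<in>S. r x)" .
  qed
  have low: "(INF x\<in>S. r x) / 2 \<le> (INF x\<in>S. s x)"
  proof (rule cINF_greatest[OF ne])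
    fix x assume x: "x \<in> S"
    show "(INF x\<in>S. r x) / 2 \<le> s x" using cINF_lower[OF bb x] s(2)[OF x] by linarith
  qed
  have i0: "0 \<le> (INF x\<in>S. r x)" by (rule cINF_greatest[OF ne r(1)])
  obtain x0 where x0: "x0 \<in> S" using ne by blast
  have sup0: "0 \<le> (SUP x\<in>S. r x)" using cSUP_upper[OF x0 ba] r(1)[OF x0] by linarith
  show ?thesis
  proof (cases "(INF x\<in>S. r x) = 0")
    \<comment> \<open>A vanishing infimum of r forces that of s to vanish, and then both quotients
      are 0 by the convention for division by zero.\<close>
    case True
    have "(INF x\<in>S. s x) \<le> K * (INF x\<in>S. r x)"
    proof (cases "K = 0")
      case True
      then show ?thesis using cINF_lower[OF bs x0] s(1)[OF x0] by simp
    next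
      case False
      then have "(INF x\<in>S. s x) / K \<le> (INF x\<in>S. r x)"
      proof (intro cINF_greatest[OF ne])
        fix x assume x: "x \<in> S"
        show "(INF x\<in>S. s x) / K \<le> r x" using cINF_lower[OF bs x] s(1)[OF x] False K by (simp add: divide_le_eq mult.commute)
      qed
      then show ?thesis using False K by (simp add: divide_le_eq mult.commute)
    qed
    then have "(INF x\<in>S. s x) = 0" using low True by simp
    then show ?thesis using True by simp
  next
    case False
    then have ip: "(INF x\<in>S. r x) > 0" using i0 by simp
    have "(SUP x\<in>S. s x) / (INF x\<in>S. s x) \<le> (K * (SUP x\<in>S. r x)) / ((INF x\<in>S. r x) / 2)"
      using up low ip K sup0 by (intro frac_le) auto
    then show ?thesis by (simp add: mult_ac)
  qed
qed

theorem proposition6p11: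
  fixes \<Omega> :: "'a::euclidean_space set"
    and T :: "nat \<Rightarrow> 'a set set"
    and J :: nat
    and \<gamma> c1 c2 \<rho> \<sigma> C0 :: real
  defines "V \<equiv> fe_space \<Omega> (T J)"
  assumes "convex_polyhedral_domain \<Omega>"
    and "1 \<le> J"
    and "\<forall>l\<in>{1..J}. triangulation_of \<Omega> (T l)"
    and "\<forall>l\<in>{2..J}. is_refinement (T l) (T (l - 1))"
    and "0 < \<gamma>" and "\<gamma> < 1" and "0 < c1" and "c1 \<le> c2"
    and "\<forall>l\<in>{1..J}. c1 * \<gamma> ^ (2 * l) \<le> mesh_size (T l) \<and> mesh_size (T l) \<le> c2 * \<gamma> ^ (2 * l)"
    and "0 < \<rho>" and "0 < \<sigma>" and "0 < C0"
    and "condition_T \<Omega> (T J) \<rho> \<sigma> C0"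
  shows "(\<forall>v\<in>V. 1 / 2 * l2_inner \<Omega> (B_op \<Omega> T J v) v \<le> l2_inner \<Omega> (B_Jac \<Omega> T J v) v \<and>
            l2_inner \<Omega> (B_Jac \<Omega> T J v) v \<le> (real DIM('a) + 2) / 2 * l2_inner \<Omega> (B_op \<Omega> T J v) v) \<and>
         (nonzero_elements \<Omega> V \<noteq> {} \<longrightarrow>
            kappa \<Omega> V (B_Jac \<Omega> T J) (A_op \<Omega> V)
              \<le> (real DIM('a) + 2) * kappa \<Omega> V (B_op \<Omega> T J) (A_op \<Omega> V))"
proof -
  let ?in = "l2_inner \<Omega>" and ?B = "B_op \<Omega> T J" and ?Bj = "B_Jac \<Omega> T J"
  define K where "K = (real DIM('a) + 2) / 2"
  have K0: "0 \<le> K" by (simp add: K_def)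
  have dom: "bounded \<Omega>" "open \<Omega>" "convex \<Omega>" using assms(2) by (auto simp: convex_polyhedral_domain_def)
  have mesh: "mesh \<Omega> (T l)" if "l \<in> {1..J}" for l
    using dom assms(4) that by (auto simp: mesh_def)
  have J: "J \<in> {1..J}" using assms(3) by simp
  interpret MJ: mesh \<Omega> "T J" by (rule mesh[OF J])
  note VL = MJ.fe_subset_L2[folded V_def] and Vsub = MJ.fsubspace_fe[folded V_def]
  define h where "h = (\<lambda>l. (mesh_size (T l))\<^sup>2)"
  have h0: "0 \<le> h l" for l by (simp add: h_def)
  have "0 < c1 * \<gamma> ^ (2 * J)" using assms(6,8) by simp
  then have "0 < mesh_size (T J)" using assms(10) J by force
  then have hJ: "0 < h J" by (simp add: h_def)
  \<comment> \<open>A function that is affine on each coarse simplex is affine on every fine simplex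
    contained in it, so refinement from level l up to J gives the inclusion.\<close>
  have nested: "fe_space \<Omega> (T l) \<subseteq> V" if "l \<in> {1..J}" for l
  proof -
    have "l \<le> J" "1 \<le> l" using that by auto
    then show ?thesis
    proof (induction rule: inc_induct)
      case base
      then show ?case by (simp add: V_def)
    next
      case (step n)
      have "is_refinement (T (Suc n)) (T n)" using assms(5) step by (auto dest!: bspec[of _ _ "Suc n"])
      then have "fe_space \<Omega> (T n) \<subseteq> fe_space \<Omega> (T (Suc n))"
        unfolding fe_space_def is_refinement_def by (fastforce simp: subset_iff)
      then show ?case using step by auto
    qed
  qed
  define Q where "Q = (\<lambda>l. l2_proj \<Omega> (fe_space \<Omega> (T l)))"
  define N where "N = (\<lambda>l. interior_vertices \<Omega> (T l))"
  define P where "P = (\<lambda>l a. l2_proj \<Omega> (fun_span (nodal_basis_fun \<Omega> (T l) a)))"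
  have QV: "Q l v \<in> V" if "l \<in> {1..J}" "v \<in> L2 \<Omega>" for l v
    using mesh.proj_spec(1)[OF mesh[OF that(1)] that(2)] nested[OF that(1)] by (auto simp: Q_def)
  have PV: "P l a v \<in> V" if "l \<in> {1..J}" "a \<in> N l" "v \<in> L2 \<Omega>" for l a v
    using mesh.nproj_spec(1)[OF mesh[OF that(1)] that(2)[unfolded N_def] that(3)]
      mesh.fun_span_fe[OF mesh[OF that(1)] that(2)[unfolded N_def]] nested[OF that(1)] by (auto simp: P_def)
  define b where "b = (\<lambda>u v. \<Sum>l\<in>{1..J}. h l * ?in (Q l u) v)"
  \<comment> \<open>The factor 1 gives the inner sum the weighted shape of
    \<open>psd_form_sum\<close> and \<open>psd_form_sum_left\<close>.\<close>
  define bj where "bj = (\<lambda>u v. \<Sum>l\<in>{1..J}. h l * (\<Sum>a\<in>N l. 1 * ?in (P l a u) v))"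
  have SV: "(\<lambda>x. \<Sum>a\<in>N l. 1 *\<^sub>R P l a v x) \<in> V" if "l \<in> {1..J}" "v \<in> L2 \<Omega>" for l v
    using PV that by (intro fsubspace_sum[OF Vsub]) auto
  have BV: "?B v \<in> V" if "v \<in> L2 \<Omega>" for v
    using fsubspace_sum[OF Vsub, where I="{1..J}" and f="\<lambda>l. Q l v" and c=h] QV that by (simp add: B_op_def Q_def h_def)
  have BjV: "?Bj v \<in> V" if "v \<in> L2 \<Omega>" for v
    using fsubspace_sum[OF Vsub, where I="{1..J}" and f="\<lambda>l x. \<Sum>a\<in>N l. 1 *\<^sub>R P l a v x" and c=h] SV that by (simp add: B_Jac_def P_def N_def h_def)
  have Bb: "?in (?B u) v = b u v" if "u \<in> L2 \<Omega>" "v \<in> L2 \<Omega>" for u v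
  proof -
    have "Q l u \<in> L2 \<Omega>" if "l \<in> {1..J}" for l using QV that \<open>u \<in> L2 \<Omega>\<close> VL by blast
    with psd_form_sum_left[OF psd_form_l2_inner fsubspace_L2 _ that(2), where I="{1..J}" and f="\<lambda>l. Q l u" and c=h]
    show ?thesis by (simp add: b_def B_op_def Q_def h_def)
  qed
  have Bjb: "?in (?Bj u) v = bj u v" if "u \<in> L2 \<Omega>" "v \<in> L2 \<Omega>" for u v
  proof -
    have S: "(\<lambda>x. \<Sum>a\<in>N l. 1 *\<^sub>R P l a u x) \<in> L2 \<Omega>" if "l \<in> {1..J}" for l using SV[OF that \<open>u \<in> L2 \<Omega>\<close>] VL by blast
    have "?in (\<lambda>x. \<Sum>a\<in>N l. 1 *\<^sub>R P l a u x) v = (\<Sum>a\<in>N l. 1 * ?in (P l a u) v)" if "l \<in> {1..J}" for l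
      by (rule psd_form_sum_left[OF psd_form_l2_inner fsubspace_L2 _ \<open>v \<in> L2 \<Omega>\<close>])
         (use PV[OF that _ \<open>u \<in> L2 \<Omega>\<close>] VL in blast)
    moreover have "?in (\<lambda>x. \<Sum>l\<in>{1..J}. h l *\<^sub>R (\<Sum>a\<in>N l. 1 *\<^sub>R P l a u x)) v =
      (\<Sum>l\<in>{1..J}. h l * ?in (\<lambda>x. \<Sum>a\<in>N l. 1 *\<^sub>R P l a u x) v)"
      by (rule psd_form_sum_left[OF psd_form_l2_inner fsubspace_L2 S that(2)])
    ultimately have "?in (\<lambda>x. \<Sum>l\<in>{1..J}. h l *\<^sub>R (\<Sum>a\<in>N l. 1 *\<^sub>R P l a u x)) v = bj u v"
      by (simp add: bj_def)
    then show ?thesis by (simp add: B_Jac_def P_def N_def h_def)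
  qed
  have bform: "psd_form (L2 \<Omega>) b" unfolding b_def Q_def
    by (rule psd_form_sum[OF mesh.proj_form[OF mesh] h0])
  have bjform: "psd_form (L2 \<Omega>) bj" unfolding bj_def P_def
    by (intro psd_form_sum h0) (use mesh.nproj_form[OF mesh] in \<open>auto simp: N_def\<close>)
  have lower: "1/2 * b v v \<le> bj v v" and upper: "bj v v \<le> K * b v v" if v: "v \<in> L2 \<Omega>" for v
  proof -
    have l1: "1/2 * ?in (Q l v) v \<le> (\<Sum>a\<in>N l. 1 * ?in (P l a v) v)"
      and l2: "(\<Sum>a\<in>N l. 1 * ?in (P l a v) v) \<le> K * ?in (Q l v) v" if "l \<in> {1..J}" for l
      using mesh.level_equivalence[OF mesh[OF that] v] by (simp_all add: Q_def P_def N_def K_def)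
    have "1/2 * b v v = (\<Sum>l\<in>{1..J}. h l * (1/2 * ?in (Q l v) v))" by (simp add: b_def sum_distrib_left)
    also have "\<dots> \<le> bj v v" unfolding bj_def by (intro sum_mono mult_left_mono l1 h0)
    finally show "1/2 * b v v \<le> bj v v" .
    have "bj v v \<le> (\<Sum>l\<in>{1..J}. h l * (K * ?in (Q l v) v))" unfolding bj_def by (intro sum_mono mult_left_mono l2 h0)
    also have "\<dots> = K * b v v" by (simp add: b_def sum_distrib_left mult_ac)
    finally show "bj v v \<le> K * b v v" .
  qed
  have part1: "\<forall>v\<in>V. 1 / 2 * ?in (?B v) v \<le> ?in (?Bj v) v \<and> ?in (?Bj v) v \<le> (real DIM('a) + 2) / 2 * ?in (?B v) v"
    using lower upper Bb Bjb VL unfolding K_def by (metis subsetD)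
  note bV = psd_form_subset[OF bform VL] and bjV = psd_form_subset[OF bjform VL]
  \<comment> \<open>The finest level alone already controls v, because the projection onto V leaves
    the form unchanged on V. This makes both preconditioners definite.\<close>
  have bpos: "h J * ?in v v \<le> b v v" if v: "v \<in> V" for v
  proof -
    have vL: "v \<in> L2 \<Omega>" using v VL by blast
    have "h J * ?in v v = h J * ?in (Q J v) v" using MJ.proj_on_fe v by (simp add: Q_def V_def)
    also have "\<dots> \<le> b v v" unfolding b_def
      using J h0 psd_formD(2)[OF mesh.proj_form[OF mesh] vL]
      by (intro member_le_sum[of J "{1..J}" "\<lambda>l. h l * ?in (Q l v) v"]) (auto simp: Q_def)
    finally show ?thesis .
  qed
  \<comment> \<open>Each projection has norm at most 1, so the weights add up; the summand 1 makes
    positivity immediate.\<close>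
  define CB where "CB = (\<Sum>l\<in>{1..J}. h l) + 1"
  have CB: "0 < CB" unfolding CB_def using h0 by (simp add: sum_nonneg add_nonneg_pos)
  have bup: "b v v \<le> CB * ?in v v" if v: "v \<in> V" for v
  proof -
    have vL: "v \<in> L2 \<Omega>" using v VL by blast
    have "b v v \<le> (\<Sum>l\<in>{1..J}. h l * ?in v v)" unfolding b_def Q_def
      by (intro sum_mono mult_left_mono h0 mesh.proj_le[OF mesh vL])
    also have "\<dots> = (\<Sum>l\<in>{1..J}. h l) * ?in v v" by (rule sum_distrib_right[symmetric])
    also have "\<dots> \<le> CB * ?in v v"
      using psd_formD(2)[OF psd_form_l2_inner vL] by (intro mult_right_mono) (auto simp: CB_def)
    finally show ?thesis .
  qed
  have bdef: "?in u u = 0" if "u \<in> V" "b u u = 0" for u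
    using bpos[OF that(1)] that(2) hJ psd_formD(2)[OF psd_form_l2_inner, of u] VL that(1)
    by (metis antisym mult_le_0_iff not_less subsetD)
  have bjdef: "?in u u = 0" if "u \<in> V" "bj u u = 0" for u
    using bdef[OF that(1)] lower[of u] that psd_formD(2)[OF bV that(1)] VL by auto
  define I where "I = op_inverse \<Omega> V ?B"
  define Ij where "Ij = op_inverse \<Omega> V ?Bj"
  have I: "I v \<in> V" "z \<in> V \<Longrightarrow> b (I v) z = ?in v z" if "v \<in> V" for v z
  proof -
    have MV: "?B u \<in> V" if "u \<in> V" for u using BV VL that by blast
    have mM: "?in (?B u) z = b u z" if "u \<in> V" "z \<in> V" for u z using Bb VL that by blast
    show "I v \<in> V" "z \<in> V \<Longrightarrow> b (I v) z = ?in v z"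
      using MJ.op_inverse_spec[folded V_def, OF bV MV mM bdef that] unfolding I_def by blast+
  qed
  have Ij: "Ij v \<in> V" "z \<in> V \<Longrightarrow> bj (Ij v) z = ?in v z" if "v \<in> V" for v z
  proof -
    have MV: "?Bj u \<in> V" if "u \<in> V" for u using BjV VL that by blast
    have mM: "?in (?Bj u) z = bj u z" if "u \<in> V" "z \<in> V" for u z using Bjb VL that by blast
    show "Ij v \<in> V" "z \<in> V \<Longrightarrow> bj (Ij v) z = ?in v z"
      using MJ.op_inverse_spec[folded V_def, OF bjV MV mM bjdef that] unfolding Ij_def by blast+
  qed
  define \<alpha> where "\<alpha> = (\<lambda>v. dirichlet_form \<Omega> v v)"
  define \<beta> where "\<beta> = (\<lambda>v. ?in (I v) v)"
  define \<beta>j where "\<beta>j = (\<lambda>v. ?in (Ij v) v)"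
  have \<beta>: "\<beta> v = b (I v) (I v)" and \<beta>j: "\<beta>j v = bj (Ij v) (Ij v)" if "v \<in> V" for v
    using I(2)[OF that I(1)[OF that]] Ij(2)[OF that Ij(1)[OF that]] by (simp_all add: \<beta>_def \<beta>j_def l2_inner_commute)
  \<comment> \<open>The level-wise comparison read for the inverses: K and 2 change sides.\<close>
  have cmp: "\<beta> v \<le> K * \<beta>j v" "\<beta>j v \<le> 2 * \<beta> v" if v: "v \<in> V" for v
  proof -
    note i = I(1)[OF v] and ij = Ij(1)[OF v]
    have iL: "I v \<in> L2 \<Omega>" "Ij v \<in> L2 \<Omega>" using i ij VL by auto
    show "\<beta> v \<le> K * \<beta>j v" unfolding \<beta>[OF v] \<beta>j[OF v]
    proof (rule inverse_form_le[OF Vsub bjV i ij])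
      show "bj (Ij v) (I v) = b (I v) (I v)" using Ij(2)[OF v i] I(2)[OF v i] by simp
    qed (use upper[OF iL(1)] psd_formD(2)[OF bV i] K0 in auto)
    show "\<beta>j v \<le> 2 * \<beta> v" unfolding \<beta>[OF v] \<beta>j[OF v]
    proof (rule inverse_form_le[OF Vsub bV ij i])
      show "b (I v) (Ij v) = bj (Ij v) (Ij v)" using Ij(2)[OF v ij] I(2)[OF v ij] by simp
    qed (use lower[OF iL(2)] psd_formD(2)[OF bjV ij] in auto)
  qed
  \<comment> \<open>The bound b \<le> CB (., .) read for inverses, with the identity as the second
    operator, so that v is its own solution.\<close>
  have \<beta>low: "?in v v \<le> CB * \<beta> v" if v: "v \<in> V" for v
  proof (rule inverse_form_le[where m = "\<lambda>u w. ?in u w" and m' = b and w = v and w' = "I v" and V = V, folded \<beta>[OF v]])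
    show "b (I v) v = ?in v v" by (rule I(2)[OF v v])
    show "0 \<le> ?in v v" using psd_formD(2)[OF psd_form_l2_inner] v VL by blast
  qed (use Vsub bV v I(1)[OF v] bup[OF v] CB in auto)
  obtain CD where CD: "CD > 0" "\<And>v. v \<in> V \<Longrightarrow> \<alpha> v \<le> CD * ?in v v"
    using MJ.dirichlet_bound by (auto simp: \<alpha>_def V_def)
  have \<alpha>0: "0 \<le> \<alpha> v" if "v \<in> V" for v
    using psd_formD(2)[OF MJ.psd_dirichlet_fe] that by (simp add: \<alpha>_def V_def)
  have A: "?in (A_op \<Omega> V v) v = \<alpha> v" if "v \<in> V" for v
    using MJ.A_op_spec that by (simp add: \<alpha>_def V_def)
  have part2: "kappa \<Omega> V ?Bj (A_op \<Omega> V) \<le> (real DIM('a) + 2) * kappa \<Omega> V ?B (A_op \<Omega> V)"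
    if ne: "nonzero_elements \<Omega> V \<noteq> {}"
  proof -
    let ?S = "nonzero_elements \<Omega> V"
    have S: "v \<in> V" "0 < ?in v v" if "v \<in> ?S" for v
    proof -
      show v: "v \<in> V" using that by (simp add: nonzero_elements_def)
      have "?in v v \<noteq> 0" using that MJ.l2_zero_ae v VL by (auto simp: nonzero_elements_def)
      then show "0 < ?in v v" using psd_formD(2)[OF psd_form_l2_inner, of v] v VL by force
    qed
    have pos: "0 < \<beta> v" "0 < \<beta>j v" if "v \<in> ?S" for v
    proof -
      have "0 < CB * \<beta> v" using S[OF that] \<beta>low by force
      then show "0 < \<beta> v" using CB by (simp add: zero_less_mult_iff)
      then have "0 < K * \<beta>j v" using cmp(1)[OF S(1)[OF that]] by linarith
      then show "0 < \<beta>j v" using K0 by (simp add: zero_less_mult_iff)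
    qed
    \<comment> \<open>Dividing the Dirichlet form by the two inverse forms turns their comparison
      into one of Rayleigh quotients. The continuity constants of A and B combine to the bound CD *
      CB.\<close>
    have "(SUP v\<in>?S. \<alpha> v / \<beta>j v) / (INF v\<in>?S. \<alpha> v / \<beta>j v) \<le> 2 * K * ((SUP v\<in>?S. \<alpha> v / \<beta> v) / (INF v\<in>?S. \<alpha> v / \<beta> v))"
    proof (rule sup_inf_ratio[OF ne, where C="CD * CB"])
      fix v assume v: "v \<in> ?S"
      note V = S(1)[OF v] and p = pos[OF v]
      show "0 \<le> \<alpha> v / \<beta> v" using \<alpha>0[OF V] p by simp
      have "\<alpha> v \<le> CD * (CB * \<beta> v)"
        using CD(2)[OF V] mult_left_mono[OF \<beta>low[OF V], of CD] CD(1) by linarith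
      then show "\<alpha> v / \<beta> v \<le> CD * CB" using p by (simp add: divide_le_eq mult.assoc)
      have "\<alpha> v * \<beta> v \<le> \<alpha> v * (K * \<beta>j v)" by (rule mult_left_mono[OF cmp(1)[OF V] \<alpha>0[OF V]])
      then show "\<alpha> v / \<beta>j v \<le> K * (\<alpha> v / \<beta> v)" using p by (simp add: field_simps)
      have "\<alpha> v * \<beta>j v \<le> \<alpha> v * (2 * \<beta> v)" by (rule mult_left_mono[OF cmp(2)[OF V] \<alpha>0[OF V]])
      then show "\<alpha> v / \<beta> v \<le> 2 * (\<alpha> v / \<beta>j v)" using p by (simp add: field_simps)
    qed (rule K0)
    moreover have "kappa \<Omega> V ?Bj (A_op \<Omega> V) = (SUP v\<in>?S. \<alpha> v / \<beta>j v) / (INF v\<in>?S. \<alpha> v / \<beta>j v)"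
      "kappa \<Omega> V ?B (A_op \<Omega> V) = (SUP v\<in>?S. \<alpha> v / \<beta> v) / (INF v\<in>?S. \<alpha> v / \<beta> v)"
      unfolding kappa_def \<beta>_def \<beta>j_def I_def Ij_def using A S(1) by (simp_all cong: image_cong)
    moreover have "2 * K = real DIM('a) + 2" by (simp add: K_def)
    ultimately show ?thesis by (simp only:)
  qed
  show ?thesis using part1 part2 by blast
qed

end
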